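(* Let $\Lambda$ be a gentle algebra over an algebraically closed field $\mathbf{k}$. Suppose $(\sigma,\lambda)$ and $(\tau,\mu)$ are homotopy bands and $f^\bullet \colon B^\bullet_{\sigma,\lambda} \to B^\bullet_{\tau,\mu}$ is a single map with single component $f$. Suppose that $\sigma = \beta\sigma_L\sigma_R\alpha$ and $\tau = \delta\tau_L\tau_R\gamma$ are compatibly oriented for $f^\bullet$. Then there exist a homotopy band $\theta$ and an integer $k \geq 1$ such that $$\theta^k = \beta\,\sigma_L\, f\,\overline{\tau_L}\,\overline{\delta}\,\overline{\gamma}\,\overline{\tau_R}\,\overline{f}\,\sigma_R\,\alpha$$ and the mapping cone of $f^\bullet$ satisfies $$M^\bullet_{f^\bullet} \cong \bigoplus_{i=1}^k B^\bullet_{\theta,\,\omega^i\sqrt[k]{-\lambda\mu^{-1}}},$$ where $\omega$ is a primitive $k$-th root of unity.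
   Context: **Gentle algebras.** $\Lambda=\mathbf{k}Q/I$ is a finite-dimensional algebra, with $Q$ a finite quiver, $I$ generated by paths of length 2, at most two arrows starting and at most two arrows ending at each vertex, and for each arrow $b$: at most one arrow $a$ with $ba$ a path not in $I$, at most one $a$ with $ba$ a path in $I$, at most one arrow $c$ with $cb$ a path not in $I$, and at most one $c$ with $cb$ a path in $I$. For a path or arrow $p$, $s(p)$ and $e(p)$ are its start and end; paths compose right to left ($qp$ is $p$ followed by $q$). $P(x)$ is the indecomposable projective at $x$; a path $p$ nonzero in $\Lambda$ induces a map $P(e(p))\to P(s(p))$, also denoted $p$; the path $qp$ induces the map "first $q$, then $p$", and products of maps below are written in this path order. **Homotopy strings and bands.** A direct homotopy letter is a nontrivial path $p$ nonzero in $\Lambda$; an inverse homotopy letter is a formal inverse $\overline p$, with $s(\overline p)=e(p)$, $e(\overline p)=s(p)$. A (finite) homotopy string is a trivial word at a vertex, or a word $\sigma=\sigma_n\cdots\sigma_1$ of homotopy letters with $s(\sigma_{i+1})=e(\sigma_i)$ such that for consecutive letters: if $\sigma_{i+1},\sigma_i$ are both direct, then $\sigma_{i+1}\sigma_i$ is zero because the length two path at the junction is in $I$; if both are inverse, the same holds for $\overline{\sigma_i}\,\overline{\sigma_{i+1}}$; if $\sigma_{i+1}=p$, $\sigma_i=\overline q$, then $p,q$ have different first arrows; if $\sigma_{i+1}=\overline p$, $\sigma_i=q$, then $p,q$ have different last arrows. $\sigma$ is drawn as a diagram labelled from left to right by $\sigma_n,\dots,\sigma_1$, a direct letter being an arrow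 $\rightarrow$ and an inverse letter an arrow $\leftarrow$; vertices carry cohomological degrees, arrows raising degree by one. $\overline\sigma$ is the inverse word. A homotopy band is a nontrivial finite homotopy string $\sigma$ starting and ending at the same vertex and in the same degree (equally many direct and inverse letters), such that $\sigma^2$ is a homotopy string whose letters are the letters of the two copies of $\sigma$ (no merging), and $\sigma$ is not a proper power; bands are considered up to rotation (cyclic permutation) and inversion. A pair $(\sigma,\lambda)$ with $\lambda\in\mathbf{k}^*$ is also called a homotopy band. Products of words are read as reduced walks, i.e. after cancelling $p\overline p$ and $\overline p p$. **Complexes.** For a band $\sigma$ and $\lambda\in\mathbf{k}^*$, the band complex $B^\bullet_{\sigma,\lambda}$ is the direct sum of the $P(x)$ over the vertices $x$ of the cyclic diagram of $\sigma$ (first and last vertex identified), placed in their degrees, with differential given by the letters, the scalar $\lambda$ multiplying one direct letter. The cohomological grading is suppressed in the notation: a complex attached to a word describing a mapping cone has the degrees inherited from the cone. The mapping cone $M^\bullet_{f^\bullet}$ of $f^\bullet\colon P^\bullet\to Q^\bullet$ is $\Sigma P^\bullet\oplus Q^\bullet$ with differential $\left[\begin{smallmatrix}-d_P&0\\ f&d_Q\end{smallmatrix}\right]$; isomorphisms are in the bounded derived category $\mathsf{D}^b(\Lambda)$. $\sqrt[k]{\nu}$ denotes some fixed $k$-th root of $\nu$. **Single maps.** A single map $f^\bullet\colon B^\bullet_{\sigma,\lambda}\to B^\bullet_{\tau,\mu}$ is a cochain map with exactly one nonzero component $f\colon P(x)\to P(y)$, given by a nontrivial path $f$, where $x$ is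 a vertex of the diagram of $\sigma$ and $y$ a vertex of the diagram of $\tau$ in the same degree. After rotation write $\sigma=\beta\sigma_L\sigma_R\alpha$, $\tau=\delta\tau_L\tau_R\gamma$, where $\sigma_L,\sigma_R$ are the homotopy letters immediately to the left and right of $x$ and $\tau_L,\tau_R$ those immediately to the left and right of $y$. Being a cochain map means: $\sigma_Lf=0$ if $\sigma_L$ is direct, $\overline{\sigma_R}f=0$ if $\sigma_R$ is inverse, $f\overline{\tau_L}=0$ if $\tau_L$ is inverse, and $f\tau_R=0$ if $\tau_R$ is direct. The single maps considered are the singleton single maps, i.e. those elements of the canonical basis of $\mathrm{Hom}_{\mathsf{D}^b(\Lambda)}(B^\bullet_{\sigma,\lambda},B^\bullet_{\tau,\mu})$ which are not null-homotopic and not homotopic to any other single or double map. For bands this means that, after possibly inverting $\sigma$ and/or $\tau$, $\sigma_R$ is direct with $\sigma_R=f\sigma_R'$ and $\tau_R$ is inverse with $\overline{\tau_R}=\tau_R'f$ for nontrivial paths $\sigma_R',\tau_R'$; when written in this way $\sigma$ and $\tau$ are compatibly oriented for $f^\bullet$. Then $\overline{\tau_R}\,\overline f\,\sigma_R$ reduces to the direct homotopy letter $\tau_R'f\sigma_R'$.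
   Formalization: The isomorphism is stated for every primitive k-th root of unity ω, so it says nothing when the characteristic of the field divides k, where no such ω exists and the formula is undefined (k = 2 does occur); θ and k are still asserted then. *)

theory Defs
  imports
    "Graph_Theory.Arc_Walk"
    "HOL-Library.Function_Algebras"
    "HOL-Computational_Algebra.Polynomial"
begin

section \<open>Gentle algebras\<close>

text \<open>
  A path is a pair of its start vertex and the list of its arrows, written from right to left: the
  path \<open>qp\<close> (\<open>p\<close> followed by \<open>q\<close>) has arrow list \<open>q @ p\<close>. Hence the first arrow of \<open>p\<close> is \<open>last p\<close>
  and its last arrow is \<open>hd p\<close>. The ideal is given by the set \<open>I\<close> of its generators, with
  \<open>(b, a) \<in> I\<close> standing for the path \<open>ba\<close> of length two.
\<close>

type_synonym ('v, 'a) path = "'v \<times> 'a list"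

definition is_path :: "('v, 'a) pre_digraph \<Rightarrow> ('v, 'a) path \<Rightarrow> bool" where
  "is_path Q p \<longleftrightarrow> (\<exists>y. pre_digraph.awalk Q (fst p) (rev (snd p)) y)"

definition path_end :: "('v, 'a) pre_digraph \<Rightarrow> ('v, 'a) path \<Rightarrow> 'v" where
  "path_end Q p = (if snd p = [] then fst p else head Q (hd (snd p)))"

definition nonzero_path :: "('v, 'a) pre_digraph \<Rightarrow> ('a \<times> 'a) set \<Rightarrow> ('v, 'a) path \<Rightarrow> bool" where
  "nonzero_path Q I p \<longleftrightarrow> is_path Q p \<and> successively (\<lambda>b a. (b, a) \<notin> I) (snd p)"

locale gentle_algebra = fin_digraph Q for Q :: "('v, 'a) pre_digraph" +
  fixes I :: "('a \<times> 'a) set"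
  assumes rel_paths:
      "(b, a) \<in> I \<Longrightarrow> b \<in> arcs Q \<and> a \<in> arcs Q \<and> head Q a = tail Q b"
    and finite_dimensional: "finite {p. nonzero_path Q I p}"
    and out_arrows: "x \<in> verts Q \<Longrightarrow> card {a \<in> arcs Q. tail Q a = x} \<le> 2"
    and in_arrows: "x \<in> verts Q \<Longrightarrow> card {a \<in> arcs Q. head Q a = x} \<le> 2"
    and before_nonrel:
      "b \<in> arcs Q \<Longrightarrow> card {a \<in> arcs Q. head Q a = tail Q b \<and> (b, a) \<notin> I} \<le> 1"
    and before_rel:
      "b \<in> arcs Q \<Longrightarrow> card {a \<in> arcs Q. head Q a = tail Q b \<and> (b, a) \<in> I} \<le> 1"
    and after_nonrel:
      "b \<in> arcs Q \<Longrightarrow> card {c \<in> arcs Q. head Q b = tail Q c \<and> (c, b) \<notin> I} \<le> 1"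
    and after_rel:
      "b \<in> arcs Q \<Longrightarrow> card {c \<in> arcs Q. head Q b = tail Q c \<and> (c, b) \<in> I} \<le> 1"

text \<open>
  As \<open>I\<close> consists of paths, the paths without a factor in \<open>I\<close> form a basis of
  \<open>\<Lambda> = kQ/I\<close>. An element of \<open>\<Lambda>\<close> is written as its family of coefficients in this basis; the product
  of two basis paths is their concatenation if that is a nonzero path, and zero otherwise.
\<close>

type_synonym ('v, 'a, 'k) alg = "('v, 'a) path \<Rightarrow> 'k"

definition alg_carrier ::
    "('v, 'a) pre_digraph \<Rightarrow> ('a \<times> 'a) set \<Rightarrow> ('v, 'a, 'k::field) alg set" where
  "alg_carrier Q I = {a. \<forall>p. \<not> nonzero_path Q I p \<longrightarrow> a p = 0}"

definition alg_one :: "('v, 'a) pre_digraph \<Rightarrow> ('v, 'a, 'k::field) alg" where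
  "alg_one Q = (\<lambda>(x, as). if x \<in> verts Q \<and> as = [] then 1 else 0)"

definition alg_mult :: "('v, 'a) pre_digraph \<Rightarrow> ('a \<times> 'a) set \<Rightarrow>
    ('v, 'a, 'k::field) alg \<Rightarrow> ('v, 'a, 'k) alg \<Rightarrow> ('v, 'a, 'k) alg" where
  "alg_mult Q I a b = (\<lambda>(x, as). if nonzero_path Q I (x, as)
     then (\<Sum>i\<le>length as. a (path_end Q (x, drop i as), take i as) * b (x, drop i as))
     else 0)"

definition alg_path :: "('v, 'a) path \<Rightarrow> ('v, 'a, 'k::field) alg" where
  "alg_path p = (\<lambda>q. if q = p then 1 else 0)"

section \<open>Modules\<close>

text \<open>
  All modules live in one vector space of functions on labels, so that the objects of the derived
  category form a single type. Functions vanishing outside \<open>Tag 0 l, \<dots>, Tag (n - 1) l\<close> for a fixed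
  label \<open>l\<close> form an \<open>n\<close>-dimensional subspace, so every finite-dimensional module is isomorphic
  to one considered here. Projectives use the labels \<open>Pth p\<close>; \<open>Tag i\<close> marks the \<open>i\<close>-th summand of
  a direct sum.
\<close>

datatype ('v, 'a) label = Pth "('v, 'a) path" | Tag nat "('v, 'a) label"

type_synonym ('v, 'a, 'k) vec = "('v, 'a) label \<Rightarrow> 'k"

definition vscale :: "'k::field \<Rightarrow> ('v, 'a, 'k) vec \<Rightarrow> ('v, 'a, 'k) vec" where
  "vscale c v = (\<lambda>l. c * v l)"

global_interpretation vec: vector_space "vscale :: 'k::field \<Rightarrow> ('v, 'a, 'k) vec \<Rightarrow> ('v, 'a, 'k) vec"
  by unfold_locales (auto simp: vscale_def fun_eq_iff algebra_simps)

record ('v, 'a, 'k) lmod =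
  mcar :: "('v, 'a, 'k) vec set"
  mact :: "('v, 'a, 'k) alg \<Rightarrow> ('v, 'a, 'k) vec \<Rightarrow> ('v, 'a, 'k) vec"

text \<open>Finite-dimensional left \<open>\<Lambda>\<close>-modules and their homomorphisms.\<close>

definition is_module ::
    "('v, 'a) pre_digraph \<Rightarrow> ('a \<times> 'a) set \<Rightarrow> ('v, 'a, 'k::field) lmod \<Rightarrow> bool" where
  "is_module Q I M \<longleftrightarrow>
     vec.subspace (mcar M) \<and>
     (\<exists>B. finite B \<and> mcar M \<subseteq> vec.span B) \<and>
     (\<forall>a\<in>alg_carrier Q I. \<forall>v\<in>mcar M.
        mact M a v \<in> mcar M \<and>
        (\<forall>w\<in>mcar M. mact M a (v + w) = mact M a v + mact M a w) \<and>
        (\<forall>b\<in>alg_carrier Q I. mact M (a + b) v = mact M a v + mact M b v) \<and>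
        (\<forall>c. mact M a (vscale c v) = vscale c (mact M a v)) \<and>
        (\<forall>c. mact M (\<lambda>p. c * a p) v = vscale c (mact M a v)) \<and>
        (\<forall>b\<in>alg_carrier Q I. mact M (alg_mult Q I a b) v = mact M a (mact M b v))) \<and>
     (\<forall>v\<in>mcar M. mact M (alg_one Q) v = v)"

definition is_hom :: "('v, 'a) pre_digraph \<Rightarrow> ('a \<times> 'a) set \<Rightarrow>
    ('v, 'a, 'k::field) lmod \<Rightarrow> ('v, 'a, 'k) lmod \<Rightarrow>
    (('v, 'a, 'k) vec \<Rightarrow> ('v, 'a, 'k) vec) \<Rightarrow> bool" where
  "is_hom Q I M N h \<longleftrightarrow>
     (\<forall>v\<in>mcar M. h v \<in> mcar N \<and>
        (\<forall>w\<in>mcar M. h (v + w) = h v + h w) \<and>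
        (\<forall>c. h (vscale c v) = vscale c (h v)) \<and>
        (\<forall>a\<in>alg_carrier Q I. h (mact M a v) = mact N a (h v)))"

definition summand :: "nat \<Rightarrow> ('v, 'a, 'k::field) vec \<Rightarrow> ('v, 'a, 'k) vec" where
  "summand i v = (\<lambda>l. v (Tag i l))"

definition inject :: "nat \<Rightarrow> ('v, 'a, 'k::field) vec \<Rightarrow> ('v, 'a, 'k) vec" where
  "inject i v = (\<lambda>l. case l of Pth p \<Rightarrow> 0 | Tag j l' \<Rightarrow> if j = i then v l' else 0)"

definition dsum :: "nat set \<Rightarrow> (nat \<Rightarrow> ('v, 'a, 'k::field) lmod) \<Rightarrow> ('v, 'a, 'k) lmod" where
  "dsum S M = \<lparr>
     mcar = {v. (\<forall>l. v l \<noteq> 0 \<longrightarrow> (\<exists>i\<in>S. \<exists>l'. l = Tag i l')) \<and> (\<forall>i\<in>S. summand i v \<in> mcar (M i))},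
     mact = (\<lambda>a v. \<Sum>i\<in>S. inject i (mact (M i) a (summand i v)))\<rparr>"

definition alg_of_vec :: "('v, 'a, 'k::field) vec \<Rightarrow> ('v, 'a, 'k) alg" where
  "alg_of_vec v = (\<lambda>p. v (Pth p))"

definition vec_of_alg :: "('v, 'a, 'k::field) alg \<Rightarrow> ('v, 'a, 'k) vec" where
  "vec_of_alg a = (\<lambda>l. case l of Pth p \<Rightarrow> a p | Tag i l' \<Rightarrow> 0)"

text \<open>
  \<open>P(x)\<close> is the left module \<open>\<Lambda>e\<^sub>x\<close>, with basis the nonzero paths starting at \<open>x\<close>. A path \<open>p\<close>
  induces the map \<open>P(e(p)) \<rightarrow> P(s(p))\<close> given by right multiplication with \<open>p\<close>.
\<close>

definition proj :: "('v, 'a) pre_digraph \<Rightarrow> ('a \<times> 'a) set \<Rightarrow> 'v \<Rightarrow> ('v, 'a, 'k::field) lmod" where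
  "proj Q I x = \<lparr>
     mcar = vec_of_alg ` {u \<in> alg_carrier Q I. \<forall>p. u p \<noteq> 0 \<longrightarrow> fst p = x},
     mact = (\<lambda>a v. vec_of_alg (alg_mult Q I a (alg_of_vec v)))\<rparr>"

definition path_map :: "('v, 'a) pre_digraph \<Rightarrow> ('a \<times> 'a) set \<Rightarrow> ('v, 'a) path \<Rightarrow>
    ('v, 'a, 'k::field) vec \<Rightarrow> ('v, 'a, 'k) vec" where
  "path_map Q I p v = vec_of_alg (alg_mult Q I (alg_of_vec v) (alg_path p))"

section \<open>Complexes and the bounded derived category\<close>

record ('v, 'a, 'k) cpx =
  cob :: "int \<Rightarrow> ('v, 'a, 'k) lmod"
  cdf :: "int \<Rightarrow> ('v, 'a, 'k) vec \<Rightarrow> ('v, 'a, 'k) vec"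

type_synonym ('v, 'a, 'k) cmap = "int \<Rightarrow> ('v, 'a, 'k) vec \<Rightarrow> ('v, 'a, 'k) vec"

definition bounded_complex ::
    "('v, 'a) pre_digraph \<Rightarrow> ('a \<times> 'a) set \<Rightarrow> ('v, 'a, 'k::field) cpx \<Rightarrow> bool" where
  "bounded_complex Q I X \<longleftrightarrow>
     (\<forall>n. is_module Q I (cob X n)) \<and>
     (\<forall>n. is_hom Q I (cob X n) (cob X (n + 1)) (cdf X n)) \<and>
     (\<forall>n. \<forall>v\<in>mcar (cob X n). cdf X (n + 1) (cdf X n v) = 0) \<and>
     finite {n. mcar (cob X n) \<noteq> {0}}"

definition chain_map :: "('v, 'a) pre_digraph \<Rightarrow> ('a \<times> 'a) set \<Rightarrow>
    ('v, 'a, 'k::field) cpx \<Rightarrow> ('v, 'a, 'k) cpx \<Rightarrow> ('v, 'a, 'k) cmap \<Rightarrow> bool" where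
  "chain_map Q I X Y f \<longleftrightarrow>
     (\<forall>n. is_hom Q I (cob X n) (cob Y n) (f n)) \<and>
     (\<forall>n. \<forall>v\<in>mcar (cob X n). f (n + 1) (cdf X n v) = cdf Y n (f n v))"

definition cmap_id :: "('v, 'a, 'k) cmap" where
  "cmap_id = (\<lambda>n v. v)"

definition cmap_comp :: "('v, 'a, 'k) cmap \<Rightarrow> ('v, 'a, 'k) cmap \<Rightarrow> ('v, 'a, 'k) cmap" where
  "cmap_comp g f = (\<lambda>n v. g n (f n v))"

definition homotopic :: "('v, 'a) pre_digraph \<Rightarrow> ('a \<times> 'a) set \<Rightarrow>
    ('v, 'a, 'k::field) cpx \<Rightarrow> ('v, 'a, 'k) cpx \<Rightarrow> ('v, 'a, 'k) cmap \<Rightarrow> ('v, 'a, 'k) cmap \<Rightarrow> bool" where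
  "homotopic Q I X Y f g \<longleftrightarrow>
     (\<exists>h. (\<forall>n. is_hom Q I (cob X n) (cob Y (n - 1)) (h n)) \<and>
          (\<forall>n. \<forall>v\<in>mcar (cob X n). f n v - g n v = cdf Y (n - 1) (h n v) + h (n + 1) (cdf X n v)))"

definition cocycles :: "('v, 'a, 'k::field) cpx \<Rightarrow> int \<Rightarrow> ('v, 'a, 'k) vec set" where
  "cocycles X n = {v \<in> mcar (cob X n). cdf X n v = 0}"

definition coboundaries :: "('v, 'a, 'k::field) cpx \<Rightarrow> int \<Rightarrow> ('v, 'a, 'k) vec set" where
  "coboundaries X n = cdf X (n - 1) ` mcar (cob X (n - 1))"

text \<open>The two clauses after the first say that the maps induced on cohomology are injective and
  surjective.\<close>

definition quasi_iso :: "('v, 'a) pre_digraph \<Rightarrow> ('a \<times> 'a) set \<Rightarrow>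
    ('v, 'a, 'k::field) cpx \<Rightarrow> ('v, 'a, 'k) cpx \<Rightarrow> ('v, 'a, 'k) cmap \<Rightarrow> bool" where
  "quasi_iso Q I X Y f \<longleftrightarrow> chain_map Q I X Y f \<and>
     (\<forall>n. \<forall>v\<in>cocycles X n. f n v \<in> coboundaries Y n \<longrightarrow> v \<in> coboundaries X n) \<and>
     (\<forall>n. \<forall>w\<in>cocycles Y n. \<exists>v\<in>cocycles X n. w - f n v \<in> coboundaries Y n)"

text \<open>
  The derived category is the localisation of the homotopy category of bounded complexes of
  finite-dimensional modules at the quasi-isomorphisms: a morphism \<open>X \<rightarrow> Y\<close> is
  represented by a roof \<open>X \<leftarrow> Z \<rightarrow> Y\<close>, whose left leg is a quasi-isomorphism.
\<close>

type_synonym ('v, 'a, 'k) roof = "('v, 'a, 'k) cpx \<times> ('v, 'a, 'k) cmap \<times> ('v, 'a, 'k) cmap"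

definition is_roof :: "('v, 'a) pre_digraph \<Rightarrow> ('a \<times> 'a) set \<Rightarrow>
    ('v, 'a, 'k::field) cpx \<Rightarrow> ('v, 'a, 'k) cpx \<Rightarrow> ('v, 'a, 'k) roof \<Rightarrow> bool" where
  "is_roof Q I X Y = (\<lambda>(Z, s, t).
     bounded_complex Q I Z \<and> quasi_iso Q I Z X s \<and> chain_map Q I Z Y t)"

definition roof_id :: "('v, 'a, 'k) cpx \<Rightarrow> ('v, 'a, 'k) roof" where
  "roof_id X = (X, cmap_id, cmap_id)"

definition roof_equiv :: "('v, 'a) pre_digraph \<Rightarrow> ('a \<times> 'a) set \<Rightarrow>
    ('v, 'a, 'k::field) cpx \<Rightarrow> ('v, 'a, 'k) cpx \<Rightarrow> ('v, 'a, 'k) roof \<Rightarrow> ('v, 'a, 'k) roof \<Rightarrow> bool" where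
  "roof_equiv Q I X Y = (\<lambda>(Z, s, t) (Z', s', t').
     \<exists>W u u'. bounded_complex Q I W \<and> chain_map Q I W Z u \<and> chain_map Q I W Z' u' \<and>
       quasi_iso Q I W X (cmap_comp s u) \<and>
       homotopic Q I W X (cmap_comp s u) (cmap_comp s' u') \<and>
       homotopic Q I W Y (cmap_comp t u) (cmap_comp t' u'))"

text \<open>\<open>is_composite Q I Y \<phi> \<psi> \<chi>\<close>: the roof \<open>\<chi>\<close> represents \<open>\<phi>\<close> followed by \<open>\<psi>\<close>, where \<open>Y\<close> is the target
  of \<open>\<phi>\<close> and the source of \<open>\<psi>\<close>.\<close>

definition is_composite :: "('v, 'a) pre_digraph \<Rightarrow> ('a \<times> 'a) set \<Rightarrow> ('v, 'a, 'k::field) cpx \<Rightarrow>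
    ('v, 'a, 'k) roof \<Rightarrow> ('v, 'a, 'k) roof \<Rightarrow> ('v, 'a, 'k) roof \<Rightarrow> bool" where
  "is_composite Q I Y = (\<lambda>(Z, s, t) (Z', s', t') \<chi>.
     \<exists>W u v. bounded_complex Q I W \<and> quasi_iso Q I W Z u \<and> chain_map Q I W Z' v \<and>
       homotopic Q I W Y (cmap_comp t u) (cmap_comp s' v) \<and>
       \<chi> = (W, cmap_comp s u, cmap_comp t' v))"

definition derived_iso :: "('v, 'a) pre_digraph \<Rightarrow> ('a \<times> 'a) set \<Rightarrow>
    ('v, 'a, 'k::field) cpx \<Rightarrow> ('v, 'a, 'k) cpx \<Rightarrow> bool" where
  "derived_iso Q I X Y \<longleftrightarrow> bounded_complex Q I X \<and> bounded_complex Q I Y \<and>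
     (\<exists>\<phi> \<psi> \<chi> \<chi>'. is_roof Q I X Y \<phi> \<and> is_roof Q I Y X \<psi> \<and>
        is_composite Q I Y \<phi> \<psi> \<chi> \<and> roof_equiv Q I X X \<chi> (roof_id X) \<and>
        is_composite Q I X \<psi> \<phi> \<chi>' \<and> roof_equiv Q I Y Y \<chi>' (roof_id Y))"

definition cpx_dsum :: "nat set \<Rightarrow> (nat \<Rightarrow> ('v, 'a, 'k::field) cpx) \<Rightarrow> ('v, 'a, 'k) cpx" where
  "cpx_dsum S X = \<lparr>
     cob = (\<lambda>n. dsum S (\<lambda>i. cob (X i) n)),
     cdf = (\<lambda>n v. \<Sum>i\<in>S. inject i (cdf (X i) n (summand i v)))\<rparr>"

text \<open>Summand \<open>0\<close> of the cone of \<open>f : X \<rightarrow> Y\<close> is \<open>\<Sigma>X\<close>, summand \<open>1\<close> is \<open>Y\<close>.\<close>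

definition cone :: "('v, 'a, 'k::field) cpx \<Rightarrow> ('v, 'a, 'k) cpx \<Rightarrow> ('v, 'a, 'k) cmap \<Rightarrow>
    ('v, 'a, 'k) cpx" where
  "cone X Y f = \<lparr>
     cob = (\<lambda>n. dsum {0, 1} (\<lambda>i. if i = 0 then cob X (n + 1) else cob Y n)),
     cdf = (\<lambda>n v. inject 0 (- cdf X (n + 1) (summand 0 v)) +
                  inject 1 (f (n + 1) (summand 0 v) + cdf Y n (summand 1 v)))\<rparr>"

section \<open>Homotopy strings and bands\<close>

text \<open>
  A letter is given by its arrow list. A word is the list of its letters from left to right as it
  is written, so \<open>\<sigma>\<^sub>n \<dots> \<sigma>\<^sub>1\<close> has head \<open>\<sigma>\<^sub>n\<close>.
\<close>

datatype 'a letter = Direct "'a list" | Inverse "'a list"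

fun letter_path :: "'a letter \<Rightarrow> 'a list" where
  "letter_path (Direct p) = p"
| "letter_path (Inverse p) = p"

fun is_direct :: "'a letter \<Rightarrow> bool" where
  "is_direct (Direct p) = True"
| "is_direct (Inverse p) = False"

fun letter_inv :: "'a letter \<Rightarrow> 'a letter" where
  "letter_inv (Direct p) = Inverse p"
| "letter_inv (Inverse p) = Direct p"

definition word_inv :: "'a letter list \<Rightarrow> 'a letter list" where
  "word_inv w = rev (map letter_inv w)"

definition word_power :: "'a letter list \<Rightarrow> nat \<Rightarrow> 'a letter list" where
  "word_power w k = concat (replicate k w)"

definition arrows_start :: "('v, 'a) pre_digraph \<Rightarrow> 'a list \<Rightarrow> 'v" where
  "arrows_start Q p = tail Q (last p)"

definition arrows_end :: "('v, 'a) pre_digraph \<Rightarrow> 'a list \<Rightarrow> 'v" where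
  "arrows_end Q p = head Q (hd p)"

definition nontrivial_nonzero ::
    "('v, 'a) pre_digraph \<Rightarrow> ('a \<times> 'a) set \<Rightarrow> 'a list \<Rightarrow> bool" where
  "nontrivial_nonzero Q I p \<longleftrightarrow> p \<noteq> [] \<and> nonzero_path Q I (arrows_start Q p, p)"

fun letter_start :: "('v, 'a) pre_digraph \<Rightarrow> 'a letter \<Rightarrow> 'v" where
  "letter_start Q (Direct p) = arrows_start Q p"
| "letter_start Q (Inverse p) = arrows_end Q p"

fun letter_end :: "('v, 'a) pre_digraph \<Rightarrow> 'a letter \<Rightarrow> 'v" where
  "letter_end Q (Direct p) = arrows_end Q p"
| "letter_end Q (Inverse p) = arrows_start Q p"

fun junction :: "('a \<times> 'a) set \<Rightarrow> 'a letter \<Rightarrow> 'a letter \<Rightarrow> bool" where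
  "junction I (Direct p) (Direct q) \<longleftrightarrow> (last p, hd q) \<in> I"
| "junction I (Inverse p) (Inverse q) \<longleftrightarrow> (last q, hd p) \<in> I"
| "junction I (Direct p) (Inverse q) \<longleftrightarrow> last p \<noteq> last q"
| "junction I (Inverse p) (Direct q) \<longleftrightarrow> hd p \<noteq> hd q"

text \<open>Nontrivial finite homotopy strings; the trivial ones play no role for bands.\<close>

definition homotopy_string ::
    "('v, 'a) pre_digraph \<Rightarrow> ('a \<times> 'a) set \<Rightarrow> 'a letter list \<Rightarrow> bool" where
  "homotopy_string Q I w \<longleftrightarrow> w \<noteq> [] \<and>
     (\<forall>l\<in>set w. nontrivial_nonzero Q I (letter_path l)) \<and>
     successively (\<lambda>l r. letter_start Q l = letter_end Q r \<and> junction I l r) w"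

definition homotopy_band ::
    "('v, 'a) pre_digraph \<Rightarrow> ('a \<times> 'a) set \<Rightarrow> 'a letter list \<Rightarrow> bool" where
  "homotopy_band Q I w \<longleftrightarrow> homotopy_string Q I w \<and>
     letter_start Q (last w) = letter_end Q (hd w) \<and>
     length (filter is_direct w) = length (filter (\<lambda>l. \<not> is_direct l) w) \<and>
     homotopy_string Q I (w @ w) \<and>
     \<not> (\<exists>u m. 2 \<le> m \<and> w = word_power u m)"

text \<open>
  The walk of a word lists its arrows with exponent \<open>True\<close> and formal inverses of arrows with exponent
  \<open>False\<close>. Two homotopy strings with the same walk are equal, since a homotopy string is cut exactly
  where the direction changes or a relation occurs; so an equation between words read as reduced
  walks determines the letters.
\<close>

fun letter_walk :: "'a letter \<Rightarrow> ('a \<times> bool) list" where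
  "letter_walk (Direct p) = map (\<lambda>a. (a, True)) p"
| "letter_walk (Inverse p) = map (\<lambda>a. (a, False)) (rev p)"

definition walk :: "'a letter list \<Rightarrow> ('a \<times> bool) list" where
  "walk w = concat (map letter_walk w)"

fun cancel_cons :: "'a \<times> bool \<Rightarrow> ('a \<times> bool) list \<Rightarrow> ('a \<times> bool) list" where
  "cancel_cons x [] = [x]"
| "cancel_cons x (y # ys) = (if fst x = fst y \<and> snd x \<noteq> snd y then ys else x # y # ys)"

definition reduced_walk :: "'a letter list \<Rightarrow> ('a \<times> bool) list" where
  "reduced_walk w = foldr cancel_cons (walk w) []"

section \<open>Band complexes\<close>

text \<open>
  The vertices of the cyclic diagram of \<open>w\<close> are numbered \<open>0, \<dots>, length w - 1\<close> from left to right;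
  vertex \<open>i\<close> is the left end of the letter \<open>w ! i\<close>. The degree of vertex \<open>0\<close> is \<open>d\<close>, and arrows
  raise the degree by one.
\<close>

definition band_vertex :: "('v, 'a) pre_digraph \<Rightarrow> 'a letter list \<Rightarrow> nat \<Rightarrow> 'v" where
  "band_vertex Q w i = letter_end Q (w ! i)"

definition vertex_degree :: "'a letter list \<Rightarrow> int \<Rightarrow> nat \<Rightarrow> int" where
  "vertex_degree w d i = d + (\<Sum>t<i. if is_direct (w ! t) then 1 else - 1)"

definition arrow_source :: "'a letter list \<Rightarrow> nat \<Rightarrow> nat" where
  "arrow_source w t = (if is_direct (w ! t) then t else Suc t mod length w)"

definition arrow_target :: "'a letter list \<Rightarrow> nat \<Rightarrow> nat" where
  "arrow_target w t = (if is_direct (w ! t) then Suc t mod length w else t)"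

definition vec_path_map :: "('v, 'a) pre_digraph \<Rightarrow> ('a \<times> 'a) set \<Rightarrow> 'a list \<Rightarrow>
    ('v, 'a, 'k::field) vec \<Rightarrow> ('v, 'a, 'k) vec" where
  "vec_path_map Q I p = path_map Q I (arrows_start Q p, p)"

text \<open>
  \<open>band_complex Q I w d j c\<close> is the band complex of \<open>(w, c)\<close> with vertex \<open>0\<close> in degree \<open>d\<close> and
  the scalar \<open>c\<close> on the letter \<open>w ! j\<close>, which is meant to be direct.
\<close>

definition band_complex :: "('v, 'a) pre_digraph \<Rightarrow> ('a \<times> 'a) set \<Rightarrow> 'a letter list \<Rightarrow>
    int \<Rightarrow> nat \<Rightarrow> 'k::field \<Rightarrow> ('v, 'a, 'k) cpx" where
  "band_complex Q I w d j c = \<lparr>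
     cob = (\<lambda>n. dsum {i. i < length w \<and> vertex_degree w d i = n} (\<lambda>i. proj Q I (band_vertex Q w i))),
     cdf = (\<lambda>n v. \<Sum>t<length w. vscale (if t = j then c else 1)
        (inject (arrow_target w t)
           (vec_path_map Q I (letter_path (w ! t)) (summand (arrow_source w t) v))))\<rparr>"

definition direct_position :: "'a letter list \<Rightarrow> nat \<Rightarrow> bool" where
  "direct_position w j \<longleftrightarrow> j < length w \<and> is_direct (w ! j)"

section \<open>Single maps\<close>

text \<open>
  \<open>F\<close> is a cochain map between the band complexes of \<open>(\<sigma>, lam)\<close> and \<open>(\<tau>, mu)\<close> whose only nonzero
  component is \<open>f : P(x) \<rightarrow> P(y)\<close>, where \<open>x\<close> is vertex \<open>i\<close> of \<open>\<sigma>\<close> and \<open>y\<close> is vertex \<open>j\<close> of \<open>\<tau>\<close>.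
\<close>

definition single_map :: "('v, 'a) pre_digraph \<Rightarrow> ('a \<times> 'a) set \<Rightarrow>
    'a letter list \<Rightarrow> int \<Rightarrow> nat \<Rightarrow> 'k::field \<Rightarrow> 'a letter list \<Rightarrow> int \<Rightarrow> nat \<Rightarrow> 'k \<Rightarrow>
    nat \<Rightarrow> nat \<Rightarrow> 'a list \<Rightarrow> ('v, 'a, 'k) cmap \<Rightarrow> bool" where
  "single_map Q I \<sigma> d\<sigma> l\<sigma> lam \<tau> d\<tau> l\<tau> mu i j f F \<longleftrightarrow>
     i < length \<sigma> \<and> j < length \<tau> \<and>
     vertex_degree \<sigma> d\<sigma> i = vertex_degree \<tau> d\<tau> j \<and>
     nontrivial_nonzero Q I f \<and>
     arrows_end Q f = band_vertex Q \<sigma> i \<and>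
     arrows_start Q f = band_vertex Q \<tau> j \<and>
     chain_map Q I (band_complex Q I \<sigma> d\<sigma> l\<sigma> lam) (band_complex Q I \<tau> d\<tau> l\<tau> mu) F \<and>
     (\<forall>n. \<forall>v\<in>mcar (cob (band_complex Q I \<sigma> d\<sigma> l\<sigma> lam) n).
        F n v = inject j (vec_path_map Q I f (summand i v)))"

text \<open>
  Here \<open>\<sigma>\<^sub>R\<close> and \<open>\<tau>\<^sub>R\<close> are the letters to the right of the vertices \<open>x\<close> and \<open>y\<close>. For single maps
  between band complexes this also expresses that the map is a singleton single map.
\<close>

definition compatibly_oriented :: "'a list \<Rightarrow> 'a letter \<Rightarrow> 'a letter \<Rightarrow> bool" where
  "compatibly_oriented f \<sigma>R \<tau>R \<longleftrightarrow>
     (\<exists>\<sigma>R' \<tau>R'. \<sigma>R' \<noteq> [] \<and> \<tau>R' \<noteq> [] \<and> \<sigma>R = Direct (f @ \<sigma>R') \<and> \<tau>R = Inverse (\<tau>R' @ f))"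

definition primitive_root_of_unity :: "nat \<Rightarrow> 'k::field \<Rightarrow> bool" where
  "primitive_root_of_unity k \<omega> \<longleftrightarrow> 1 \<le> k \<and> \<omega> ^ k = 1 \<and> (\<forall>m. 1 \<le> m \<and> m < k \<longrightarrow> \<omega> ^ m \<noteq> 1)"

end

theory Submission
  imports Defs
begin

text \<open>
  Write \<open>\<sigma>\<^sub>R = f p\<close> and let \<open>q f\<close> be the path of the inverse letter \<open>\<tau>\<^sub>R\<close>. In the cone of \<open>f\<close>, the
  vertex \<open>x\<close> of \<open>\<sigma>\<close> maps to the vertex \<open>y\<close> of \<open>\<tau>\<close> by \<open>f\<close> and to its right neighbour \<open>x'\<close> by
  \<open>-f p\<close>, and the right neighbour \<open>y'\<close> of \<open>y\<close> maps to \<open>y\<close> by \<open>q f\<close>. Both letters \<open>f p\<close> and \<open>q f\<close>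
  factor through the new arrow \<open>f\<close>, so they can be removed by a change of basis: a multiple of \<open>p\<close>
  from \<open>y\<close> to \<open>x'\<close> removes the first, \<open>q\<close> from \<open>y'\<close> to \<open>x\<close> removes the second, and together they
  leave a multiple of \<open>q f p\<close> from \<open>y'\<close> to \<open>x'\<close>. Nothing else changes, because the products of \<open>p\<close> and
  \<open>q\<close> with the other letters at these vertices vanish: at \<open>x'\<close> and \<open>y'\<close> since \<open>\<sigma>\<close> and \<open>\<tau>\<close> are homotopy
  strings, at \<open>x\<close> and \<open>y\<close> since an arrow of a gentle quiver has only one nonzero continuation at
  either end. So the cone is isomorphic, as a complex, to the one whose diagram is
  the cyclic word \<open>W = \<beta> \<sigma>\<^sub>L f \<dots> (q f p) \<alpha>\<close>, which is the reduced form of the given product. This is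
  \<open>cone_chain\<close> with \<open>U_inverse\<close>; that the remaining letters are read off cyclically as \<open>W\<close> is
  \<open>diagram_chain\<close> and \<open>sum_edge_matrices\<close>.

  The isomorphism class of a complex with cyclic diagram depends only on the word and on the
  product of its scalars, inverted at one of the two kinds of letters. Here that product is
  \<open>-lam / mu\<close>: the cone changes the sign of each of the evenly many letters of \<open>\<sigma>\<close>, the new letter
  \<open>q f p\<close> has lost this sign, and \<open>\<tau>\<close> is traversed backwards (\<open>holonomy_diagram\<close>).

  Finally write \<open>W = \<theta>\<^sup>k\<close> with \<open>\<theta>\<close> not a proper power. Going once along \<open>\<theta>\<close> is a symmetry of order
  \<open>k\<close> of the diagram of \<open>W\<close>, and passing to its eigenvectors (a discrete Fourier transform, available
  when a primitive \<open>k\<close>-th root of unity exists) splits the complex into \<open>k\<close> copies of the diagram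
  of \<open>\<theta>\<close>, whose scalars are the \<open>k\<close>-th roots of \<open>-lam / mu\<close>. This is \<open>split_join\<close>, \<open>join_split\<close> and
  \<open>split_chain\<close>.

  All complexes involved are sums of indecomposable projectives, with maps given by matrices over
  the path algebra. So both isomorphisms are checked as matrix identities, which
  \<open>derived_iso_if_matrix_iso\<close> turns into an isomorphism in the derived category.
\<close>

section \<open>The path algebra\<close>

lemma sum_fun_apply: "(\<Sum>e\<in>E. g e) x = (\<Sum>e\<in>E. g e x :: 'b::comm_monoid_add)"
  by (induction E rule: infinite_finite_induct) auto

context gentle_algebra
begin

abbreviation mult :: "('v, 'a, 'k::field) alg \<Rightarrow> ('v, 'a, 'k) alg \<Rightarrow> ('v, 'a, 'k) alg"
    (infixl "\<odot>" 70) where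
  "a \<odot> b \<equiv> alg_mult Q I a b"

abbreviation nz :: "('v, 'a) path \<Rightarrow> bool" where
  "nz \<equiv> nonzero_path Q I"

lemma awalk_rev_end:
  assumes "awalk x (rev as) y"
  shows "y = path_end Q (x, as)"
  using assms by (cases as) (auto simp: path_end_def awalk_Cons_iff)

lemma is_path_Cons:
  "is_path Q (x, b # as) \<longleftrightarrow> is_path Q (x, as) \<and> b \<in> arcs Q \<and> tail Q b = path_end Q (x, as)"
proof -
  have end_eq: "awlast x (rev as) = path_end Q (x, as)" if "awalk x (rev as) z" for z
    using that awalk_rev_end[OF that] by simp
  show ?thesis
    unfolding is_path_def fst_conv snd_conv
    using end_eq by (auto simp: awalk_simps)
qed

lemma nz_Nil [simp]: "nz (x, []) \<longleftrightarrow> x \<in> verts Q"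
  by (auto simp: nonzero_path_def is_path_def awalk_simps)

lemma nz_Cons:
  "nz (x, b # as) \<longleftrightarrow> nz (x, as) \<and> b \<in> arcs Q \<and> tail Q b = path_end Q (x, as) \<and>
     (as \<noteq> [] \<longrightarrow> (b, hd as) \<notin> I)"
  by (cases as) (auto simp: nonzero_path_def is_path_Cons)

lemma path_end_Nil [simp]: "path_end Q (x, []) = x"
  by (simp add: path_end_def)

lemma path_end_append: "path_end Q (x, p @ q) = path_end Q (path_end Q (x, q), p)"
  by (simp add: path_end_def)

lemma nz_append:
  "nz (x, p @ q) \<longleftrightarrow> nz (x, q) \<and> nz (path_end Q (x, q), p) \<and>
     (p \<noteq> [] \<and> q \<noteq> [] \<longrightarrow> (last p, hd q) \<notin> I)"
proof (induction p)
  case Nil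
  have "path_end Q (x, q) \<in> verts Q" if "nz (x, q)"
    using that by (cases q) (auto simp: nz_Cons path_end_def)
  then show ?case by auto
next
  case (Cons b p)
  then show ?case
    by (cases p) (auto simp: nz_Cons path_end_append path_end_def)
qed

lemma nz_end: "nz (x, as) \<Longrightarrow> path_end Q (x, as) \<in> verts Q"
  using nz_append[of x "[]" as] by simp

lemma nz_start: "nz (x, as) \<Longrightarrow> x \<in> verts Q"
  by (induction as) (auto simp: nz_Cons)

lemma mult_apply:
  "(a \<odot> b) (x, as) = (if nz (x, as)
     then (\<Sum>i\<le>length as. a (path_end Q (x, drop i as), take i as) * b (x, drop i as)) else 0)"
  by (simp add: alg_mult_def)

lemma mult_nz: "(a \<odot> b) p \<noteq> 0 \<Longrightarrow> nz p"
  by (cases p) (auto simp: mult_apply split: if_splits)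

lemma mult_in_carrier [simp]: "a \<odot> b \<in> alg_carrier Q I"
  using mult_nz by (auto simp: alg_carrier_def)

text \<open>
  A path in the support of \<open>a b\<close> splits into one from \<open>a\<close> after one from \<open>b\<close>; this is how all
  statements about supports (start, end, degree) pass to products.
\<close>

lemma mult_factors:
  assumes "(a \<odot> b) p \<noteq> 0"
  shows "\<exists>q r. a q \<noteq> 0 \<and> b r \<noteq> 0 \<and> fst q = path_end Q r \<and> fst p = fst r \<and> path_end Q p = path_end Q q"
proof -
  obtain x as where p: "p = (x, as)" by fastforce
  have "(\<Sum>i\<le>length as. a (path_end Q (x, drop i as), take i as) * b (x, drop i as)) \<noteq> 0"
    using assms by (simp add: p mult_apply split: if_splits)
  then obtain i where "a (path_end Q (x, drop i as), take i as) * b (x, drop i as) \<noteq> 0"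
    by (meson sum.neutral)
  moreover have "path_end Q (path_end Q (x, drop i as), take i as) = path_end Q (x, as)"
    by (metis append_take_drop_id path_end_append)
  ultimately show ?thesis using p by fastforce
qed

lemma mult_add_left: "(a + b) \<odot> c = a \<odot> c + b \<odot> c"
  by (auto simp: fun_eq_iff mult_apply sum.distrib algebra_simps)

lemma mult_add_right: "a \<odot> (b + c) = a \<odot> b + a \<odot> c"
  by (auto simp: fun_eq_iff mult_apply sum.distrib algebra_simps)

lemma zero_prod_left [simp]: "0 \<odot> a = 0"
  by (auto simp: fun_eq_iff mult_apply)

lemma zero_prod_right [simp]: "a \<odot> 0 = 0"
  by (auto simp: fun_eq_iff mult_apply)

lemma mult_uminus_left: "(- a) \<odot> b = - (a \<odot> b)"
  by (auto simp: fun_eq_iff mult_apply sum_negf)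

lemma mult_uminus_right: "a \<odot> (- b) = - (a \<odot> b)"
  by (auto simp: fun_eq_iff mult_apply sum_negf)

lemma mult_sum_left: "(\<Sum>e\<in>E. g e) \<odot> a = (\<Sum>e\<in>E. g e \<odot> a)"
  using sum_comp_morphism[of "\<lambda>b. b \<odot> a" g E] by (simp add: o_def mult_add_left)

lemma mult_sum_right: "a \<odot> (\<Sum>e\<in>E. g e) = (\<Sum>e\<in>E. a \<odot> g e)"
  using sum_comp_morphism[of "\<lambda>b. a \<odot> b" g E] by (simp add: o_def mult_add_right)

lemma mult_scale_left: "(\<lambda>p. c * a p) \<odot> b = (\<lambda>p. c * (a \<odot> b) p)"
  by (auto simp: fun_eq_iff mult_apply sum_distrib_left algebra_simps)

lemma mult_scale_right: "a \<odot> (\<lambda>p. c * b p) = (\<lambda>p. c * (a \<odot> b) p)"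
  by (auto simp: fun_eq_iff mult_apply sum_distrib_left algebra_simps)

text \<open>
  Both sides are the sum over all ways to cut a path into three pieces. No carrier condition appears,
  since the product already vanishes on paths that are zero in \<open>\<Lambda>\<close> and a factor of a nonzero
  path is nonzero.
\<close>

lemma mult_assoc: "(a \<odot> b) \<odot> c = a \<odot> (b \<odot> c)"
proof
  fix p :: "('v, 'a) path"
  obtain x as where p: "p = (x, as)" by fastforce
  let ?n = "length as"
  show "((a \<odot> b) \<odot> c) p = (a \<odot> (b \<odot> c)) p"
  proof (cases "nz (x, as)")
    case False
    then show ?thesis by (simp add: p mult_apply)
  next
    case True
    let ?E = "\<lambda>i. path_end Q (x, drop i as)"
    let ?g = "\<lambda>i j. a (?E j, take j as) * b (?E i, drop j (take i as)) * c (x, drop i as)"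
    have parts: "nz (x, drop i as) \<and> nz (?E i, take i as)" for i
      using True nz_append[of x "take i as" "drop i as"] by simp
    have ends: "path_end Q (?E i, drop j (take i as)) = ?E j" if "j \<le> i" for i j
      using that by (metis path_end_append append_take_drop_id drop_take drop_drop
          le_add_diff_inverse2)
    have "((a \<odot> b) \<odot> c) p = (\<Sum>i\<le>?n. (\<Sum>j\<le>i. ?g i j))"
      unfolding p mult_apply[of "a \<odot> b"] if_P[OF True]
      by (intro sum.cong refl) (auto simp: mult_apply parts ends sum_distrib_right min_absorb1 min_absorb2)
    also have "\<dots> = (\<Sum>j\<le>?n. \<Sum>i\<in>{j..?n}. ?g i j)"
      unfolding sum.Sigma[OF finite_atMost ballI[OF finite_atMost]]
        sum.Sigma[OF finite_atMost ballI[OF finite_atLeastAtMost]]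
      by (rule sum.reindex_bij_witness[where i = "\<lambda>(j, i). (i, j)" and j = "\<lambda>(i, j). (j, i)"]) auto
    also have "\<dots> = (\<Sum>j\<le>?n. \<Sum>i\<le>?n - j. ?g (j + i) j)"
    proof (rule sum.cong[OF refl])
      show "(\<Sum>i\<in>{j..?n}. ?g i j) = (\<Sum>i\<le>?n - j. ?g (j + i) j)" if "j \<in> {..?n}" for j
        using that by (intro sum.reindex_bij_witness[where j = "\<lambda>i. i - j" and i = "\<lambda>i. j + i"]) auto
    qed
    also have "\<dots> = (a \<odot> (b \<odot> c)) p"
      unfolding p mult_apply[of a] if_P[OF True]
      by (intro sum.cong refl)
        (auto simp: mult_apply parts sum_distrib_left drop_take add.commute mult.assoc)
    finally show ?thesis .
  qed
qed

lemma path_product: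
  "alg_path p \<odot> alg_path q = (if path_end Q q = fst p \<and> nz (fst q, snd p @ snd q)
     then alg_path (fst q, snd p @ snd q) else (0 :: ('v, 'a, 'k::field) alg))"
proof
  fix r :: "('v, 'a) path"
  obtain x as where r: "r = (x, as)" by fastforce
  obtain y bs where p: "p = (y, bs)" by fastforce
  obtain z cs where q: "q = (z, cs)" by fastforce
  have "alg_path p (path_end Q (x, drop i as), take i as) * alg_path q (x, drop i as)
    = (if i = length bs then
        (if x = z \<and> as = bs @ cs \<and> path_end Q q = y then 1 else 0 :: 'k) else 0)" (is "?l = ?r")
    if i: "i \<le> length as" for i
  proof (cases "take i as = bs \<and> drop i as = cs")
    case True
    then have "as = bs @ cs" "i = length bs" using i by auto
    then show ?thesis by (simp add: alg_path_def p q)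
  next
    case False
    then have "\<not> (i = length bs \<and> as = bs @ cs)" by auto
    moreover have "?l = 0" using False by (auto simp: alg_path_def p q)
    ultimately show ?thesis by auto
  qed
  then have "(\<Sum>i\<le>length as. alg_path p (path_end Q (x, drop i as), take i as) * alg_path q (x, drop i as))
    = (\<Sum>i\<le>length as. if i = length bs then
        (if x = z \<and> as = bs @ cs \<and> path_end Q q = y then 1 else 0 :: 'k) else 0)"
    by (intro sum.cong) auto
  also have "\<dots> = (if x = z \<and> as = bs @ cs \<and> path_end Q q = y then 1 else 0)"
    by auto
  finally have "(alg_path p \<odot> alg_path q) r =
      (if nz (x, as) then (if x = z \<and> as = bs @ cs \<and> path_end Q q = y then 1 else 0 :: 'k) else 0)"
    by (simp add: r mult_apply)
  then show "(alg_path p \<odot> alg_path q) r = (if path_end Q q = fst p \<and> nz (fst q, snd p @ snd q)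
     then alg_path (fst q, snd p @ snd q) else (0 :: ('v, 'a, 'k) alg)) r"
    by (auto simp: p q r alg_path_def)
qed

lemma path_unit_left:
  assumes "a \<in> alg_carrier Q I" "\<And>p. a p \<noteq> 0 \<Longrightarrow> path_end Q p = x"
  shows "alg_path (x, []) \<odot> a = a"
proof
  fix p :: "('v, 'a) path"
  obtain y as where p: "p = (y, as)" by fastforce
  have "alg_path (x, []) (path_end Q (y, drop i as), take i as) * a (y, drop i as)
    = (if i = 0 then a (y, as) else 0)" if "i \<le> length as" for i
    using assms(2)[of "(y, as)"] that by (cases "i = 0") (auto simp: alg_path_def)
  then have "(\<Sum>i\<le>length as. alg_path (x, []) (path_end Q (y, drop i as), take i as) * a (y, drop i as))
    = (\<Sum>i\<le>length as. if i = 0 then a (y, as) else 0)"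
    by (intro sum.cong) auto
  then have "(alg_path (x, []) \<odot> a) p = (if nz p then a p else 0)"
    by (simp add: p mult_apply)
  then show "(alg_path (x, []) \<odot> a) p = a p"
    using assms(1) by (cases p) (auto simp: alg_carrier_def)
qed

lemma path_unit_right:
  assumes "a \<in> alg_carrier Q I" "\<And>p. a p \<noteq> 0 \<Longrightarrow> fst p = x"
  shows "a \<odot> alg_path (x, []) = a"
proof
  fix p :: "('v, 'a) path"
  obtain y as where p: "p = (y, as)" by fastforce
  have "a (path_end Q (y, drop i as), take i as) * alg_path (x, []) (y, drop i as)
    = (if i = length as then a (y, as) else 0)" if "i \<le> length as" for i
    using assms(2)[of "(y, as)"] that by (cases "i = length as") (auto simp: alg_path_def)
  then have "(\<Sum>i\<le>length as. a (path_end Q (y, drop i as), take i as) * alg_path (x, []) (y, drop i as))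
    = (\<Sum>i\<le>length as. if i = length as then a (y, as) else 0)"
    by (intro sum.cong) auto
  then have "(a \<odot> alg_path (x, [])) p = (if nz p then a p else 0)"
    by (simp add: p mult_apply)
  then show "(a \<odot> alg_path (x, [])) p = a p"
    using assms(1) by (cases p) (auto simp: alg_carrier_def)
qed

lemma one_mult:
  assumes "a \<in> alg_carrier Q I"
  shows "alg_one Q \<odot> a = a"
proof
  fix p :: "('v, 'a) path"
  obtain y as where p: "p = (y, as)" by fastforce
  have "alg_one Q (path_end Q (y, drop i as), take i as) * a (y, drop i as)
    = (if i = 0 then a (y, as) else 0)" if "nz (y, as)" "i \<le> length as" for i
    using nz_end[OF that(1)] that(2) by (cases "i = 0") (auto simp: alg_one_def)
  then have "(\<Sum>i\<le>length as. alg_one Q (path_end Q (y, drop i as), take i as) * a (y, drop i as))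
    = (\<Sum>i\<le>length as. if i = 0 then a (y, as) else 0)" if "nz (y, as)"
    using that by (intro sum.cong) auto
  then have "(alg_one Q \<odot> a) p = (if nz p then a p else 0)"
    by (simp add: p mult_apply)
  then show "(alg_one Q \<odot> a) p = a p"
    using assms by (cases p) (auto simp: alg_carrier_def)
qed

end

section \<open>Matrices over the path algebra\<close>

text \<open>
  A finite sum of indecomposable projectives in all degrees at once. The index \<open>(i, j)\<close>
  belongs to the labels \<open>Tag i (Tag j \<dots>)\<close>: both the mapping cone of two band complexes and a direct
  sum of band complexes are sums of sums.
\<close>

record 'v summands =
  indices :: "(nat \<times> nat) set"
  vert :: "nat \<times> nat \<Rightarrow> 'v"
  deg :: "nat \<times> nat \<Rightarrow> int"

type_synonym ('v, 'a, 'k) matrix = "nat \<times> nat \<Rightarrow> nat \<times> nat \<Rightarrow> ('v, 'a, 'k) alg"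

definition entry :: "nat \<times> nat \<Rightarrow> nat \<times> nat \<Rightarrow> ('v, 'a, 'k::field) alg \<Rightarrow> ('v, 'a, 'k) matrix" where
  "entry s t u = (\<lambda>s' t'. if s' = s \<and> t' = t then u else 0)"

lemma entry_zero [simp]: "entry s t 0 = 0"
  by (auto simp: entry_def fun_eq_iff)

lemma entry_add: "entry s t (u + u') = entry s t u + entry s t u'"
  by (auto simp: entry_def fun_eq_iff)

lemma entry_sum: "entry s t (\<Sum>e\<in>E. g e) = (\<Sum>e\<in>E. entry s t (g e))"
  using sum_comp_morphism[of "entry s t" g E] by (simp add: o_def entry_add)

context gentle_algebra
begin

definition mmul :: "(nat \<times> nat) set \<Rightarrow> ('v, 'a, 'k::field) matrix \<Rightarrow> ('v, 'a, 'k) matrix \<Rightarrow>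
    ('v, 'a, 'k) matrix" where
  "mmul S A B = (\<lambda>s t. \<Sum>r\<in>S. A s r \<odot> B r t)"

lemma mmul_add_left: "mmul S (A + B) C = mmul S A C + mmul S B C"
  by (simp add: mmul_def fun_eq_iff mult_add_left sum.distrib)

lemma mmul_add_right: "mmul S A (B + C) = mmul S A B + mmul S A C"
  by (simp add: mmul_def fun_eq_iff mult_add_right sum.distrib)

lemma mmul_zero_left [simp]: "mmul S 0 A = 0"
  by (simp add: mmul_def fun_eq_iff)

lemma mmul_zero_right [simp]: "mmul S A 0 = 0"
  by (simp add: mmul_def fun_eq_iff)

lemma mmul_uminus_left: "mmul S (- A) B = - mmul S A B"
  by (simp add: mmul_def fun_eq_iff mult_uminus_left sum_negf)

lemma mmul_uminus_right: "mmul S A (- B) = - mmul S A B"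
  by (simp add: mmul_def fun_eq_iff mult_uminus_right sum_negf)

lemma mmul_diff_left: "mmul S (A - B) C = mmul S A C - mmul S B C"
  using mmul_add_left[of S A "- B" C] by (simp add: mmul_uminus_left)

lemma mmul_diff_right: "mmul S A (B - C) = mmul S A B - mmul S A C"
  using mmul_add_right[of S A B "- C"] by (simp add: mmul_uminus_right)

lemma mmul_sum_left: "mmul S (\<Sum>e\<in>E. g e) A = (\<Sum>e\<in>E. mmul S (g e) A)"
  using sum_comp_morphism[of "\<lambda>B. mmul S B A" g E] by (simp add: o_def mmul_add_left)

lemma mmul_sum_right: "mmul S A (\<Sum>e\<in>E. g e) = (\<Sum>e\<in>E. mmul S A (g e))"
  using sum_comp_morphism[of "\<lambda>B. mmul S A B" g E] by (simp add: o_def mmul_add_right)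

lemma mmul_assoc: "mmul T (mmul S A B) C = mmul S A (mmul T B C)"
proof (intro ext)
  fix s t p
  have "mmul T (mmul S A B) C s t = (\<Sum>r\<in>T. \<Sum>q\<in>S. A s q \<odot> (B q r \<odot> C r t))"
    by (simp add: mmul_def mult_sum_left mult_assoc)
  also have "\<dots> = (\<Sum>q\<in>S. \<Sum>r\<in>T. A s q \<odot> (B q r \<odot> C r t))"
    by (rule sum.swap)
  also have "\<dots> = mmul S A (mmul T B C) s t"
    by (simp add: mmul_def mult_sum_right)
  finally show "mmul T (mmul S A B) C s t p = mmul S A (mmul T B C) s t p" by simp
qed

lemma mmul_entry:
  assumes "finite S"
  shows "mmul S (entry s t u) (entry s' t' u') =
    (if t = s' \<and> t \<in> S then entry s t' (u \<odot> u') else 0)"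
proof (intro ext)
  fix x y p
  have "entry s t u x r \<odot> entry s' t' u' r y =
      (if r = t then if t = s' then entry s t' (u \<odot> u') x y else 0 else 0)" for r
    by (auto simp: entry_def)
  then have "mmul S (entry s t u) (entry s' t' u') x y =
      (\<Sum>r\<in>S. if r = t then if t = s' then entry s t' (u \<odot> u') x y else 0 else 0)"
    by (simp add: mmul_def)
  then show "mmul S (entry s t u) (entry s' t' u') x y p =
      (if t = s' \<and> t \<in> S then entry s t' (u \<odot> u') else 0) x y p"
    using assms by (simp only: sum.delta) auto
qed

text \<open>
  \<open>A\<close> is the matrix of a degree \<open>e\<close> homomorphism from the sum \<open>G\<close> to the sum \<open>H\<close>. Elements are rows,
  so \<open>A s t\<close> acts by right multiplication and has to consist of paths from \<open>vert H t\<close> to \<open>vert G s\<close>.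
\<close>

definition between :: "'v summands \<Rightarrow> 'v summands \<Rightarrow> int \<Rightarrow> ('v, 'a, 'k::field) matrix \<Rightarrow> bool" where
  "between G H e A \<longleftrightarrow> (\<forall>s t p. A s t p \<noteq> 0 \<longrightarrow> s \<in> indices G \<and> t \<in> indices H \<and> nz p \<and>
     path_end Q p = vert G s \<and> fst p = vert H t \<and> deg H t = deg G s + e)"

definition idm :: "'v summands \<Rightarrow> ('v, 'a, 'k::field) matrix" where
  "idm G = (\<lambda>s t. if s = t \<and> s \<in> indices G then alg_path (vert G s, []) else 0)"

lemma betweenI:
  assumes "\<And>s t p. A s t p \<noteq> 0 \<Longrightarrow> s \<in> indices G \<and> t \<in> indices H \<and> nz p \<and>
     path_end Q p = vert G s \<and> fst p = vert H t \<and> deg H t = deg G s + e"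
  shows "between G H e A"
  using assms unfolding between_def by blast

lemma betweenD:
  assumes "between G H e A" "A s t p \<noteq> 0"
  shows "s \<in> indices G \<and> t \<in> indices H \<and> nz p \<and>
     path_end Q p = vert G s \<and> fst p = vert H t \<and> deg H t = deg G s + e"
  using assms unfolding between_def by blast

lemma between_add:
  assumes A: "between G H e A" and B: "between G H e B"
  shows "between G H e (A + B)"
proof (rule betweenI)
  fix s t p
  assume "(A + B) s t p \<noteq> 0"
  then have "A s t p \<noteq> 0 \<or> B s t p \<noteq> 0" by auto
  then show "s \<in> indices G \<and> t \<in> indices H \<and> nz p \<and>
      path_end Q p = vert G s \<and> fst p = vert H t \<and> deg H t = deg G s + e"
    using betweenD[OF A] betweenD[OF B] by blast
qed

lemma between_uminus: "between G H e A \<Longrightarrow> between G H e (- A)"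
  by (rule betweenI) (simp add: betweenD)

lemma between_zero: "between G H e 0"
  by (simp add: between_def)

lemma between_sum: "(\<And>x. x \<in> E \<Longrightarrow> between G H e (g x)) \<Longrightarrow> between G H e (\<Sum>x\<in>E. g x)"
proof (induction E rule: infinite_finite_induct)
  case (infinite A)
  show ?case unfolding sum.infinite[OF infinite(1)] by (rule between_zero)
next
  case empty
  show ?case unfolding sum.empty by (rule between_zero)
next
  case (insert x F)
  show ?case unfolding sum.insert[OF insert(1,2)] using insert by (intro between_add) auto
qed

lemma between_entry:
  assumes "s \<in> indices G" "t \<in> indices H" "deg H t = deg G s + e"
    "\<And>p. u p \<noteq> 0 \<Longrightarrow> nz p \<and> path_end Q p = vert G s \<and> fst p = vert H t"
  shows "between G H e (entry s t u)"
  using assms by (intro betweenI) (auto simp: entry_def split: if_splits)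

lemma between_mmul:
  assumes A: "between G H e A" and B: "between H K e' B"
  shows "between G K (e + e') (mmul (indices H) A B)"
proof (rule betweenI)
  fix s t p
  assume "mmul (indices H) A B s t p \<noteq> 0"
  then have "(\<Sum>r\<in>indices H. (A s r \<odot> B r t) p) \<noteq> 0"
    by (simp add: mmul_def sum_fun_apply)
  then obtain r where r: "(A s r \<odot> B r t) p \<noteq> 0"
    by (meson sum.neutral)
  from mult_factors[OF r] obtain q q' where "A s r q \<noteq> 0" "B r t q' \<noteq> 0"
    and q: "fst p = fst q'" "path_end Q p = path_end Q q" by blast
  with betweenD[OF A, of s r q] betweenD[OF B, of r t q'] mult_nz[OF r]
  show "s \<in> indices G \<and> t \<in> indices K \<and> nz p \<and> path_end Q p = vert G s \<and> fst p = vert K t \<and>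
      deg K t = deg G s + (e + e')"
    by simp
qed

lemma between_carrier: "between G H e A \<Longrightarrow> A s t \<in> alg_carrier Q I"
  unfolding alg_carrier_def using betweenD by blast

lemma between_outside:
  assumes "between G H e A" "s \<notin> indices G \<or> t \<notin> indices H"
  shows "A s t = 0"
proof
  fix p
  show "A s t p = 0 p"
    using betweenD[OF assms(1), of s t p] assms(2) by (cases "A s t p = 0") auto
qed

lemma idm_mmul:
  assumes "between G H e A" "finite (indices G)"
  shows "mmul (indices G) (idm G) A = A"
proof (intro ext)
  fix s t p
  have "A s t = 0" if "s \<notin> indices G"
    using between_outside[OF assms(1)] that by blast
  moreover have "alg_path (vert G s, []) \<odot> A s t = A s t"
    using betweenD[OF assms(1)] between_carrier[OF assms(1)] by (intro path_unit_left) blast+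
  moreover have "mmul (indices G) (idm G) A s t =
     (\<Sum>r\<in>indices G. if r = s then alg_path (vert G s, []) \<odot> A s t else 0)"
    unfolding mmul_def by (intro sum.cong) (auto simp: idm_def)
  ultimately have "mmul (indices G) (idm G) A s t = A s t"
    using assms(2) by (cases "s \<in> indices G") (simp_all only: sum.delta if_True if_False not_False_eq_True simp_thms)
  then show "mmul (indices G) (idm G) A s t p = A s t p" by simp
qed

lemma mmul_idm:
  assumes "between G H e A" "finite (indices H)"
  shows "mmul (indices H) A (idm H) = A"
proof (intro ext)
  fix s t p
  have "A s t = 0" if "t \<notin> indices H"
    using between_outside[OF assms(1)] that by blast
  moreover have "A s t \<odot> alg_path (vert H t, []) = A s t"
    using betweenD[OF assms(1)] between_carrier[OF assms(1)] by (intro path_unit_right) blast+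
  moreover have "mmul (indices H) A (idm H) s t =
     (\<Sum>r\<in>indices H. if r = t then A s t \<odot> alg_path (vert H t, []) else 0)"
    unfolding mmul_def by (intro sum.cong) (auto simp: idm_def)
  ultimately have "mmul (indices H) A (idm H) s t = A s t"
    using assms(2) by (cases "t \<in> indices H") (simp_all only: sum.delta if_True if_False not_False_eq_True simp_thms)
  then show "mmul (indices H) A (idm H) s t p = A s t p" by simp
qed

lemma idm_eq_sum:
  assumes "finite (indices G)"
  shows "idm G = (\<Sum>s\<in>indices G. entry s s (alg_path (vert G s, [])))"
proof (rule ext, rule ext)
  fix s t
  have "(\<Sum>r\<in>indices G. entry r r (alg_path (vert G r, [])) s t) =
     (\<Sum>r\<in>indices G. if r = s then if s = t then alg_path (vert G s, []) else 0 else 0)"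
    by (intro sum.cong) (auto simp: entry_def)
  also have "\<dots> = idm G s t"
    using assms by (simp only: sum.delta) (simp add: idm_def)
  finally show "idm G s t = (\<Sum>s\<in>indices G. entry s s (alg_path (vert G s, []))) s t"
    unfolding sum_fun_apply by (rule sym)
qed

section \<open>Sums of projectives\<close>

text \<open>
  The inclusion of, and below it the projection to, the summand with index \<open>s\<close>, with elements of
  \<open>P(x)\<close> regarded as elements of \<open>\<Lambda>\<close>.
\<close>

definition put :: "nat \<times> nat \<Rightarrow> ('v, 'a, 'k::field) alg \<Rightarrow> ('v, 'a, 'k) vec" where
  "put s u = inject (fst s) (inject (snd s) (vec_of_alg u))"

definition part :: "nat \<times> nat \<Rightarrow> ('v, 'a, 'k::field) vec \<Rightarrow> ('v, 'a, 'k) alg" where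
  "part s v = alg_of_vec (summand (snd s) (summand (fst s) v))"

definition proj_sum :: "'v summands \<Rightarrow> int \<Rightarrow> ('v, 'a, 'k::field) vec set" where
  "proj_sum G n = {v. \<forall>l. v l \<noteq> 0 \<longrightarrow> (\<exists>s\<in>indices G. \<exists>p. deg G s = n \<and>
     l = Tag (fst s) (Tag (snd s) (Pth p)) \<and> nz p \<and> fst p = vert G s)}"

definition act :: "'v summands \<Rightarrow> ('v, 'a, 'k::field) alg \<Rightarrow> ('v, 'a, 'k) vec \<Rightarrow>
    ('v, 'a, 'k) vec" where
  "act G a v = (\<Sum>s\<in>indices G. put s (a \<odot> part s v))"

text \<open>The homomorphism given by a matrix, as multiplication of rows.\<close>

definition lin :: "'v summands \<Rightarrow> 'v summands \<Rightarrow> ('v, 'a, 'k::field) matrix \<Rightarrow>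
    ('v, 'a, 'k) vec \<Rightarrow> ('v, 'a, 'k) vec" where
  "lin G H A v = (\<Sum>t\<in>indices H. put t (\<Sum>s\<in>indices G. part s v \<odot> A s t))"

lemma part_apply: "part s v p = v (Tag (fst s) (Tag (snd s) (Pth p)))"
  by (simp add: part_def alg_of_vec_def summand_def)

lemma put_apply: "put s u (Tag i (Tag j (Pth p))) = (if s = (i, j) then u p else 0)"
  by (auto simp: put_def inject_def vec_of_alg_def)

lemma put_apply_nonzero: "put s u l \<noteq> 0 \<Longrightarrow> \<exists>p. l = Tag (fst s) (Tag (snd s) (Pth p)) \<and> u p \<noteq> 0"
  by (auto simp: put_def inject_def vec_of_alg_def split: label.splits if_splits)

lemma part_put: "part s (put t u) = (if s = t then u else 0)"
  by (auto simp: fun_eq_iff part_apply put_apply)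

lemma part_add [simp]: "part s (v + w) = part s v + part s w"
  by (auto simp: fun_eq_iff part_apply)

lemma part_zero [simp]: "part s 0 = 0"
  by (auto simp: fun_eq_iff part_apply)

lemma part_scale [simp]: "part s (vscale c v) = (\<lambda>p. c * part s v p)"
  by (auto simp: fun_eq_iff part_apply vscale_def)

lemma part_sum: "part s (\<Sum>e\<in>E. g e) = (\<Sum>e\<in>E. part s (g e))"
  using sum_comp_morphism[of "part s" g E] by (simp add: o_def)

lemma put_add: "put s (u + u') = put s u + put s u'"
  by (auto simp: fun_eq_iff put_def inject_def vec_of_alg_def split: label.splits)

lemma put_zero [simp]: "put s 0 = 0"
  by (auto simp: fun_eq_iff put_def inject_def vec_of_alg_def split: label.splits)

lemma put_uminus: "put s (- u) = - put s u"
  by (auto simp: fun_eq_iff put_def inject_def vec_of_alg_def split: label.splits)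

lemma part_sum_put:
  assumes "finite S"
  shows "part t (\<Sum>s\<in>S. put s (g s)) = (if t \<in> S then g t else 0)"
proof -
  have "part t (\<Sum>s\<in>S. put s (g s)) = (\<Sum>s\<in>S. if t = s then g s else 0)"
    unfolding part_sum part_put ..
  then show ?thesis using assms by (simp only: sum.delta')
qed

lemma proj_sum_zero [simp]: "0 \<in> proj_sum G n"
  by (simp add: proj_sum_def)

lemma proj_sum_add:
  assumes "v \<in> proj_sum G n" "w \<in> proj_sum G n"
  shows "v + w \<in> proj_sum G n"
proof -
  have "(v + w) l \<noteq> 0 \<Longrightarrow> v l \<noteq> 0 \<or> w l \<noteq> 0" for l by auto
  then show ?thesis using assms unfolding proj_sum_def mem_Collect_eq by meson
qed

lemma proj_sum_scale: "v \<in> proj_sum G n \<Longrightarrow> vscale c v \<in> proj_sum G n"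
  by (simp add: proj_sum_def vscale_def)

lemma proj_sum_sum: "(\<And>e. e \<in> E \<Longrightarrow> g e \<in> proj_sum G n) \<Longrightarrow> (\<Sum>e\<in>E. g e) \<in> proj_sum G n"
proof (induction E rule: infinite_finite_induct)
  case (infinite A)
  show ?case unfolding sum.infinite[OF infinite(1)] by (rule proj_sum_zero)
next
  case empty
  show ?case unfolding sum.empty by (rule proj_sum_zero)
next
  case (insert x F)
  show ?case unfolding sum.insert[OF insert(1,2)] using insert by (intro proj_sum_add) auto
qed

lemma proj_sum_put:
  assumes "\<And>p. u p \<noteq> 0 \<Longrightarrow> s \<in> indices G \<and> deg G s = n \<and> nz p \<and> fst p = vert G s"
  shows "put s u \<in> proj_sum G n"
  unfolding proj_sum_def mem_Collect_eq using assms put_apply_nonzero by meson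

text \<open>
  The support condition in \<open>proj_sum\<close>, read off at one summand. It makes the parts outside degree \<open>n\<close>
  vanish, so that sums over the summands of degree \<open>n\<close> may be extended to all of \<open>indices G\<close>.
\<close>

lemma part_proj_sum:
  assumes "v \<in> proj_sum G n" "part s v p \<noteq> 0"
  shows "s \<in> indices G \<and> deg G s = n \<and> nz p \<and> fst p = vert G s"
  using assms unfolding proj_sum_def part_apply by (force simp: prod_eq_iff)

lemma proj_sum_eqI:
  assumes v: "v \<in> proj_sum G n" and w: "w \<in> proj_sum G n" and eq: "\<And>s. s \<in> indices G \<Longrightarrow> part s v = part s w"
  shows "v = w"
proof
  fix l
  show "v l = w l"
  proof (cases "\<exists>s\<in>indices G. \<exists>p. l = Tag (fst s) (Tag (snd s) (Pth p))")
    case True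
    then show ?thesis using eq by (metis part_apply)
  next
    case False
    then have "v l = 0 \<and> w l = 0" using v w unfolding proj_sum_def by blast
    then show ?thesis by simp
  qed
qed

lemma part_carrier: "v \<in> proj_sum G n \<Longrightarrow> part s v \<in> alg_carrier Q I"
  unfolding alg_carrier_def using part_proj_sum by blast

lemma part_lin: "finite (indices H) \<Longrightarrow>
    part t (lin G H A v) = (if t \<in> indices H then \<Sum>s\<in>indices G. part s v \<odot> A s t else 0)"
  unfolding lin_def by (rule part_sum_put)

lemma part_act: "finite (indices G) \<Longrightarrow>
    part t (act G a v) = (if t \<in> indices G then a \<odot> part t v else 0)"
  unfolding act_def by (rule part_sum_put)

lemma act_proj_sum:
  assumes "v \<in> proj_sum G n"
  shows "act G a v \<in> proj_sum G n"
  unfolding act_def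
proof (intro proj_sum_sum proj_sum_put)
  fix s p
  assume "s \<in> indices G" "(a \<odot> part s v) p \<noteq> 0"
  then show "s \<in> indices G \<and> deg G s = n \<and> nz p \<and> fst p = vert G s"
    using mult_factors[of a "part s v" p] mult_nz[of a "part s v" p] part_proj_sum[OF assms] by metis
qed

lemma lin_proj_sum:
  assumes v: "v \<in> proj_sum G n" and A: "between G H e A"
  shows "lin G H A v \<in> proj_sum H (n + e)"
  unfolding lin_def
proof (intro proj_sum_sum proj_sum_put)
  fix t p
  assume "t \<in> indices H" "(\<Sum>s\<in>indices G. part s v \<odot> A s t) p \<noteq> 0"
  then obtain s where "(part s v \<odot> A s t) p \<noteq> 0"
    unfolding sum_fun_apply by (meson sum.neutral)
  from mult_factors[OF this] mult_nz[OF this] part_proj_sum[OF v] betweenD[OF A]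
  show "t \<in> indices H \<and> deg H t = n + e \<and> nz p \<and> fst p = vert H t"
    by metis
qed

lemma lin_lin:
  assumes "finite (indices H)"
  shows "lin H K B (lin G H A v) = lin G K (mmul (indices H) A B) v"
proof -
  have "(\<Sum>s\<in>indices H. part s (lin G H A v) \<odot> B s t) =
      (\<Sum>s\<in>indices G. part s v \<odot> mmul (indices H) A B s t)" for t
  proof -
    have "(\<Sum>s\<in>indices H. part s (lin G H A v) \<odot> B s t) =
        (\<Sum>s\<in>indices H. \<Sum>r\<in>indices G. part r v \<odot> (A r s \<odot> B s t))"
      using assms by (simp add: part_lin mult_sum_left mult_assoc)
    also have "\<dots> = (\<Sum>r\<in>indices G. \<Sum>s\<in>indices H. part r v \<odot> (A r s \<odot> B s t))"
      by (rule sum.swap)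
    finally show ?thesis by (simp add: mmul_def mult_sum_right)
  qed
  then show ?thesis by (simp add: lin_def)
qed

lemma lin_idm:
  assumes "finite (indices G)" and v: "v \<in> proj_sum G n"
  shows "lin G G (idm G) v = v"
proof (rule proj_sum_eqI)
  fix s assume s: "s \<in> indices G"
  have "part s (lin G G (idm G) v) = (\<Sum>r\<in>indices G. if r = s then part s v \<odot> alg_path (vert G s, []) else 0)"
    using assms(1) s unfolding part_lin[OF assms(1)] if_P[OF s]
    by (intro sum.cong) (auto simp: idm_def)
  also have "\<dots> = part s v \<odot> alg_path (vert G s, [])"
    using assms(1) s by (simp only: sum.delta if_True)
  also have "\<dots> = part s v"
    using part_carrier[OF v] part_proj_sum[OF v] by (intro path_unit_right) auto
  finally show "part s (lin G G (idm G) v) = part s v" .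
next
  show "lin G G (idm G) v \<in> proj_sum G n"
    unfolding lin_def
  proof (intro proj_sum_sum proj_sum_put)
    fix t p
    assume t: "t \<in> indices G" "(\<Sum>s\<in>indices G. part s v \<odot> idm G s t) p \<noteq> 0"
    then obtain s where s: "(part s v \<odot> idm G s t) p \<noteq> 0"
      unfolding sum_fun_apply by (meson sum.neutral)
    then have "s = t" by (auto simp: idm_def split: if_splits)
    with mult_factors[OF s] mult_nz[OF s] part_proj_sum[OF v] t
    show "t \<in> indices G \<and> deg G t = n \<and> nz p \<and> fst p = vert G t"
      by (auto simp: idm_def alg_path_def split: if_splits)
  qed
qed (rule v)

lemma lin_add: "lin G H A (v + w) = lin G H A v + lin G H A w"
  by (simp add: lin_def mult_add_left sum.distrib put_add)

lemma put_scale: "put s (\<lambda>p. c * u p) = vscale c (put s u)"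
  by (auto simp: fun_eq_iff put_def inject_def vec_of_alg_def vscale_def split: label.splits)

lemma lin_scale: "lin G H A (vscale c v) = vscale c (lin G H A v)"
proof -
  have "(\<Sum>s\<in>indices G. part s (vscale c v) \<odot> A s t) = (\<lambda>p. c * (\<Sum>s\<in>indices G. part s v \<odot> A s t) p)" for t
    by (rule ext) (simp add: mult_scale_left sum_fun_apply sum_distrib_left)
  then have "lin G H A (vscale c v) = (\<Sum>t\<in>indices H. vscale c (put t (\<Sum>s\<in>indices G. part s v \<odot> A s t)))"
    by (simp only: lin_def put_scale)
  then show ?thesis by (simp only: lin_def vec.scale_sum_right)
qed

lemma lin_act:
  assumes "finite (indices G)" "finite (indices H)"
  shows "lin G H A (act G a v) = act H a (lin G H A v)"
proof -
  have "part t (lin G H A v) = (\<Sum>s\<in>indices G. part s v \<odot> A s t)" if "t \<in> indices H" for t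
    using that assms by (simp add: part_lin)
  then have "put t (\<Sum>s\<in>indices G. part s (act G a v) \<odot> A s t) = put t (a \<odot> part t (lin G H A v))"
    if "t \<in> indices H" for t
    using assms that by (simp add: part_act mult_sum_right mult_assoc)
  then show ?thesis unfolding lin_def[of G H A "act G a v"] act_def[of H] by (intro sum.cong) auto
qed

definition presents_module :: "('v, 'a, 'k::field) lmod \<Rightarrow> 'v summands \<Rightarrow> int \<Rightarrow> bool" where
  "presents_module M G n \<longleftrightarrow> mcar M = proj_sum G n \<and>
     (\<forall>a\<in>alg_carrier Q I. \<forall>v\<in>proj_sum G n. mact M a v = act G a v)"

lemma alg_add_carrier: "a \<in> alg_carrier Q I \<Longrightarrow> b \<in> alg_carrier Q I \<Longrightarrow> a + b \<in> alg_carrier Q I"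
  by (auto simp: alg_carrier_def)

text \<open>The finitely many nonzero paths, placed in each summand, span.\<close>

lemma proj_sum_finite_span:
  assumes "finite (indices G)"
  shows "\<exists>B. finite B \<and> proj_sum G n \<subseteq> (vec.span B :: ('v, 'a, 'k::field) vec set)"
proof -
  let ?L = "(\<lambda>(s, p). Tag (fst s) (Tag (snd s) (Pth p))) ` (indices G \<times> {p. nz p})"
  let ?u = "\<lambda>l l'. if l' = l then 1 else 0 :: 'k"
  have fin: "finite ?L" using assms finite_dimensional by auto
  have "v \<in> vec.span (?u ` ?L)" if v: "v \<in> proj_sum G n" for v :: "('v, 'a, 'k) vec"
  proof -
    have "v = (\<Sum>l\<in>?L. vscale (v l) (?u l))"
    proof
      fix l'
      have "(\<Sum>l\<in>?L. vscale (v l) (?u l)) l' = (\<Sum>l\<in>?L. if l = l' then v l else 0)"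
        unfolding sum_fun_apply by (intro sum.cong) (auto simp: vscale_def)
      also have "\<dots> = v l'"
        using fin v by (auto simp: proj_sum_def)
      finally show "v l' = (\<Sum>l\<in>?L. vscale (v l) (?u l)) l'" by simp
    qed
    moreover have "(\<Sum>l\<in>?L. vscale (v l) (?u l)) \<in> vec.span (?u ` ?L)"
      by (intro vec.span_sum vec.span_scale vec.span_base) auto
    ultimately show ?thesis by metis
  qed
  then show ?thesis using fin by (intro exI[of _ "?u ` ?L"]) auto
qed

text \<open>
  All axioms can be checked on the parts, where the action is multiplication in \<open>\<Lambda>\<close>.
\<close>

lemma presents_module_is_module:
  fixes M :: "('v, 'a, 'k::field) lmod"
  assumes fin: "finite (indices G)" and M: "presents_module M G n"
  shows "is_module Q I M"
proof -
  have car: "mcar M = proj_sum G n" and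
    actM: "\<And>a v. a \<in> alg_carrier Q I \<Longrightarrow> v \<in> proj_sum G n \<Longrightarrow> mact M a v = act G a v"
    using M by (auto simp: presents_module_def)
  have one: "(alg_one Q :: ('v, 'a, 'k) alg) \<in> alg_carrier Q I"
    by (auto simp: alg_one_def alg_carrier_def split: if_splits)
  have scale: "(\<lambda>p. c * a p) \<in> alg_carrier Q I" if "a \<in> alg_carrier Q I" for c :: 'k and a
    using that by (auto simp: alg_carrier_def)
  have sub: "vec.subspace (proj_sum G n)"
    by (intro vec.subspaceI proj_sum_zero proj_sum_add proj_sum_scale)
  have eqI: "v = w" if "v \<in> proj_sum G n" "w \<in> proj_sum G n" "\<And>s. s \<in> indices G \<Longrightarrow> part s v = part s w"
    for v w :: "('v, 'a, 'k) vec"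
    using proj_sum_eqI[OF that] .
  show ?thesis
    unfolding is_module_def car
  proof (intro conjI ballI allI sub proj_sum_finite_span fin)
    fix a :: "('v, 'a, 'k) alg" and v :: "('v, 'a, 'k) vec"
    assume a: "a \<in> alg_carrier Q I" and v: "v \<in> proj_sum G n"
    show "mact M a v \<in> proj_sum G n" using a v by (simp add: actM act_proj_sum)
    show "mact M a (v + w) = mact M a v + mact M a w" if "w \<in> proj_sum G n" for w
      using a v that fin by (intro eqI) (simp_all add: actM act_proj_sum proj_sum_add part_act mult_add_right)
    show "mact M (a + b) v = mact M a v + mact M b v" if "b \<in> alg_carrier Q I" for b
      using a v that fin
      by (intro eqI) (simp_all add: actM act_proj_sum proj_sum_add part_act mult_add_left alg_add_carrier)
    show "mact M a (vscale c v) = vscale c (mact M a v)" for c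
      using a v fin by (intro eqI) (simp_all add: actM act_proj_sum proj_sum_scale part_act mult_scale_right)
    show "mact M (\<lambda>p. c * a p) v = vscale c (mact M a v)" for c
      using a v fin scale
      by (intro eqI) (simp_all add: actM act_proj_sum proj_sum_scale part_act mult_scale_left)
    show "mact M (a \<odot> b) v = mact M a (mact M b v)" if "b \<in> alg_carrier Q I" for b
      using a v that fin by (intro eqI) (simp_all add: actM act_proj_sum part_act mult_assoc)
  next
    fix v :: "('v, 'a, 'k) vec"
    assume v: "v \<in> proj_sum G n"
    show "mact M (alg_one Q) v = v"
      using v fin one part_carrier[OF v]
      by (intro eqI) (simp_all add: actM act_proj_sum part_act one_mult)
  qed
qed

lemma is_hom_lin:
  assumes "finite (indices G)" "finite (indices H)"
    and M: "presents_module M G n" and N: "presents_module N H (n + e)"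
    and A: "between G H e A" and h: "\<And>v. v \<in> proj_sum G n \<Longrightarrow> h v = lin G H A v"
  shows "is_hom Q I M N h"
proof -
  have car: "mcar M = proj_sum G n" "mcar N = proj_sum H (n + e)"
    using M N by (auto simp: presents_module_def)
  show ?thesis
    unfolding is_hom_def car
    using assms lin_proj_sum[OF _ A]
    by (auto simp: proj_sum_add proj_sum_scale lin_add lin_scale presents_module_def act_proj_sum lin_act)
qed

end

section \<open>Isomorphisms of complexes\<close>

lemma is_hom_id: "is_hom Q I M M (\<lambda>v. v)"
  by (simp add: is_hom_def)

lemma module_zero:
  fixes M :: "('v, 'a, 'k::field) lmod"
  assumes "is_module Q I M"
  shows "0 \<in> mcar M" and "a \<in> alg_carrier Q I \<Longrightarrow> mact M a 0 = 0"
proof -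
  show z: "0 \<in> mcar M"
    using assms by (simp add: is_module_def vec.subspace_0)
  have "vscale 0 (0 :: ('v, 'a, 'k) vec) = 0" "vscale 0 (mact M a 0) = 0" by simp_all
  moreover have "mact M a (vscale 0 0) = vscale 0 (mact M a 0)" if "a \<in> alg_carrier Q I"
    using assms z that unfolding is_module_def by blast
  ultimately show "a \<in> alg_carrier Q I \<Longrightarrow> mact M a 0 = 0" by metis
qed

lemma is_hom_zero: "is_module Q I N \<Longrightarrow> is_hom Q I M N (\<lambda>v. 0)"
  using module_zero[of Q I N] by (auto simp: is_hom_def)

lemma hom_zero:
  assumes "is_hom Q I M N h" "is_module Q I M"
  shows "h 0 = 0"
proof -
  have "h (vscale 0 0) = vscale 0 (h 0)"
    using assms module_zero(1)[OF assms(2)] unfolding is_hom_def by blast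
  then show ?thesis by simp
qed

text \<open>The zero homotopy: chain maps which agree on the carriers are homotopic.\<close>

lemma homotopic_if_eq:
  assumes X: "bounded_complex Q I X" and Y: "bounded_complex Q I Y"
    and eq: "\<And>n v. v \<in> mcar (cob X n) \<Longrightarrow> f n v = g n v"
  shows "homotopic Q I X Y f g"
  unfolding homotopic_def
proof (intro exI[of _ "\<lambda>n v. 0"] conjI allI ballI)
  have Ym: "is_module Q I (cob Y n)" and "is_hom Q I (cob Y n) (cob Y (n + 1)) (cdf Y n)" for n
    using Y by (auto simp: bounded_complex_def)
  then have "cdf Y n 0 = 0" for n by (rule hom_zero[rotated])
  then show "f n v - g n v = cdf Y (n - 1) 0 + 0" if "v \<in> mcar (cob X n)" for n v
    using eq[OF that] by simp
  show "is_hom Q I (cob X n) (cob Y (n - 1)) (\<lambda>v. 0)" for n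
    using Ym by (rule is_hom_zero)
qed

lemma quasi_iso_id:
  assumes X: "bounded_complex Q I X"
  shows "quasi_iso Q I X X cmap_id"
proof -
  have "is_hom Q I (cob X (n - 1)) (cob X (n - 1 + 1)) (cdf X (n - 1))"
    "is_module Q I (cob X (n - 1))" for n
    using X unfolding bounded_complex_def by blast+
  then have "cdf X (n - 1) 0 = 0" "0 \<in> mcar (cob X (n - 1))" for n
    using hom_zero module_zero(1) by blast+
  then have "0 \<in> coboundaries X n" for n
    unfolding coboundaries_def by (metis image_eqI)
  then have "\<exists>v\<in>cocycles X n. w - v \<in> coboundaries X n" if "w \<in> cocycles X n" for n w
    using that by (intro bexI[of _ w]) simp_all
  then show ?thesis
    by (auto simp: quasi_iso_def chain_map_def cmap_id_def is_hom_id)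
qed

text \<open>
  Mutually inverse chain maps give an isomorphism in the derived category: the roofs with identities
  as left legs compose strictly, and all homotopies required of them are zero.
\<close>

lemma derived_iso_if_iso:
  fixes X Y :: "('v, 'a, 'k::field) cpx"
  assumes X: "bounded_complex Q I X" and Y: "bounded_complex Q I Y"
    and f: "chain_map Q I X Y f" and g: "chain_map Q I Y X g"
    and gf: "\<And>n v. v \<in> mcar (cob X n) \<Longrightarrow> g n (f n v) = v"
    and fg: "\<And>n v. v \<in> mcar (cob Y n) \<Longrightarrow> f n (g n v) = v"
  shows "derived_iso Q I X Y"
proof -
  have qX: "quasi_iso Q I X X cmap_id" and qY: "quasi_iso Q I Y Y cmap_id"
    using X Y by (simp_all add: quasi_iso_id)
  then have idX: "chain_map Q I X X cmap_id" and idY: "chain_map Q I Y Y cmap_id"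
    by (simp_all add: quasi_iso_def)
  have unit [simp]: "cmap_comp cmap_id h = h" "cmap_comp h cmap_id = h"
    for h :: "('v, 'a, 'k) cmap"
    by (simp_all add: cmap_comp_def cmap_id_def)
  have comp: "is_composite Q I Y (X, cmap_id, f) (Y, cmap_id, g) (X, cmap_id, cmap_comp g f)"
    if "bounded_complex Q I X" "bounded_complex Q I Y" "quasi_iso Q I X X cmap_id"
      "chain_map Q I X Y f" for X Y :: "('v, 'a, 'k) cpx" and f g
    using that homotopic_if_eq[OF that(1,2), of f f]
    unfolding is_composite_def prod.case
    by - (rule exI[of _ X], rule exI[of _ cmap_id], rule exI[of _ f], simp)
  have equiv: "roof_equiv Q I X X (X, cmap_id, h) (roof_id X)"
    if "bounded_complex Q I X" "quasi_iso Q I X X cmap_id" "\<And>n v. v \<in> mcar (cob X n) \<Longrightarrow> h n v = v"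
    for X :: "('v, 'a, 'k) cpx" and h
    using that homotopic_if_eq[OF that(1,1), of h cmap_id] homotopic_if_eq[OF that(1,1), of cmap_id cmap_id]
    by (auto simp: roof_equiv_def roof_id_def cmap_comp_def cmap_id_def quasi_iso_def
        intro!: exI[of _ X] exI[of _ "\<lambda>n v. v"])
  have "is_roof Q I X Y (X, cmap_id, f)" "is_roof Q I Y X (Y, cmap_id, g)"
    using X Y f g qX qY by (simp_all add: is_roof_def)
  moreover have "roof_equiv Q I X X (X, cmap_id, cmap_comp g f) (roof_id X)"
    "roof_equiv Q I Y Y (Y, cmap_id, cmap_comp f g) (roof_id Y)"
    using equiv[OF X qX] equiv[OF Y qY] gf fg by (simp_all add: cmap_comp_def)
  ultimately show ?thesis
    unfolding derived_iso_def using X Y comp[OF X Y qX f] comp[OF Y X qY g] by blast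
qed

context gentle_algebra
begin

definition presents :: "('v, 'a, 'k::field) cpx \<Rightarrow> 'v summands \<Rightarrow> ('v, 'a, 'k) matrix \<Rightarrow> bool" where
  "presents X G D \<longleftrightarrow> finite (indices G) \<and> between G G 1 D \<and>
     (\<forall>n. presents_module (cob X n) G n) \<and> (\<forall>n. \<forall>v\<in>proj_sum G n. cdf X n v = lin G G D v)"

lemma presents_bounded:
  fixes X :: "('v, 'a, 'k::field) cpx"
  assumes X: "presents X G D" and sq: "\<And>v n. v \<in> proj_sum G n \<Longrightarrow> lin G G D (lin G G D v) = 0"
  shows "bounded_complex Q I X"
proof -
  have fin: "finite (indices G)" and D: "between G G 1 D"
    and M: "\<And>n. presents_module (cob X n) G n" and d: "\<And>n v. v \<in> proj_sum G n \<Longrightarrow> cdf X n v = lin G G D v"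
    using X by (auto simp: presents_def)
  have car: "mcar (cob X n) = proj_sum G n" for n using M by (simp add: presents_module_def)
  have "{n. mcar (cob X n) \<noteq> {0}} \<subseteq> deg G ` indices G"
  proof
    fix n assume "n \<in> {n. mcar (cob X n) \<noteq> {0}}"
    then have "proj_sum G n \<noteq> ({0} :: ('v, 'a, 'k) vec set)" by (simp add: car)
    then obtain v :: "('v, 'a, 'k) vec" where "v \<in> proj_sum G n" "v \<noteq> 0"
      using proj_sum_zero[of G n] by (metis empty_iff insertI1 singletonD subset_singletonD subsetI)
    then obtain l where "v l \<noteq> 0" by (auto simp: fun_eq_iff)
    then obtain s where "s \<in> indices G" "deg G s = n"
      using \<open>v \<in> proj_sum G n\<close> unfolding proj_sum_def by blast
    then show "n \<in> deg G ` indices G" by blast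
  qed
  then show ?thesis
    unfolding bounded_complex_def
    using fin M D d sq is_hom_lin[OF fin fin M M D d] presents_module_is_module[OF fin M]
      lin_proj_sum[OF _ D] finite_subset[OF _ finite_imageI[OF fin]]
    by (auto simp: car)
qed

text \<open>
  Only \<open>Y\<close> is required to have square zero: the differential of \<open>X\<close> is conjugate to the one of
  \<open>Y\<close>. For the cone this replaces a direct verification.
\<close>

theorem derived_iso_if_matrix_iso:
  fixes X Y :: "('v, 'a, 'k::field) cpx"
  assumes X: "presents X G D" and Y: "presents Y H D'"
    and A: "between G H 0 A" and B: "between H G 0 B"
    and comm: "mmul (indices G) D A = mmul (indices H) A D'"
    and AB: "mmul (indices H) A B = idm G" and BA: "mmul (indices G) B A = idm H"
    and sq: "mmul (indices H) D' D' = 0"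
  shows "derived_iso Q I X Y"
proof -
  have fG: "finite (indices G)" and D: "between G G 1 D"
    and MX: "\<And>n. presents_module (cob X n) G n" and dX: "\<And>n v. v \<in> proj_sum G n \<Longrightarrow> cdf X n v = lin G G D v"
    using X by (auto simp: presents_def)
  have fH: "finite (indices H)" and D': "between H H 1 D'"
    and MY: "\<And>n. presents_module (cob Y n) H n" and dY: "\<And>n v. v \<in> proj_sum H n \<Longrightarrow> cdf Y n v = lin H H D' v"
    using Y by (auto simp: presents_def)
  have carX: "mcar (cob X n) = proj_sum G n" and carY: "mcar (cob Y n) = proj_sum H n" for n
    using MX MY by (auto simp: presents_module_def)
  have lin0: "lin G' H' 0 v = 0" for G' H' v
    by (simp add: lin_def)
  let ?f = "lin G H A" and ?g = "lin H G B"
  have gf: "?g (?f v) = v" if "v \<in> proj_sum G n" for v n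
    using that by (simp add: lin_lin fH AB lin_idm fG)
  have fg: "?f (?g v) = v" if "v \<in> proj_sum H n" for v n
    using that by (simp add: lin_lin fG BA lin_idm fH)
  have fd: "?f (lin G G D v) = lin H H D' (?f v)" for v
    by (simp add: lin_lin fH fG comm)
  have f_proj_sum: "?f v \<in> proj_sum H n" if "v \<in> proj_sum G n" for v n
    using lin_proj_sum[OF that A] by simp
  have g_proj_sum: "?g v \<in> proj_sum G n" if "v \<in> proj_sum H n" for v n
    using lin_proj_sum[OF that B] by simp
  have bY: "bounded_complex Q I Y"
    using Y by (rule presents_bounded) (simp add: lin_lin fH sq lin0)
  have bX: "bounded_complex Q I X"
    using X
  proof (rule presents_bounded)
    fix v :: "('v, 'a, 'k) vec" and n assume v: "v \<in> proj_sum G n"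
    then have "lin G G D (lin G G D v) \<in> proj_sum G (n + 1 + 1)"
      using lin_proj_sum[OF _ D] by blast
    then have "lin G G D (lin G G D v) = ?g (?f (lin G G D (lin G G D v)))"
      by (rule gf[symmetric])
    also have "\<dots> = ?g (lin H H D' (lin H H D' (?f v)))"
      by (simp only: fd)
    also have "\<dots> = ?g 0" by (simp only: lin_lin[OF fH, where A = D' and B = D'] sq lin0)
    also have "\<dots> = 0" by (simp add: lin_def)
    finally show "lin G G D (lin G G D v) = 0" .
  qed
  show ?thesis
  proof (rule derived_iso_if_iso[OF bX bY, of "\<lambda>n. ?f" "\<lambda>n. ?g"])
    show "chain_map Q I X Y (\<lambda>n. ?f)"
      unfolding chain_map_def
      using is_hom_lin[OF fG fH MX, of _ _ 0] MY A by (auto simp: carX dX dY f_proj_sum fd)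
    have "?g (lin H H D' v) = lin G G D (?g v)" if v: "v \<in> proj_sum H n"
      for v :: "('v, 'a, 'k) vec" and n
    proof -
      have "?g (lin H H D' v) = ?g (lin H H D' (?f (?g v)))" using v by (simp add: fg)
      also have "\<dots> = ?g (?f (lin G G D (?g v)))" by (simp only: fd)
      also have "\<dots> = lin G G D (?g v)" using lin_proj_sum[OF g_proj_sum[OF v] D] by (rule gf)
      finally show ?thesis .
    qed
    then show "chain_map Q I Y X (\<lambda>n. ?g)"
      unfolding chain_map_def
      using is_hom_lin[OF fH fG MY, of _ _ 0] MX B by (auto simp: carY dX dY g_proj_sum)
  qed (auto simp: carX carY gf fg)
qed

end

section \<open>Cyclic words and their band complexes\<close>

lemma letter_path_inv [simp]: "letter_path (letter_inv l) = letter_path l"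
  by (cases l) auto

lemma is_direct_inv [simp]: "is_direct (letter_inv l) \<longleftrightarrow> \<not> is_direct l"
  by (cases l) auto

lemma letter_end_inv [simp]: "letter_end Q (letter_inv l) = letter_start Q l"
  by (cases l) auto

lemma letter_start_inv [simp]: "letter_start Q (letter_inv l) = letter_end Q l"
  by (cases l) auto

lemma vertex_degree_shift: "vertex_degree w (d + e) i = vertex_degree w d i + e"
  by (simp add: vertex_degree_def)

lemma vertex_degree_Suc:
  "vertex_degree w d (Suc i) = vertex_degree w d i + (if is_direct (w ! i) then 1 else - 1)"
  by (simp add: vertex_degree_def)

lemma inject_zero [simp]: "inject i 0 = 0"
  by (auto simp: fun_eq_iff inject_def split: label.splits)

lemma inject_add: "inject i (v + w) = inject i v + inject i w"
  by (auto simp: fun_eq_iff inject_def split: label.splits)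

lemma inject_uminus: "inject i (- v) = - inject i v"
  by (auto simp: fun_eq_iff inject_def split: label.splits)

lemma inject_scale: "inject i (vscale c v) = vscale c (inject i v)"
  by (auto simp: fun_eq_iff inject_def vscale_def split: label.splits)

lemma inject_sum: "inject i (\<Sum>e\<in>E. g e) = (\<Sum>e\<in>E. inject i (g e))"
  using sum_comp_morphism[of "inject i" g E] by (simp add: o_def inject_add)

lemma mcar_dsum:
  assumes "\<And>i. i \<in> S \<Longrightarrow> mcar (M i) = {v. \<forall>l. v l \<noteq> 0 \<longrightarrow> P i l}"
  shows "mcar (dsum S M) = {v. \<forall>l. v l \<noteq> 0 \<longrightarrow> (\<exists>i\<in>S. \<exists>l'. l = Tag i l' \<and> P i l')}"
proof (intro equalityI subsetI)
  fix v assume v: "v \<in> mcar (dsum S M)"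
  have "\<exists>i\<in>S. \<exists>l'. l = Tag i l' \<and> P i l'" if nonzero: "v l \<noteq> 0" for l
  proof -
    obtain i l' where l: "i \<in> S" "l = Tag i l'"
      using v nonzero unfolding dsum_def lmod.simps mem_Collect_eq by blast
    then have "summand i v \<in> {v. \<forall>l. v l \<noteq> 0 \<longrightarrow> P i l}"
      using v assms by (auto simp: dsum_def)
    then show ?thesis using l nonzero by (auto simp: summand_def)
  qed
  then show "v \<in> {v. \<forall>l. v l \<noteq> 0 \<longrightarrow> (\<exists>i\<in>S. \<exists>l'. l = Tag i l' \<and> P i l')}" by blast
next
  fix v :: "('a, 'b, 'c) vec"
  assume "v \<in> {v. \<forall>l. v l \<noteq> 0 \<longrightarrow> (\<exists>i\<in>S. \<exists>l'. l = Tag i l' \<and> P i l')}"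
  then have v: "\<And>l. v l \<noteq> 0 \<Longrightarrow> \<exists>i\<in>S. \<exists>l'. l = Tag i l' \<and> P i l'" by blast
  have "summand i v \<in> mcar (M i)" if "i \<in> S" for i
    unfolding assms[OF that] using v by (fastforce simp: summand_def)
  then show "v \<in> mcar (dsum S M)"
    using v by (fastforce simp: dsum_def)
qed

text \<open>The change of degree along a word; a band has balance zero.\<close>

definition balance :: "'a letter list \<Rightarrow> int" where
  "balance w = (\<Sum>t<length w. if is_direct (w ! t) then 1 else - 1)"

lemma balance_eq:
  "balance w = int (length (filter is_direct w)) - int (length (filter (\<lambda>l. \<not> is_direct l) w))"
proof -
  have "(\<Sum>l\<leftarrow>w. if is_direct l then 1 else - 1) =
      int (length (filter is_direct w)) - int (length (filter (\<lambda>l. \<not> is_direct l) w))"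
    by (induction w) auto
  then show ?thesis
    by (simp add: balance_def sum_list_sum_nth atLeast0LessThan)
qed

context gentle_algebra
begin

definition adjacent :: "'a letter \<Rightarrow> 'a letter \<Rightarrow> bool" where
  "adjacent l r \<longleftrightarrow> letter_start Q l = letter_end Q r \<and> junction I l r"

text \<open>
  The local conditions on a band: its letters form a homotopy string also across the point where the
  last vertex is identified with the first. Words obtained from cones satisfy them, but need not be
  primitive.
\<close>

definition cyclic_word :: "'a letter list \<Rightarrow> bool" where
  "cyclic_word w \<longleftrightarrow> w \<noteq> [] \<and> (\<forall>l\<in>set w. nontrivial_nonzero Q I (letter_path l)) \<and>
     (\<forall>t<length w. adjacent (w ! t) (w ! (Suc t mod length w)))"

lemma homotopy_string_iff:
  "homotopy_string Q I w \<longleftrightarrow>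
     w \<noteq> [] \<and> (\<forall>l\<in>set w. nontrivial_nonzero Q I (letter_path l)) \<and> successively adjacent w"
  by (simp add: homotopy_string_def adjacent_def[abs_def])

lemma cyclic_word_if_double:
  assumes "homotopy_string Q I (w @ w)"
  shows "cyclic_word w"
proof -
  have w: "w \<noteq> []" "\<forall>l\<in>set w. nontrivial_nonzero Q I (letter_path l)" "successively adjacent (w @ w)"
    using assms by (auto simp: homotopy_string_iff)
  have "adjacent (w ! t) (w ! (Suc t mod length w))" if "t < length w" for t
  proof -
    have "adjacent ((w @ w) ! t) ((w @ w) ! Suc t)"
      using w(3) that unfolding successively_conv_nth by simp
    moreover have "(w @ w) ! Suc t = w ! (Suc t mod length w)"
      using that by (cases "Suc t = length w") (auto simp: nth_append)
    ultimately show ?thesis using that by (simp add: nth_append)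
  qed
  then show ?thesis using w by (simp add: cyclic_word_def)
qed

lemma homotopy_bandD:
  assumes "homotopy_band Q I w"
  shows "cyclic_word w" "balance w = 0"
  using assms cyclic_word_if_double by (auto simp: homotopy_band_def balance_eq)

lemma vertex_degree_next:
  assumes "balance w = 0" "t < length w"
  shows "vertex_degree w d (Suc t mod length w) = vertex_degree w d t + (if is_direct (w ! t) then 1 else - 1)"
proof (cases "Suc t = length w")
  case True
  have "vertex_degree w d (length w) = d"
    using assms(1) by (simp add: vertex_degree_def balance_def)
  then show ?thesis
    using vertex_degree_Suc[of w d t] True by (simp add: vertex_degree_def)
next
  case False
  then show ?thesis using assms(2) by (simp add: vertex_degree_Suc)
qed

lemma band_vertex_next:
  assumes "cyclic_word w" "t < length w"
  shows "band_vertex Q w (Suc t mod length w) = letter_start Q (w ! t)"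
  using assms by (auto simp: cyclic_word_def adjacent_def band_vertex_def)

subsection \<open>Multiples of paths\<close>

definition path_elem :: "'k::field \<Rightarrow> 'a list \<Rightarrow> ('v, 'a, 'k) alg" where
  "path_elem c p = (\<lambda>q. c * alg_path (arrows_start Q p, p) q)"

definition vertex_elem :: "'k::field \<Rightarrow> 'v \<Rightarrow> ('v, 'a, 'k) alg" where
  "vertex_elem c x = (\<lambda>q. c * alg_path (x, []) q)"

lemma path_elem_nonzero: "path_elem c p q \<noteq> 0 \<Longrightarrow> q = (arrows_start Q p, p)"
  by (auto simp: path_elem_def alg_path_def split: if_splits)

lemma path_elem_uminus: "path_elem (- c) p = - path_elem c p"
  by (simp add: path_elem_def fun_eq_iff)

lemma nontrivial_path_end: "nontrivial_nonzero Q I p \<Longrightarrow> path_end Q (x, p) = arrows_end Q p"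
  by (simp add: path_end_def arrows_end_def nontrivial_nonzero_def)

lemma path_elem_props:
  assumes "nontrivial_nonzero Q I p" "path_elem c p q \<noteq> 0"
  shows "nz q \<and> path_end Q q = arrows_end Q p \<and> fst q = arrows_start Q p"
  using path_elem_nonzero[OF assms(2)] assms(1)
  by (simp add: nontrivial_path_end) (simp add: nontrivial_nonzero_def)

lemma between_path_elem:
  assumes "s \<in> indices G" "t \<in> indices H" "deg H t = deg G s + e" "nontrivial_nonzero Q I p"
    "arrows_end Q p = vert G s" "arrows_start Q p = vert H t"
  shows "between G H e (entry s t (path_elem c p))"
  using assms path_elem_props by (intro between_entry) auto

lemma nz_start_eq: "nz (x, p) \<Longrightarrow> p \<noteq> [] \<Longrightarrow> x = tail Q (last p)"
  by (induction p) (auto simp: nz_Cons split: if_splits)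

text \<open>
  With \<open>path_elem_mult\<close> below: the composition of two consecutive letters is zero or again a letter,
  according to the relation at the junction.
\<close>

lemma path_elem_mult_rel:
  assumes "(last p, hd q) \<in> I" "p \<noteq> []" "q \<noteq> []"
  shows "path_elem c p \<odot> path_elem c' q = 0"
  using assms by (simp add: path_elem_def mult_scale_left mult_scale_right path_product nz_append fun_eq_iff)

lemma path_elem_mult:
  assumes "nontrivial_nonzero Q I (p @ q)" "p \<noteq> []" "q \<noteq> []"
  shows "path_elem c p \<odot> path_elem c' q = path_elem (c * c') (p @ q)"
proof -
  have "nz (arrows_start Q q, p @ q)"
    using assms by (simp add: nontrivial_nonzero_def arrows_start_def)
  moreover from this have "path_end Q (arrows_start Q q, q) = arrows_start Q p"
    using nz_start_eq assms(2) unfolding nz_append arrows_start_def by blast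
  ultimately show ?thesis
    using assms(3)
    by (simp add: path_elem_def mult_scale_left mult_scale_right path_product fun_eq_iff arrows_start_def)
qed

lemma path_vertex_elem_mult:
  assumes "nontrivial_nonzero Q I p"
  shows "path_elem c p \<odot> vertex_elem c' (arrows_start Q p) = path_elem (c * c') p"
    and "vertex_elem c' (arrows_end Q p) \<odot> path_elem c p = path_elem (c' * c) p"
  using assms
  by (simp_all add: path_elem_def vertex_elem_def mult_scale_left mult_scale_right path_product
      nontrivial_path_end fun_eq_iff algebra_simps)
    (simp_all add: nontrivial_nonzero_def nz_start)

lemma vertex_elem_mult:
  assumes "x \<in> verts Q"
  shows "vertex_elem c x \<odot> vertex_elem c' x = vertex_elem (c * c') x"
  using assms
  by (simp add: vertex_elem_def mult_scale_left mult_scale_right path_product fun_eq_iff)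

subsection \<open>Sums of band complexes\<close>

definition band_summands :: "nat set \<Rightarrow> (nat \<Rightarrow> 'a letter list) \<Rightarrow> (nat \<Rightarrow> int) \<Rightarrow> 'v summands" where
  "band_summands S w d = \<lparr>indices = (SIGMA a:S. {..<length (w a)}),
     vert = (\<lambda>(a, i). band_vertex Q (w a) i), deg = (\<lambda>(a, i). vertex_degree (w a) (d a) i)\<rparr>"

definition letter_entry :: "nat \<Rightarrow> 'a letter list \<Rightarrow> 'k::field \<Rightarrow> nat \<Rightarrow> ('v, 'a, 'k) matrix" where
  "letter_entry a w c t =
     entry (a, arrow_source w t) (a, arrow_target w t) (path_elem c (letter_path (w ! t)))"

lemma band_summands_simps [simp]:
  "indices (band_summands S w d) = (SIGMA a:S. {..<length (w a)})"
  "vert (band_summands S w d) (a, i) = band_vertex Q (w a) i"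
  "deg (band_summands S w d) (a, i) = vertex_degree (w a) (d a) i"
  by (simp_all add: band_summands_def)

lemma arrow_source_less: "t < length w \<Longrightarrow> arrow_source w t < length w"
  and arrow_target_less: "t < length w \<Longrightarrow> arrow_target w t < length w"
  by (cases w; auto simp: arrow_source_def arrow_target_def)+

lemma between_letter_entry:
  assumes w: "cyclic_word (w a)" "balance (w a) = 0" and a: "a \<in> S" and t: "t < length (w a)"
  shows "between (band_summands S w d) (band_summands S w d) 1 (letter_entry a (w a) c t)"
proof -
  have n: "nontrivial_nonzero Q I (letter_path (w a ! t))"
    using w(1) t by (simp add: cyclic_word_def)
  have l: "Suc t mod length (w a) < length (w a)" using t by (cases "w a") auto
  show ?thesis
    unfolding letter_entry_def
  proof (rule between_path_elem[OF _ _ _ n])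
    show "arrows_end Q (letter_path (w a ! t)) = vert (band_summands S w d) (a, arrow_source (w a) t)"
      "arrows_start Q (letter_path (w a ! t)) = vert (band_summands S w d) (a, arrow_target (w a) t)"
      using band_vertex_next[OF w(1) t]
      by (cases "w a ! t"; simp add: arrow_source_def arrow_target_def band_vertex_def)+
    show "deg (band_summands S w d) (a, arrow_target (w a) t) =
        deg (band_summands S w d) (a, arrow_source (w a) t) + 1"
      using vertex_degree_next[OF w(2) t, of "d a"]
      by (simp add: arrow_source_def arrow_target_def)
  qed (use a t l in \<open>auto simp: arrow_source_def arrow_target_def\<close>)
qed

lemma mcar_proj: "mcar (proj Q I x :: ('v, 'a, 'k::field) lmod) =
    {v. \<forall>l. v l \<noteq> 0 \<longrightarrow> (\<exists>p. l = Pth p \<and> nz p \<and> fst p = x)}"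
proof (intro equalityI subsetI)
  fix v :: "('v, 'a, 'k) vec"
  assume "v \<in> mcar (proj Q I x)"
  then obtain u where u: "v = vec_of_alg u" "\<forall>p. \<not> nz p \<longrightarrow> u p = 0" "\<forall>p. u p \<noteq> 0 \<longrightarrow> fst p = x"
    unfolding proj_def alg_carrier_def lmod.simps by blast
  have "\<exists>p. l = Pth p \<and> nz p \<and> fst p = x" if "v l \<noteq> 0" for l
  proof (cases l)
    case (Pth p)
    then have "u p \<noteq> 0" using that by (simp add: u(1) vec_of_alg_def)
    then show ?thesis using u(2,3) Pth by blast
  qed (use that in \<open>simp add: u(1) vec_of_alg_def\<close>)
  then show "v \<in> {v. \<forall>l. v l \<noteq> 0 \<longrightarrow> (\<exists>p. l = Pth p \<and> nz p \<and> fst p = x)}" by blast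
next
  fix v :: "('v, 'a, 'k) vec"
  assume v: "v \<in> {v. \<forall>l. v l \<noteq> 0 \<longrightarrow> (\<exists>p. l = Pth p \<and> nz p \<and> fst p = x)}"
  then have "v = vec_of_alg (alg_of_vec v)"
    by (auto simp: fun_eq_iff vec_of_alg_def alg_of_vec_def split: label.splits)
  moreover have "alg_of_vec v \<in> {u \<in> alg_carrier Q I. \<forall>p. u p \<noteq> 0 \<longrightarrow> fst p = x}"
    using v unfolding alg_carrier_def alg_of_vec_def mem_Collect_eq by blast
  ultimately show "v \<in> mcar (proj Q I x)"
    unfolding proj_def lmod.simps by (rule image_eqI)
qed

lemma presents_module_bands:
  assumes "finite S"
  shows "presents_module (dsum S (\<lambda>a. dsum {i. i < length (w a) \<and> vertex_degree (w a) (d a) i = n}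
      (\<lambda>i. proj Q I (band_vertex Q (w a) i)))) (band_summands S w d) n"
    (is "presents_module (dsum S ?M) ?G n")
proof -
  let ?N = "\<lambda>a. {i. i < length (w a) \<and> vertex_degree (w a) (d a) i = n}"
  have "mcar (?M a) = {v. \<forall>l. v l \<noteq> 0 \<longrightarrow> (\<exists>i\<in>?N a. \<exists>l'. l = Tag i l' \<and>
      (\<exists>p. l' = Pth p \<and> nz p \<and> fst p = band_vertex Q (w a) i))}" for a
    by (rule mcar_dsum) (rule mcar_proj)
  from mcar_dsum[OF this] have car: "mcar (dsum S ?M) = proj_sum ?G n"
    unfolding proj_sum_def by (auto 0 4)
  have "mact (dsum S ?M) a v = act ?G a v" if v: "v \<in> proj_sum ?G n" for a v
  proof -
    have "mact (dsum S ?M) a v = (\<Sum>b\<in>S. \<Sum>i\<in>?N b. put (b, i) (a \<odot> part (b, i) v))"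
      by (simp add: dsum_def proj_def inject_sum put_def part_def)
    also have "\<dots> = (\<Sum>b\<in>S. \<Sum>i<length (w b). put (b, i) (a \<odot> part (b, i) v))"
    proof (rule sum.cong[OF refl], rule sum.mono_neutral_left, goal_cases)
      case (3 b)
      show ?case
      proof
      fix i
      assume "i \<in> {..<length (w b)} - ?N b"
      then have "part (b, i) v = 0"
        using part_proj_sum[OF v, of "(b, i)"] by (auto simp: fun_eq_iff)
      then show "put (b, i) (a \<odot> part (b, i) v) = 0" by simp
      qed
    qed auto
    also have "\<dots> = act ?G a v"
      unfolding act_def band_summands_simps using assms by (simp add: sum.Sigma split_def)
    finally show ?thesis .
  qed
  with car show ?thesis by (simp add: presents_module_def)
qed


lemma lin_matrix_add: "lin G H (A + B) v = lin G H A v + lin G H B v"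
  by (simp add: lin_def mult_add_right sum.distrib put_add)

lemma lin_matrix_zero: "lin G H 0 v = 0"
  by (simp add: lin_def)

lemma lin_matrix_sum: "lin G H (\<Sum>e\<in>E. g e) v = (\<Sum>e\<in>E. lin G H (g e) v)"
  using sum_comp_morphism[of "\<lambda>A. lin G H A v" g E]
  by (simp add: o_def lin_matrix_add lin_matrix_zero)

lemma lin_entry:
  assumes "finite (indices G)" "finite (indices H)" "s \<in> indices G" "t \<in> indices H"
  shows "lin G H (entry s t u) v = put t (part s v \<odot> u)"
proof -
  have "(\<Sum>r\<in>indices G. part r v \<odot> entry s t u r t') =
      (\<Sum>r\<in>indices G. if r = s then if t' = t then part s v \<odot> u else 0 else 0)" for t'
    by (intro sum.cong) (auto simp: entry_def)
  also have "\<dots> t' = (if t' = t then part s v \<odot> u else 0)" for t'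
    using assms(1,3) by (simp only: sum.delta if_True)
  finally have "lin G H (entry s t u) v = (\<Sum>t'\<in>indices H. if t' = t then put t (part s v \<odot> u) else 0)"
    unfolding lin_def by (intro sum.cong) auto
  then show ?thesis using assms(2,4) by (simp only: sum.delta if_True)
qed

definition scalar_at :: "nat \<Rightarrow> 'k::field \<Rightarrow> nat \<Rightarrow> 'k" where
  "scalar_at j c t = (if t = j then c else 1)"

lemma put_vec_path_map:
  "inject a (inject i (vec_path_map Q I p (summand i' (summand a' v)))) =
    put (a, i) (part (a', i') v \<odot> alg_path (arrows_start Q p, p))"
  by (simp add: put_def part_def vec_path_map_def path_map_def)

lemma mult_path_elem: "u \<odot> path_elem c p = (\<lambda>q. c * (u \<odot> alg_path (arrows_start Q p, p)) q)"
  by (simp add: path_elem_def mult_scale_right)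

lemma inject_band_cdf:
  "inject a (cdf (band_complex Q I w d j c) n (summand a v)) =
    (\<Sum>t<length w. put (a, arrow_target w t)
       (part (a, arrow_source w t) v \<odot> path_elem (scalar_at j c t) (letter_path (w ! t))))"
  by (simp add: band_complex_def inject_sum inject_scale put_vec_path_map mult_path_elem put_scale
      scalar_at_def)

definition bands_matrix :: "nat set \<Rightarrow> (nat \<Rightarrow> 'a letter list) \<Rightarrow> (nat \<Rightarrow> nat \<Rightarrow> 'k::field) \<Rightarrow>
    ('v, 'a, 'k) matrix" where
  "bands_matrix S w c = (\<Sum>a\<in>S. \<Sum>t<length (w a). letter_entry a (w a) (c a t) t)"

lemma between_bands_matrix:
  assumes "\<And>a. a \<in> S \<Longrightarrow> cyclic_word (w a) \<and> balance (w a) = 0"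
  shows "between (band_summands S w d) (band_summands S w d) 1 (bands_matrix S w c)"
  unfolding bands_matrix_def using assms by (intro between_sum between_letter_entry) auto

lemma lin_bands_matrix:
  assumes "finite S" and "\<And>a. a \<in> S \<Longrightarrow> T a \<subseteq> {..<length (w a)}"
  shows "lin (band_summands S w d) (band_summands S w d) (\<Sum>a\<in>S. \<Sum>t\<in>T a. letter_entry a (w a) (c a t) t) v =
    (\<Sum>a\<in>S. \<Sum>t\<in>T a. put (a, arrow_target (w a) t)
       (part (a, arrow_source (w a) t) v \<odot> path_elem (c a t) (letter_path (w a ! t))))"
  unfolding lin_matrix_sum letter_entry_def
proof (intro sum.cong refl lin_entry)
  fix a t assume "a \<in> S" "t \<in> T a"
  then have "t < length (w a)" using assms(2) by blast
  then show "(a, arrow_source (w a) t) \<in> indices (band_summands S w d)"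
    "(a, arrow_target (w a) t) \<in> indices (band_summands S w d)"
    using \<open>a \<in> S\<close> by (auto simp: arrow_source_less arrow_target_less)
qed (use assms(1) in auto)

lemma presents_band_sum:
  assumes S: "finite S" and w: "\<And>a. a \<in> S \<Longrightarrow> cyclic_word (w a) \<and> balance (w a) = 0"
  shows "presents (cpx_dsum S (\<lambda>a. band_complex Q I (w a) (d a) (j a) (c a)))
    (band_summands S w d) (bands_matrix S w (\<lambda>a. scalar_at (j a) (c a)))"
  unfolding presents_def
proof (intro conjI allI ballI)
  show "finite (indices (band_summands S w d))" using S by simp
  show "between (band_summands S w d) (band_summands S w d) 1
      (bands_matrix S w (\<lambda>a. scalar_at (j a) (c a)))"
    using w by (rule between_bands_matrix)
  show "presents_module (cob (cpx_dsum S (\<lambda>a. band_complex Q I (w a) (d a) (j a) (c a))) n)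
      (band_summands S w d) n" for n
    unfolding cpx_dsum_def band_complex_def cpx.simps using S by (rule presents_module_bands)
  show "cdf (cpx_dsum S (\<lambda>a. band_complex Q I (w a) (d a) (j a) (c a))) n v =
      lin (band_summands S w d) (band_summands S w d) (bands_matrix S w (\<lambda>a. scalar_at (j a) (c a))) v" for n v
    unfolding bands_matrix_def
    by (subst lin_bands_matrix) (simp_all add: S cpx_dsum_def inject_band_cdf)
qed

text \<open>
  If one letter maps into the vertex at which another starts, then both are direct or both are inverse and
  they are neighbours, so that the junction of the word is a relation.
\<close>

lemma letter_products_zero:
  assumes w: "cyclic_word w" and t: "t < length w" "t' < length w"
    and eq: "arrow_target w t = arrow_source w t'"
  shows "path_elem c (letter_path (w ! t)) \<odot> path_elem c' (letter_path (w ! t')) = 0"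
proof -
  let ?n = "length w"
  have ne: "letter_path (w ! s) \<noteq> []" if "s < ?n" for s
    using w that by (auto simp: cyclic_word_def nontrivial_nonzero_def)
  have adj: "junction I (w ! s) (w ! (Suc s mod ?n))" if "s < ?n" for s
    using w that by (auto simp: cyclic_word_def adjacent_def)
  have suc_inj: "s = s'" if "Suc s mod ?n = Suc s' mod ?n" "s < ?n" "s' < ?n" for s s'
    using that by (auto simp: mod_Suc split: if_splits)
  show ?thesis
  proof (cases "w ! t"; cases "w ! t'")
    fix p q assume pq: "w ! t = Direct p" "w ! t' = Direct q"
    then have "t' = Suc t mod ?n" using eq by (simp add: arrow_source_def arrow_target_def)
    then show ?thesis using pq adj[OF t(1)] ne[OF t(1)] ne[OF t(2)] by (simp add: path_elem_mult_rel)
  next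
    fix p q assume pq: "w ! t = Inverse p" "w ! t' = Inverse q"
    then have "t = Suc t' mod ?n" using eq by (simp add: arrow_source_def arrow_target_def)
    then show ?thesis using pq adj[OF t(2)] ne[OF t(1)] ne[OF t(2)] by (simp add: path_elem_mult_rel)
  next
    fix p q assume pq: "w ! t = Direct p" "w ! t' = Inverse q"
    then have "Suc t mod ?n = Suc t' mod ?n" using eq by (simp add: arrow_source_def arrow_target_def)
    then have "t = t'" using t by (rule suc_inj)
    with pq show ?thesis by simp
  next
    fix p q assume pq: "w ! t = Inverse p" "w ! t' = Direct q"
    then have "t = t'" using eq by (simp add: arrow_source_def arrow_target_def)
    with pq show ?thesis by simp
  qed
qed

lemma bands_matrix_square:
  assumes S: "finite S" and w: "\<And>a. a \<in> S \<Longrightarrow> cyclic_word (w a)"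
  shows "mmul (indices (band_summands S w d)) (bands_matrix S w c) (bands_matrix S w c) = 0"
proof -
  let ?N = "indices (band_summands S w d)"
  have fin: "finite ?N" using S by simp
  have "mmul ?N (letter_entry a (w a) (c a t) t) (letter_entry b (w b) (c b t') t') = 0"
    if "a \<in> S" "b \<in> S" "t < length (w a)" "t' < length (w b)" for a b t t'
    unfolding letter_entry_def mmul_entry[OF fin]
    using letter_products_zero[OF w[OF that(1)] that(3), where t' = t' and c = "c a t" and c' = "c b t'"] that(4) by auto
  then show ?thesis
    by (simp add: bands_matrix_def mmul_sum_left mmul_sum_right)
qed

abbreviation cone_summands :: "'a letter list \<Rightarrow> int \<Rightarrow> 'a letter list \<Rightarrow> int \<Rightarrow> 'v summands" where
  "cone_summands \<sigma> d\<sigma> \<tau> d\<tau> \<equiv>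
     band_summands {0, 1} (\<lambda>a. if a = 0 then \<sigma> else \<tau>) (\<lambda>a. if a = 0 then d\<sigma> - 1 else d\<tau>)"

text \<open>
  The shift of \<open>B(\<sigma>, lam)\<close> appears as a lower degree of vertex \<open>0\<close> and as the sign at the letters
  of \<open>\<sigma>\<close>.
\<close>

lemma presents_cone:
  fixes F :: "('v, 'a, 'k::field) cmap"
  assumes \<sigma>: "cyclic_word \<sigma>" "balance \<sigma> = 0" and \<tau>: "cyclic_word \<tau>" "balance \<tau> = 0"
    and F: "single_map Q I \<sigma> d\<sigma> l\<sigma> lam \<tau> d\<tau> l\<tau> mu x y f F"
  shows "presents (cone (band_complex Q I \<sigma> d\<sigma> l\<sigma> lam) (band_complex Q I \<tau> d\<tau> l\<tau> mu) F)
    (cone_summands \<sigma> d\<sigma> \<tau> d\<tau>)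
    ((\<Sum>t<length \<sigma>. letter_entry 0 \<sigma> (- scalar_at l\<sigma> lam t) t) +
     (\<Sum>t<length \<tau>. letter_entry 1 \<tau> (scalar_at l\<tau> mu t) t) + entry (0, x) (1, y) (path_elem 1 f))"
    (is "presents (cone ?X ?Y F) ?G (?A + ?B + ?f)")
proof -
  have x: "x < length \<sigma>" and y: "y < length \<tau>" and deg: "vertex_degree \<sigma> d\<sigma> x = vertex_degree \<tau> d\<tau> y"
    and f: "nontrivial_nonzero Q I f" "arrows_end Q f = band_vertex Q \<sigma> x"
      "arrows_start Q f = band_vertex Q \<tau> y"
    and F_eq: "\<And>n v. v \<in> mcar (cob ?X n) \<Longrightarrow> F n v = inject y (vec_path_map Q I f (summand x v))"
    using F by (auto simp: single_map_def)
  let ?w = "\<lambda>a::nat. if a = 0 then \<sigma> else \<tau>" and ?d = "\<lambda>a::nat. if a = 0 then d\<sigma> - 1 else d\<tau>"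
  let ?c = "\<lambda>a::nat. if a = 0 then \<lambda>t. - scalar_at l\<sigma> lam t else scalar_at l\<tau> mu"
  have AB: "?A + ?B = bands_matrix {0, 1} ?w ?c"
    by (simp add: bands_matrix_def)
  have cyc: "cyclic_word (?w a) \<and> balance (?w a) = 0" for a using \<sigma> \<tau> by simp
  have fin: "finite (indices ?G)" by simp
  have modules: "cob (cone ?X ?Y F) n = dsum {0, 1} (\<lambda>a. dsum {i. i < length (?w a) \<and>
      vertex_degree (?w a) (?d a) i = n} (\<lambda>i. proj Q I (band_vertex Q (?w a) i)))" for n
  proof -
    have "vertex_degree \<sigma> (d\<sigma> - 1) i = n \<longleftrightarrow> vertex_degree \<sigma> d\<sigma> i = n + 1" for i
      using vertex_degree_shift[of \<sigma> d\<sigma> "- 1" i] by auto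
    then have "(if a = 0 then cob ?X (n + 1) else cob ?Y n) = dsum {i. i < length (?w a) \<and>
      vertex_degree (?w a) (?d a) i = n} (\<lambda>i. proj Q I (band_vertex Q (?w a) i))" for a :: nat
      by (simp add: band_complex_def)
    then show ?thesis by (simp add: cone_def)
  qed
  have pm: "presents_module (cob (cone ?X ?Y F) n) ?G n" for n
    unfolding modules by (rule presents_module_bands) simp
  show ?thesis
    unfolding presents_def
  proof (intro conjI allI ballI fin pm)
    have "between ?G ?G 1 ?f"
      using x y deg f vertex_degree_shift[of \<sigma> d\<sigma> "- 1" x] by (intro between_path_elem) simp_all
    then show "between ?G ?G 1 (?A + ?B + ?f)"
      unfolding AB using between_bands_matrix[of "{0, 1}" ?w] cyc by (intro between_add) blast+
  next
    fix n and v :: "('v, 'a, 'k) vec"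
    assume "v \<in> proj_sum ?G n"
    then have "v \<in> mcar (cob (cone ?X ?Y F) n)" using pm by (simp add: presents_module_def)
    then have "summand 0 v \<in> mcar (cob ?X (n + 1))" by (simp add: cone_def dsum_def)
    note F_v = F_eq[OF this]
    have "lin ?G ?G (?A + ?B + ?f) v = lin ?G ?G (bands_matrix {0, 1} ?w ?c) v + lin ?G ?G ?f v"
      by (simp only: AB lin_matrix_add)
    also have "lin ?G ?G ?f v = put (1, y) (part (0, x) v \<odot> path_elem 1 f)"
      using x y by (intro lin_entry) auto
    also have "lin ?G ?G (bands_matrix {0, 1} ?w ?c) v =
       (\<Sum>t<length \<sigma>. put (0, arrow_target \<sigma> t)
         (part (0, arrow_source \<sigma> t) v \<odot> path_elem (- scalar_at l\<sigma> lam t) (letter_path (\<sigma> ! t)))) +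
       (\<Sum>t<length \<tau>. put (1, arrow_target \<tau> t)
         (part (1, arrow_source \<tau> t) v \<odot> path_elem (scalar_at l\<tau> mu t) (letter_path (\<tau> ! t))))"
      unfolding bands_matrix_def by (subst lin_bands_matrix) simp_all
    also have "\<dots> = inject 0 (- cdf ?X (n + 1) (summand 0 v)) + inject 1 (cdf ?Y n (summand 1 v))"
      by (simp add: inject_uminus inject_band_cdf path_elem_uminus mult_uminus_right put_uminus sum_negf)
    finally have "lin ?G ?G (?A + ?B + ?f) v = inject 0 (- cdf ?X (n + 1) (summand 0 v)) +
        inject 1 (cdf ?Y n (summand 1 v)) + put (1, y) (part (0, x) v \<odot> path_elem 1 f)" .
    also have "put (1, y) (part (0, x) v \<odot> path_elem 1 f) = inject 1 (F (n + 1) (summand 0 v))"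
      by (simp add: F_v put_vec_path_map path_elem_def)
    finally have lin_eq: "lin ?G ?G (?A + ?B + ?f) v = inject 0 (- cdf ?X (n + 1) (summand 0 v)) +
        inject 1 (cdf ?Y n (summand 1 v)) + inject 1 (F (n + 1) (summand 0 v))" .
    show "cdf (cone ?X ?Y F) n v = lin ?G ?G (?A + ?B + ?f) v"
      unfolding lin_eq by (simp only: cone_def cpx.simps inject_add add_ac)
  qed
qed

end

section \<open>Splitting a cyclic word that is a power\<close>

lemma primitive_root_nonzero: "primitive_root_of_unity k \<omega> \<Longrightarrow> \<omega> \<noteq> 0"
  by (auto simp: primitive_root_of_unity_def power_0_left)

lemma primitive_root_inj:
  assumes \<omega>: "primitive_root_of_unity k (\<omega> :: 'k::field)" and eq: "\<omega> ^ a = \<omega> ^ b"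
    and lt: "a < b + k" "b < a + k"
  shows "a = b"
proof -
  have nz: "\<omega> \<noteq> 0" using \<omega> by (rule primitive_root_nonzero)
  have False if "c < d" "d < c + k" "\<omega> ^ c = \<omega> ^ d" for c d
  proof -
    have "\<omega> ^ d = \<omega> ^ c * \<omega> ^ (d - c)" using that(1) by (metis le_add_diff_inverse less_imp_le power_add)
    then have "\<omega> ^ (d - c) = 1" using that(3) nz by simp
    moreover have "1 \<le> d - c" "d - c < k" using that by auto
    ultimately show False using \<omega> by (auto simp: primitive_root_of_unity_def)
  qed
  from this[of a b] this[of b a] show ?thesis using eq lt by (metis nat_neq_iff)
qed

lemma sum_powers_root:
  assumes "(z :: 'k::field) ^ k = 1" "z \<noteq> 1"
  shows "(\<Sum>i<k. z ^ i) = 0"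
  using assms power_diff_1_eq[of z k] by simp

text \<open>
  The characteristic does not divide \<open>k\<close>: otherwise all \<open>k\<close> powers of \<open>\<omega>\<close>, including \<open>1\<close>, would be
  roots of \<open>1 + X + \<dots> + X\<^sup>k\<^sup>-\<^sup>1\<close>.
\<close>

lemma primitive_root_order_nonzero:
  assumes \<omega>: "primitive_root_of_unity k (\<omega> :: 'k::field)"
  shows "(of_nat k :: 'k) \<noteq> 0"
proof
  assume k: "(of_nat k :: 'k) = 0"
  have k1: "1 \<le> k" and \<omega>k: "\<omega> ^ k = 1" using \<omega> by (auto simp: primitive_root_of_unity_def)
  define P :: "'k poly" where "P = (\<Sum>i<k. monom 1 i)"
  have eval: "poly P z = (\<Sum>i<k. z ^ i)" for z
    by (simp add: P_def poly_sum poly_monom)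
  have coeff: "coeff P i = (if i < k then 1 else 0)" for i
    by (simp add: P_def coeff_sum)
  have P0: "P \<noteq> 0" using coeff[of 0] k1 by auto
  have deg: "degree P \<le> k - 1"
    by (rule degree_le) (auto simp: coeff)
  have "poly P (\<omega> ^ q) = 0" if "q < k" for q
  proof (cases "\<omega> ^ q = 1")
    case True
    then show ?thesis using k by (simp add: eval)
  next
    case False
    moreover have "(\<omega> ^ q) ^ k = 1" by (metis \<omega>k power_mult power_one mult.commute)
    ultimately show ?thesis by (simp add: eval sum_powers_root)
  qed
  then have "(\<lambda>q. \<omega> ^ q) ` {..<k} \<subseteq> {z. poly P z = 0}" by auto
  moreover have "inj_on (\<lambda>q. \<omega> ^ q) {..<k}"
    by (rule inj_onI, rule primitive_root_inj[OF \<omega>]) auto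
  ultimately have "k \<le> card {z. poly P z = 0}"
    using card_mono[OF poly_roots_finite[OF P0], of "(\<lambda>q. \<omega> ^ q) ` {..<k}"] by (simp add: card_image)
  also have "\<dots> \<le> degree P" using P0 by (rule card_poly_roots_bound)
  finally show False using deg k1 by simp
qed

lemma root_orthogonality:
  assumes \<omega>: "primitive_root_of_unity k (\<omega> :: 'k::field)" and lt: "a < b + k" "b < a + k"
  shows "(\<Sum>i<k. (\<omega> ^ a / \<omega> ^ b) ^ i) = (if a = b then of_nat k else 0)"
proof (cases "a = b")
  case True
  have "\<omega> \<noteq> 0" using \<omega> by (rule primitive_root_nonzero)
  with True show ?thesis by simp
next
  case False
  have nz: "\<omega> \<noteq> 0" and \<omega>k: "\<omega> ^ k = 1"
    using \<omega> primitive_root_nonzero[OF \<omega>] by (auto simp: primitive_root_of_unity_def)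
  have "(\<omega> ^ c) ^ k = 1" for c by (metis \<omega>k power_mult power_one mult.commute)
  then have "(\<omega> ^ a / \<omega> ^ b) ^ k = 1" by (simp add: power_divide)
  moreover have "\<omega> ^ a / \<omega> ^ b \<noteq> 1" using primitive_root_inj[OF \<omega> _ lt] False nz by auto
  ultimately show ?thesis using False sum_powers_root[of "\<omega> ^ a / \<omega> ^ b" k] by simp
qed

lemma bij_betw_Suc_mod: "bij_betw (\<lambda>t. Suc t mod n) {..<n} {..<n}"
proof -
  have "inj_on (\<lambda>t. Suc t mod n) {..<n}"
    by (auto simp: inj_on_def mod_Suc split: if_splits)
  moreover have "(\<lambda>t. Suc t mod n) ` {..<n} \<subseteq> {..<n}" by auto
  ultimately show ?thesis
    by (simp add: bij_betw_def endo_inj_surj)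
qed

lemma Suc_mod_mod: "n dvd N \<Longrightarrow> Suc m mod N mod n = Suc (m mod n) mod n"
  by (simp add: mod_mod_cancel mod_Suc_eq)

text \<open>
  A letter of a cyclic diagram together with the vertices at its left and right end. Recording the
  vertices allows a diagram to run through the summands of a given complex in any order.
\<close>

record ('a, 'k) edge =
  lft :: "nat \<times> nat"
  rgt :: "nat \<times> nat"
  lett :: "'a letter"
  coef :: 'k

definition edge_source :: "('a, 'k) edge \<Rightarrow> nat \<times> nat" where
  "edge_source e = (if is_direct (lett e) then lft e else rgt e)"

definition edge_target :: "('a, 'k) edge \<Rightarrow> nat \<times> nat" where
  "edge_target e = (if is_direct (lett e) then rgt e else lft e)"

text \<open>
  Walking from left to right through an edge \<open>c p\<close>, the basis has to be rescaled by this factor if the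
  scalar \<open>c\<close> is to be replaced by \<open>1\<close>.
\<close>

definition holonomy :: "('a, 'k::field) edge \<Rightarrow> 'k" where
  "holonomy e = (if is_direct (lett e) then inverse (coef e) else coef e)"

context gentle_algebra
begin

definition edge_matrix :: "('a, 'k::field) edge \<Rightarrow> ('v, 'a, 'k) matrix" where
  "edge_matrix e = entry (edge_source e) (edge_target e) (path_elem (coef e) (letter_path (lett e)))"

end

text \<open>
  A complex whose summands \<open>G\<close> are passed once each by a closed diagram spelling \<open>\<theta>\<^sup>k\<close>. The position
  \<open>m\<close> on the diagram lies over the position \<open>m mod n\<close> on \<open>\<theta>\<close>. The assumption \<open>hol\<close> says that
  \<open>\<rho>\<^sup>k\<close> is the scalar obtained when all scalars are moved to one direct letter.
\<close>

locale cyclic_power = gentle_algebra Q I for Q :: "('v, 'a) pre_digraph" and I +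
  fixes diagram :: "('a, 'k::field) edge list" and G :: "'v summands" and \<theta> :: "'a letter list"
    and d :: int and k n l :: nat and \<omega> \<rho> :: 'k
  assumes len: "length diagram = k * n" and n: "n = length \<theta>"
    and \<theta>: "cyclic_word \<theta>" "balance \<theta> = 0"
    and lett: "m < k * n \<Longrightarrow> lett (diagram ! m) = \<theta> ! (m mod n)"
    and rgt: "m < k * n \<Longrightarrow> rgt (diagram ! m) = lft (diagram ! (Suc m mod (k * n)))"
    and dist: "distinct (map lft diagram)" and set: "set (map lft diagram) = indices G"
    and vert: "m < k * n \<Longrightarrow> vert G (lft (diagram ! m)) = band_vertex Q \<theta> (m mod n)"
    and deg: "m < k * n \<Longrightarrow> deg G (lft (diagram ! m)) = vertex_degree \<theta> d (m mod n)"
    and coef: "m < k * n \<Longrightarrow> coef (diagram ! m) \<noteq> 0"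
    and hol: "(\<Prod>m<k * n. holonomy (diagram ! m)) * \<rho> ^ k = 1"
    and \<omega>: "primitive_root_of_unity k \<omega>" and l: "direct_position \<theta> l"
begin

definition power_summands :: "'v summands" where
  "power_summands = band_summands {1..k} (\<lambda>_. \<theta>) (\<lambda>_. d)"

definition power_matrix :: "('v, 'a, 'k) matrix" where
  "power_matrix = bands_matrix {1..k} (\<lambda>_. \<theta>) (\<lambda>i. scalar_at l (\<omega> ^ i * \<rho>))"

definition pos :: "nat \<Rightarrow> nat \<times> nat" where
  "pos m = lft (diagram ! m)"

text \<open>
  The number of letters before position \<open>m\<close> which lie over the letter \<open>l\<close> of \<open>\<theta>\<close>, the one that carries the
  scalar \<open>\<omega>\<^sup>i \<rho>\<close> in the \<open>i\<close>-th summand.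
\<close>

definition crossings :: "nat \<Rightarrow> nat" where
  "crossings m = (\<Sum>j<m. if j mod n = l then 1 else 0)"

definition hol_prod :: "nat \<Rightarrow> 'k" where
  "hol_prod m = (\<Prod>j<m. (if j mod n = l then \<rho> else 1) * holonomy (diagram ! j))"

text \<open>
  The coefficient with which position \<open>m\<close> of the diagram contributes to the \<open>i\<close>-th copy of \<open>\<theta>\<close>. It is
  determined, up to a constant, by the requirement that the contributions are compatible with
  every letter, see \<open>\<chi>_next\<close>; the letter \<open>l\<close> being direct, each crossing of it contributes
  \<open>\<omega>\<^sup>i \<rho>\<close> and every edge its holonomy.
\<close>

definition \<chi> :: "nat \<Rightarrow> nat \<Rightarrow> 'k" where
  "\<chi> m i = (\<omega> ^ i) ^ crossings m * hol_prod m"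

abbreviation N :: nat where "N \<equiv> k * n"
abbreviation H :: "'v summands" where "H \<equiv> power_summands"
abbreviation x :: "nat \<Rightarrow> 'v" where "x m \<equiv> band_vertex Q \<theta> (m mod n)"

definition split_matrix :: "('v, 'a, 'k) matrix" where
  "split_matrix = (\<Sum>m<N. \<Sum>i\<in>{1..k}. entry (pos m) (i, m mod n) (vertex_elem (\<chi> m i) (x m)))"

text \<open>
  Up to the factor \<open>1 / k\<close>, the inverse of a character table is obtained by transposing it and inverting its
  entries.
\<close>

definition join_matrix :: "('v, 'a, 'k) matrix" where
  "join_matrix = (\<Sum>m<N. \<Sum>i\<in>{1..k}.
     entry (i, m mod n) (pos m) (vertex_elem (inverse (of_nat k * \<chi> m i)) (x m)))"

lemma k1: "1 \<le> k" and \<omega>k: "\<omega> ^ k = 1" and \<omega>0: "\<omega> \<noteq> 0"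
  using \<omega> primitive_root_nonzero[OF \<omega>] by (auto simp: primitive_root_of_unity_def)

lemma k0: "(of_nat k :: 'k) \<noteq> 0"
  using \<omega> by (rule primitive_root_order_nonzero)

lemma n0: "0 < n"
  using \<theta>(1) n by (simp add: cyclic_word_def)

lemma l_less: "l < n" and l_direct: "is_direct (\<theta> ! l)"
  using l n by (auto simp: direct_position_def)

lemma finH: "finite (indices H)"
  by (simp add: power_summands_def)

lemma finG: "finite (indices G)"
  unfolding set[symmetric] by simp

lemma \<rho>0: "\<rho> \<noteq> 0"
  using hol k1 by (metis mult_zero_right power_0_left not_one_le_zero zero_neq_one)

lemma pos_inj: "pos m = pos m' \<Longrightarrow> m < N \<Longrightarrow> m' < N \<Longrightarrow> m = m'"
  using dist len by (metis pos_def distinct_conv_nth length_map nth_map)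

lemma pos_in: "m < N \<Longrightarrow> pos m \<in> indices G"
  unfolding set[symmetric] using len by (auto simp: pos_def)

lemma pos_image: "pos ` {..<N} = indices G"
proof
  show "indices G \<subseteq> pos ` {..<N}"
  proof
    fix s assume "s \<in> indices G"
    then obtain m where "m < N" "map lft diagram ! m = s"
      unfolding set[symmetric] in_set_conv_nth length_map len by blast
    then show "s \<in> pos ` {..<N}" using len by (auto simp: pos_def)
  qed
qed (auto simp: pos_in)

lemma H_in: "i \<in> {1..k} \<Longrightarrow> (i, m mod n) \<in> indices H"
  using n0 n by (simp add: power_summands_def)

lemma x_verts: "x m \<in> verts Q"
proof -
  have p: "nontrivial_nonzero Q I (letter_path (\<theta> ! (m mod n)))"
    using \<theta>(1) n n0 by (simp add: cyclic_word_def)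
  then have "nz (arrows_start Q (letter_path (\<theta> ! (m mod n))), letter_path (\<theta> ! (m mod n)))"
    by (simp add: nontrivial_nonzero_def)
  from nz_start[OF this] nz_end[OF this] p show ?thesis
    by (cases "\<theta> ! (m mod n)") (auto simp: band_vertex_def nontrivial_path_end)
qed

lemma unit_props: "vertex_elem (c :: 'k) (x m) p \<noteq> 0 \<Longrightarrow> nz p \<and> path_end Q p = x m \<and> fst p = x m"
  using x_verts[of m] by (auto simp: vertex_elem_def alg_path_def split: if_splits)

lemma crossings_eq:
  assumes "r \<le> n"
  shows "crossings (q * n + r) = q + (if l < r then 1 else 0)"
proof (induction q)
  case 0
  have "crossings r = (\<Sum>j<r. if j = l then 1 else 0)"
    unfolding crossings_def using assms by (intro sum.cong) auto
  then show ?case by simp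
next
  case (Suc q)
  have shift: "crossings (m + n) = crossings m + 1" for m
  proof (induction m)
    case 0
    have "crossings n = (\<Sum>j<n. if j = l then 1 else 0)"
      unfolding crossings_def by (intro sum.cong) auto
    then show ?case using l_less by (simp add: crossings_def)
  next
    case (Suc m)
    then show ?case by (simp add: crossings_def)
  qed
  show ?case using shift[of "q * n + r"] Suc by (simp add: algebra_simps)
qed

lemma crossings_N: "crossings N = k"
  using crossings_eq[of 0 k] by simp

lemma holonomy_nonzero: "m < N \<Longrightarrow> holonomy (diagram ! m) \<noteq> 0"
  using coef by (simp add: holonomy_def)

lemma \<chi>_nonzero: "m < N \<Longrightarrow> \<chi> m i \<noteq> 0"
  using holonomy_nonzero \<rho>0 \<omega>0 by (simp add: \<chi>_def hol_prod_def)

lemma hol_prodN: "hol_prod N = 1"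
proof -
  have "(\<Prod>j<m. if j mod n = l then \<rho> else 1) = \<rho> ^ crossings m" for m
    by (induction m) (simp_all add: crossings_def)
  then show ?thesis using hol by (simp add: hol_prod_def prod.distrib mult.commute crossings_N)
qed

text \<open>
  At the last position this uses that the coefficients close up: \<open>\<chi> N i = 1\<close>, as a full turn crosses the letter
  \<open>l\<close> exactly \<open>k\<close> times.
\<close>

lemma \<chi>_next:
  assumes "m < N"
  shows "\<chi> (Suc m mod N) i = \<chi> m i * scalar_at l (\<omega> ^ i * \<rho>) (m mod n) * holonomy (diagram ! m)"
proof -
  have step: "\<chi> (Suc m) i = \<chi> m i * scalar_at l (\<omega> ^ i * \<rho>) (m mod n) * holonomy (diagram ! m)"
    by (simp add: \<chi>_def crossings_def hol_prod_def scalar_at_def)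
  have "(\<omega> ^ i) ^ k = 1" by (metis \<omega>k power_mult power_one mult.commute)
  then have "\<chi> N i = 1" by (simp add: \<chi>_def hol_prodN crossings_N)
  moreover have "\<chi> 0 i = 1" by (simp add: \<chi>_def crossings_def hol_prod_def)
  ultimately show ?thesis using step assms by (cases "Suc m = N") auto
qed

lemma between_split: "between G H 0 split_matrix"
  unfolding split_matrix_def
proof (intro between_sum between_entry)
  fix m i assume m: "m \<in> {..<N}" and i: "i \<in> {1..k}"
  show "pos m \<in> indices G" "(i, m mod n) \<in> indices H"
    using m i pos_in H_in by auto
  show "deg H (i, m mod n) = deg G (pos m) + 0"
    using deg m by (simp add: power_summands_def pos_def)
  show "nz p \<and> path_end Q p = vert G (pos m) \<and> fst p = vert H (i, m mod n)"
    if "vertex_elem (\<chi> m i) (x m) p \<noteq> 0" for p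
    using unit_props[OF that] vert m by (simp add: power_summands_def pos_def)
qed

lemma between_join: "between H G 0 join_matrix"
  unfolding join_matrix_def
proof (intro between_sum between_entry)
  fix m i assume m: "m \<in> {..<N}" and i: "i \<in> {1..k}"
  show "pos m \<in> indices G" "(i, m mod n) \<in> indices H"
    using m i pos_in H_in by auto
  show "deg G (pos m) = deg H (i, m mod n) + 0"
    using deg m by (simp add: power_summands_def pos_def)
  show "nz p \<and> path_end Q p = vert H (i, m mod n) \<and> fst p = vert G (pos m)"
    if "vertex_elem (inverse (of_nat k * \<chi> m i)) (x m) p \<noteq> 0" for p
    using unit_props[OF that] vert m by (simp add: power_summands_def pos_def)
qed

text \<open>
  Among the positions over a given position of \<open>\<theta>\<close>, the number of crossings determines the position, and
  the numbers differ by less than \<open>k\<close> (\<open>crossings_close\<close>). So the powers of \<open>\<omega>\<close> in the coefficients \<open>\<chi>\<close> are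
  distinct, which is the orthogonality \<open>split_join_scalars\<close>. For \<open>join_split_scalars\<close> the numbers of
  crossings run through \<open>k\<close> consecutive values.
\<close>

lemma position_eq:
  assumes "m mod n = m' mod n" "crossings m = crossings m'"
  shows "m = m'"
proof -
  have "crossings m = m div n + (if l < m mod n then 1 else 0)" for m
    using crossings_eq[of "m mod n" "m div n"] n0 by simp
  then have "m div n = m' div n" using assms by (metis add_right_cancel)
  then show ?thesis using assms(1) by (metis div_mult_mod_eq)
qed

lemma crossings_close:
  assumes "m < N" "m mod n = m' mod n"
  shows "crossings m < crossings m' + k"
proof -
  have "crossings m = m div n + (if l < m mod n then 1 else 0)" for m
    using crossings_eq[of "m mod n" "m div n"] n0 by simp
  moreover have "m div n < k" using assms(1) by (simp add: less_mult_imp_div_less)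
  ultimately show ?thesis using assms(2) by simp
qed

lemma sum_shift_powers: "z ^ k = 1 \<Longrightarrow> (\<Sum>i\<in>{1..k}. z ^ i) = (\<Sum>i<k. (z :: 'k) ^ i)"
proof -
  assume z: "z ^ k = 1"
  \<comment> \<open>the copies of \<open>\<theta>\<close> are numbered from \<open>1\<close>, so \<open>z\<^sup>k = 1\<close> replaces \<open>z\<^sup>0\<close>\<close>
  have "(\<Sum>i\<in>{1..k}. z ^ i) = (\<Sum>i<k. z ^ Suc i)"
    by (rule sum.reindex_bij_witness[where i = Suc and j = "\<lambda>i. i - 1"]) auto
  moreover have "(\<Sum>i<k. z ^ Suc i) + z ^ 0 = (\<Sum>i<k. z ^ i) + z ^ k"
    by (metis add.commute sum.lessThan_Suc sum.lessThan_Suc_shift)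
  ultimately show ?thesis using z by simp
qed

lemma split_join_scalars:
  assumes m: "m < N" "m' < N" "m mod n = m' mod n"
  shows "(\<Sum>i\<in>{1..k}. \<chi> m i * inverse (of_nat k * \<chi> m' i)) = (if m = m' then 1 else 0)"
proof -
  let ?z = "\<omega> ^ crossings m / \<omega> ^ crossings m'"
  have "(\<omega> ^ c) ^ k = 1" for c by (metis \<omega>k power_mult power_one mult.commute)
  then have zk: "?z ^ k = 1" by (simp add: power_divide)
  have "\<chi> m i * inverse (of_nat k * \<chi> m' i) = hol_prod m / (of_nat k * hol_prod m') * ?z ^ i" for i
    by (simp add: \<chi>_def power_divide field_simps flip: power_mult)
  then have "(\<Sum>i\<in>{1..k}. \<chi> m i * inverse (of_nat k * \<chi> m' i)) =
      hol_prod m / (of_nat k * hol_prod m') * (\<Sum>i<k. ?z ^ i)"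
    by (simp only: sum_shift_powers[OF zk, symmetric] sum_distrib_left)
  also have "(\<Sum>i<k. ?z ^ i) = (if crossings m = crossings m' then of_nat k else 0)"
    using m crossings_close[of m m'] crossings_close[of m' m] by (intro root_orthogonality \<omega>) auto
  also have "hol_prod m / (of_nat k * hol_prod m') * \<dots> = (if m = m' then 1 else 0)"
    using position_eq[OF m(3)] \<chi>_nonzero[OF m(2), of 0] k0 by (auto simp: \<chi>_def)
  finally show ?thesis .
qed

lemma residue_class_sum:
  assumes r: "r < n"
  shows "(\<Sum>m\<in>{m\<in>{..<N}. m mod n = r}. g m) = (\<Sum>q<k. g (q * n + r))"
proof -
  have "q * n + r < N" if "q < k" for q
  proof -
    have "Suc q * n \<le> k * n" using that by (intro mult_le_mono1) simp
    then show ?thesis using r by simp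
  qed
  then show ?thesis
    using r by (intro sum.reindex_bij_witness[where i = "\<lambda>q. q * n + r" and j = "\<lambda>m. m div n"])
      (auto simp: less_mult_imp_div_less)
qed

lemma join_split_scalars:
  assumes i: "i \<in> {1..k}" "i' \<in> {1..k}" and r: "r < n"
  shows "(\<Sum>m\<in>{m\<in>{..<N}. m mod n = r}. inverse (of_nat k * \<chi> m i) * \<chi> m i') = (if i = i' then 1 else 0)"
proof -
  let ?z = "\<omega> ^ i' / \<omega> ^ i" and ?e = "if l < r then 1 else 0 :: nat"
  have "inverse (of_nat k * \<chi> m i) * \<chi> m i' = inverse (of_nat k) * ?z ^ crossings m" if "m < N" for m
    using \<chi>_nonzero[OF that, of 0] by (simp add: \<chi>_def power_divide field_simps)
  then have "(\<Sum>m\<in>{m\<in>{..<N}. m mod n = r}. inverse (of_nat k * \<chi> m i) * \<chi> m i') =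
     (\<Sum>m\<in>{m\<in>{..<N}. m mod n = r}. inverse (of_nat k) * ?z ^ crossings m)"
    by (intro sum.cong) auto
  also have "\<dots> = (\<Sum>q<k. inverse (of_nat k) * ?z ^ (q + ?e))"
    unfolding residue_class_sum[OF r] using r crossings_eq[of r] by simp
  also have "\<dots> = inverse (of_nat k) * ?z ^ ?e * (\<Sum>q<k. ?z ^ q)"
    by (simp add: power_add sum_distrib_left mult_ac)
  also have "(\<Sum>q<k. ?z ^ q) = (if i' = i then of_nat k else 0)"
    using i by (intro root_orthogonality \<omega>) auto
  finally show ?thesis using k0 \<omega>0 by (cases "i = i'") auto
qed

lemma vertex_elem_sum: "vertex_elem (\<Sum>e\<in>E. g e) y = (\<Sum>e\<in>E. vertex_elem (g e) y)"
  by (rule ext) (simp add: vertex_elem_def sum_fun_apply sum_distrib_right)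

lemma vertex_elem_zero [simp]: "vertex_elem 0 y = 0"
  by (simp add: vertex_elem_def fun_eq_iff)

lemma split_join: "mmul (indices H) split_matrix join_matrix = idm G"
proof -
  let ?S = "\<lambda>m i. entry (pos m) (i, m mod n) (vertex_elem (\<chi> m i) (x m))"
  let ?J = "\<lambda>i m. entry (i, m mod n) (pos m) (vertex_elem (inverse (of_nat k * \<chi> m i)) (x m))"
  let ?P = "\<lambda>m m' i. entry (pos m) (pos m') (vertex_elem (\<chi> m i * inverse (of_nat k * \<chi> m' i)) (x m))"
  have "mmul (indices H) split_matrix join_matrix = (\<Sum>m<N. \<Sum>i\<in>{1..k}. \<Sum>m'<N. \<Sum>i'\<in>{1..k}.
      mmul (indices H) (?S m i)
        (?J i' m'))"
    by (simp only: split_matrix_def mmul_sum_left) (simp only: join_matrix_def mmul_sum_right)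
  also have "\<dots> = (\<Sum>m<N. \<Sum>i\<in>{1..k}. \<Sum>m'<N. if m mod n = m' mod n
      then ?P m m' i else 0)"
  proof (intro sum.cong refl)
    fix m i m' assume i: "i \<in> {1..k}"
    have "(\<Sum>i'\<in>{1..k}. mmul (indices H) (?S m i)
        (?J i' m')) =
      (\<Sum>i'\<in>{1..k}. if i = i' then if m mod n = m' mod n then
        ?P m m' i else 0 else 0)"
      using H_in[OF i, of m] by (intro sum.cong) (auto simp: mmul_entry[OF finH] vertex_elem_mult[OF x_verts])
    then show "(\<Sum>i'\<in>{1..k}. mmul (indices H) (?S m i)
        (?J i' m')) =
      (if m mod n = m' mod n then
        ?P m m' i else 0)"
      using i by (simp only: sum.delta' finite_atLeastAtMost if_True)
  qed
  also have "\<dots> = (\<Sum>m<N. \<Sum>m'<N. \<Sum>i\<in>{1..k}. if m mod n = m' mod n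
      then ?P m m' i else 0)"
    by (intro sum.cong refl sum.swap)
  also have "\<dots> = (\<Sum>m<N. \<Sum>m'<N. if m = m' then entry (pos m) (pos m) (vertex_elem 1 (x m)) else 0)"
  proof (intro sum.cong refl)
    fix m m' assume mm: "m \<in> {..<N}" "m' \<in> {..<N}"
    show "(\<Sum>i\<in>{1..k}. if m mod n = m' mod n
      then ?P m m' i else 0) =
      (if m = m' then entry (pos m) (pos m) (vertex_elem 1 (x m)) else 0)"
    proof (cases "m mod n = m' mod n")
      case True
      then have "(\<Sum>i\<in>{1..k}. ?P m m' i) =
          entry (pos m) (pos m') (vertex_elem (if m = m' then 1 else 0) (x m))"
        using split_join_scalars[OF _ _ True] mm by (simp flip: entry_sum vertex_elem_sum)
      then show ?thesis using True by auto
    next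
      case False
      then show ?thesis by auto
    qed
  qed
  also have "\<dots> = (\<Sum>m<N. entry (pos m) (pos m) (vertex_elem 1 (x m)))"
    by (intro sum.cong refl) (simp only: sum.delta' finite_lessThan if_True)
  also have "\<dots> = (\<Sum>m<N. entry (pos m) (pos m) (alg_path (vert G (pos m), [])))"
    using vert by (intro sum.cong refl) (simp add: vertex_elem_def pos_def)
  also have "\<dots> = idm G"
    unfolding idm_eq_sum[OF finG] pos_image[symmetric]
    by (subst sum.reindex) (auto simp: inj_on_def pos_inj)
  finally show ?thesis .
qed

lemma join_split: "mmul (indices G) join_matrix split_matrix = idm H"
proof -
  let ?u = "\<lambda>m i i'. entry (i, m mod n) (i', m mod n)
    (vertex_elem (inverse (of_nat k * \<chi> m i) * \<chi> m i') (x m))"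
  have "mmul (indices G) join_matrix split_matrix = (\<Sum>m<N. \<Sum>i\<in>{1..k}. \<Sum>m'<N. \<Sum>i'\<in>{1..k}.
      mmul (indices G) (entry (i, m mod n) (pos m) (vertex_elem (inverse (of_nat k * \<chi> m i)) (x m)))
        (entry (pos m') (i', m' mod n) (vertex_elem (\<chi> m' i') (x m'))))"
    by (simp only: join_matrix_def mmul_sum_left) (simp only: split_matrix_def mmul_sum_right)
  also have "\<dots> = (\<Sum>m<N. \<Sum>i\<in>{1..k}. \<Sum>m'<N. if m = m' then \<Sum>i'\<in>{1..k}. ?u m i i' else 0)"
  proof (intro sum.cong refl)
    fix m i m' assume m: "m \<in> {..<N}" "m' \<in> {..<N}"
    then have "pos m = pos m' \<longleftrightarrow> m = m'" using pos_inj by auto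
    then show "(\<Sum>i'\<in>{1..k}.
      mmul (indices G) (entry (i, m mod n) (pos m) (vertex_elem (inverse (of_nat k * \<chi> m i)) (x m)))
        (entry (pos m') (i', m' mod n) (vertex_elem (\<chi> m' i') (x m')))) =
      (if m = m' then \<Sum>i'\<in>{1..k}. ?u m i i' else 0)"
      using m pos_in by (auto simp: mmul_entry[OF finG] vertex_elem_mult[OF x_verts] simp del: sum.infinite)
  qed
  also have "\<dots> = (\<Sum>m<N. \<Sum>i\<in>{1..k}. \<Sum>i'\<in>{1..k}. ?u m i i')"
    by (rule sum.cong[OF refl], rule sum.cong[OF refl]) (simp only: sum.delta' finite_lessThan if_True)
  also have "\<dots> = (\<Sum>i\<in>{1..k}. \<Sum>m<N. \<Sum>i'\<in>{1..k}. ?u m i i')"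
    by (rule sum.swap)
  also have "\<dots> = (\<Sum>i\<in>{1..k}. \<Sum>i'\<in>{1..k}. \<Sum>m<N. ?u m i i')"
    by (rule sum.cong[OF refl], rule sum.swap)
  also have "\<dots> = (\<Sum>i\<in>{1..k}. \<Sum>i'\<in>{1..k}. if i = i' then
      \<Sum>r<n. entry (i, r) (i, r) (vertex_elem 1 (band_vertex Q \<theta> r)) else 0)"
  proof (intro sum.cong refl)
    fix i i' assume i: "i \<in> {1..k}" "i' \<in> {1..k}"
    have "(\<Sum>m<N. ?u m i i') = (\<Sum>r<n. \<Sum>m\<in>{m\<in>{..<N}. m mod n = r}. ?u m i i')"
      using n0 by (subst sum.group) auto
    also have "\<dots> = (\<Sum>r<n. entry (i, r) (i', r) (vertex_elem (if i = i' then 1 else 0) (band_vertex Q \<theta> r)))"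
    proof (rule sum.cong[OF refl])
      fix r assume r: "r \<in> {..<n}"
      have "(\<Sum>m\<in>{m\<in>{..<N}. m mod n = r}. ?u m i i') =
        (\<Sum>m\<in>{m\<in>{..<N}. m mod n = r}. entry (i, r) (i', r)
          (vertex_elem (inverse (of_nat k * \<chi> m i) * \<chi> m i') (band_vertex Q \<theta> r)))"
        by (intro sum.cong) auto
      also have "\<dots> = entry (i, r) (i', r) (vertex_elem (if i = i' then 1 else 0) (band_vertex Q \<theta> r))"
        using join_split_scalars[OF i, of r] r by (simp flip: entry_sum vertex_elem_sum)
      finally show "(\<Sum>m\<in>{m\<in>{..<N}. m mod n = r}. ?u m i i') =
        entry (i, r) (i', r) (vertex_elem (if i = i' then 1 else 0) (band_vertex Q \<theta> r))" .
    qed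
    finally show "(\<Sum>m<N. ?u m i i') = (if i = i' then
      \<Sum>r<n. entry (i, r) (i, r) (vertex_elem 1 (band_vertex Q \<theta> r)) else 0)" by auto
  qed
  also have "\<dots> = (\<Sum>i\<in>{1..k}. \<Sum>r<n. entry (i, r) (i, r) (vertex_elem 1 (band_vertex Q \<theta> r)))"
    by (rule sum.cong[OF refl]) (simp only: sum.delta' finite_atLeastAtMost if_True)
  also have "\<dots> = idm H"
    unfolding idm_eq_sum[OF finH]
    by (simp add: power_summands_def band_summands_def n sum.Sigma vertex_elem_def split_def)
  finally show ?thesis .
qed

definition src_pos :: "nat \<Rightarrow> nat" where
  "src_pos m = (if is_direct (\<theta> ! (m mod n)) then m else Suc m mod N)"

definition tgt_pos :: "nat \<Rightarrow> nat" where
  "tgt_pos m = (if is_direct (\<theta> ! (m mod n)) then Suc m mod N else m)"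

lemma tgt_pos_less: "m < N \<Longrightarrow> tgt_pos m < N"
  using k1 n0 by (simp add: tgt_pos_def)

lemma tgt_pos_mod: "tgt_pos m mod n = arrow_target \<theta> (m mod n)"
  by (simp add: tgt_pos_def arrow_target_def Suc_mod_mod flip: n)

abbreviation path_at :: "nat \<Rightarrow> 'a list" where
  "path_at t \<equiv> letter_path (\<theta> ! t)"

lemma edge_matrix_diagram:
  "m < N \<Longrightarrow> edge_matrix (diagram ! m) = entry (pos (src_pos m)) (pos (tgt_pos m)) (path_elem (coef (diagram ! m)) (path_at (m mod n)))"
  using rgt[of m] by (simp add: edge_matrix_def edge_source_def edge_target_def lett src_pos_def tgt_pos_def pos_def)

lemma path_at_ends:
  assumes "t < n"
  shows "nontrivial_nonzero Q I (path_at t)"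
    and "arrows_start Q (path_at t) = band_vertex Q \<theta> (arrow_target \<theta> t)"
    and "arrows_end Q (path_at t) = band_vertex Q \<theta> (arrow_source \<theta> t)"
proof -
  show "nontrivial_nonzero Q I (path_at t)"
    using \<theta>(1) assms n by (simp add: cyclic_word_def)
  show "arrows_start Q (path_at t) = band_vertex Q \<theta> (arrow_target \<theta> t)"
    "arrows_end Q (path_at t) = band_vertex Q \<theta> (arrow_source \<theta> t)"
    using band_vertex_next[OF \<theta>(1), of t] assms n
    by (cases "\<theta> ! t"; simp add: arrow_source_def arrow_target_def band_vertex_def)+
qed

lemma transport_scalars:
  assumes m: "m < N"
  shows "coef (diagram ! m) * \<chi> (tgt_pos m) i = \<chi> (src_pos m) i * scalar_at l (\<omega> ^ i * \<rho>) (m mod n)"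
proof (cases "is_direct (\<theta> ! (m mod n))")
  case True
  then show ?thesis
    using \<chi>_next[OF m, of i] coef[OF m] lett[OF m] by (simp add: src_pos_def tgt_pos_def holonomy_def)
next
  case False
  then have "m mod n \<noteq> l" using l_direct by auto
  then show ?thesis
    using False \<chi>_next[OF m, of i] lett[OF m]
    by (simp add: src_pos_def tgt_pos_def holonomy_def scalar_at_def mult.commute)
qed

text \<open>
  Each letter \<open>t\<close> of \<open>\<theta>\<close> and each position over its source belong to exactly one edge of the diagram lying over
  \<open>t\<close>. For inverse letters the source is the right end, so the positions are shifted by one.
\<close>

lemma sum_over_sources:
  "(\<Sum>m<N. \<Sum>t<n. if m mod n = arrow_source \<theta> t then g m t else 0) = (\<Sum>m<N. g (src_pos m) (m mod n))"
proof -
  have per_letter: "(\<Sum>m<N. if m mod n = arrow_source \<theta> t then g m t else 0) =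
      (\<Sum>m<N. if m mod n = t then g (src_pos m) t else 0)" if t: "t < n" for t
  proof (cases "is_direct (\<theta> ! t)")
    case True
    then show ?thesis by (intro sum.cong) (auto simp: arrow_source_def src_pos_def)
  next
    case False
    have "(\<Sum>m<N. if m mod n = arrow_source \<theta> t then g m t else 0) =
        (\<Sum>m<N. if Suc m mod N mod n = arrow_source \<theta> t then g (Suc m mod N) t else 0)"
      by (rule sum.reindex_bij_betw[OF bij_betw_Suc_mod, symmetric])
    also have "\<dots> = (\<Sum>m<N. if m mod n = t then g (src_pos m) t else 0)"
    proof (intro sum.cong refl)
      fix m
      have "Suc m mod N mod n = arrow_source \<theta> t \<longleftrightarrow> Suc (m mod n) mod n = Suc t mod n"
        using False n by (simp add: arrow_source_def Suc_mod_mod)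
      also have "\<dots> \<longleftrightarrow> m mod n = t"
        using t n0 by (auto simp: mod_Suc split: if_splits)
      finally show "(if Suc m mod N mod n = arrow_source \<theta> t then g (Suc m mod N) t else 0) =
          (if m mod n = t then g (src_pos m) t else 0)"
        using False by (auto simp: src_pos_def)
    qed
    finally show ?thesis .
  qed
  have "(\<Sum>m<N. \<Sum>t<n. if m mod n = arrow_source \<theta> t then g m t else 0) =
      (\<Sum>t<n. \<Sum>m<N. if m mod n = t then g (src_pos m) t else 0)"
    by (subst sum.swap, rule sum.cong[OF refl], rule per_letter) simp
  also have "\<dots> = (\<Sum>m<N. \<Sum>t<n. if m mod n = t then g (src_pos m) t else 0)"
    by (rule sum.swap)
  also have "\<dots> = (\<Sum>m<N. g (src_pos m) (m mod n))"
    using n0 by (intro sum.cong refl) (simp only: sum.delta' finite_lessThan lessThan_iff mod_less_divisor if_True)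
  finally show ?thesis .
qed

text \<open>
  Both sides are the sum over all edges of the diagram and all \<open>i\<close> of the same letter from the
  source of the edge to the \<open>i\<close>-th copy of \<open>\<theta>\<close>; the scalars agree by \<open>transport_scalars\<close>.
\<close>

lemma split_chain:
  "mmul (indices G) (\<Sum>m<N. edge_matrix (diagram ! m)) split_matrix = mmul (indices H) split_matrix power_matrix"
proof -
  let ?S = "\<lambda>m i. entry (pos m) (i, m mod n) (vertex_elem (\<chi> m i) (x m))"
  let ?L = "\<lambda>i t. letter_entry i \<theta> (scalar_at l (\<omega> ^ i * \<rho>) t) t"
  let ?T = "\<lambda>m i t. entry (pos m) (i, arrow_target \<theta> t)
    (path_elem (\<chi> m i * scalar_at l (\<omega> ^ i * \<rho>) t) (path_at t))"
  let ?w = "\<lambda>i m. entry (pos (src_pos m)) (i, arrow_target \<theta> (m mod n))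
    (path_elem (\<chi> (src_pos m) i * scalar_at l (\<omega> ^ i * \<rho>) (m mod n)) (path_at (m mod n)))"
  have "mmul (indices G) (\<Sum>m<N. edge_matrix (diagram ! m)) split_matrix = (\<Sum>m<N. \<Sum>m'<N. \<Sum>i\<in>{1..k}.
      mmul (indices G) (edge_matrix (diagram ! m)) (?S m' i))"
    by (simp only: mmul_sum_left) (simp only: split_matrix_def mmul_sum_right)
  also have "\<dots> = (\<Sum>m<N. \<Sum>m'<N. if tgt_pos m = m' then \<Sum>i\<in>{1..k}. ?w i m else 0)"
  proof (intro sum.cong refl)
    fix m m' assume m: "m \<in> {..<N}" "m' \<in> {..<N}"
    then have "pos (tgt_pos m) = pos m' \<longleftrightarrow> tgt_pos m = m'" using pos_inj tgt_pos_less by auto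
    moreover have "path_elem (coef (diagram ! m)) (path_at (m mod n)) \<odot> vertex_elem (\<chi> (tgt_pos m) i) (x (tgt_pos m)) =
        path_elem (\<chi> (src_pos m) i * scalar_at l (\<omega> ^ i * \<rho>) (m mod n)) (path_at (m mod n))" for i
      using m n0 path_at_ends[of "m mod n"] path_vertex_elem_mult(1)[OF path_at_ends(1), of "m mod n" "coef (diagram ! m)" "\<chi> (tgt_pos m) i"]
        transport_scalars[of m i] by (simp add: tgt_pos_mod)
    ultimately show "(\<Sum>i\<in>{1..k}.
      mmul (indices G) (edge_matrix (diagram ! m)) (?S m' i)) =
      (if tgt_pos m = m' then \<Sum>i\<in>{1..k}. ?w i m else 0)"
      using m pos_in tgt_pos_less by (auto simp: edge_matrix_diagram mmul_entry[OF finG] tgt_pos_mod simp del: sum.infinite)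
  qed
  also have "\<dots> = (\<Sum>m<N. \<Sum>i\<in>{1..k}. ?w i m)"
    using tgt_pos_less by (intro sum.cong[OF refl, of "{..<N}"]) (simp only: sum.delta' finite_lessThan lessThan_iff if_True)
  also have "\<dots> = (\<Sum>i\<in>{1..k}. \<Sum>m<N. ?w i m)"
    by (rule sum.swap)
  also have "\<dots> = (\<Sum>i\<in>{1..k}. \<Sum>m<N. \<Sum>t<n. if m mod n = arrow_source \<theta> t then
      ?T m i t else 0)"
    by (simp only: sum_over_sources)
  also have "\<dots> = (\<Sum>m<N. \<Sum>i\<in>{1..k}. \<Sum>t<n. if m mod n = arrow_source \<theta> t then
      ?T m i t else 0)"
    by (rule sum.swap)
  also have "\<dots> = (\<Sum>m<N. \<Sum>i\<in>{1..k}. \<Sum>i'\<in>{1..k}. \<Sum>t<n. mmul (indices H)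
      (?S m i)
      (?L i' t))"
  proof (rule sum.cong[OF refl], rule sum.cong[OF refl])
    fix m i assume i: "i \<in> {1..k}"
    have "(\<Sum>i'\<in>{1..k}. \<Sum>t<n. mmul (indices H)
      (?S m i)
      (?L i' t)) =
      (\<Sum>i'\<in>{1..k}. if i = i' then \<Sum>t<n. if m mod n = arrow_source \<theta> t then
      ?T m i t else 0 else 0)"
    proof (intro sum.cong refl)
      fix i'
      have "vertex_elem (\<chi> m i) (x m) \<odot> path_elem c (path_at t) = path_elem (\<chi> m i * c) (path_at t)"
        if "t < n" "m mod n = arrow_source \<theta> t" for t c
        using that path_at_ends[of t] path_vertex_elem_mult(2)[OF path_at_ends(1), of t "\<chi> m i" c] by simp
      then show "(\<Sum>t<n. mmul (indices H)
        (?S m i)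
        (?L i' t)) =
        (if i = i' then \<Sum>t<n. if m mod n = arrow_source \<theta> t then
        ?T m i t else 0 else 0)"
        using H_in[OF i, of m] unfolding letter_entry_def
        by (cases "i = i'") (auto simp: mmul_entry[OF finH] intro!: sum.cong)
    qed
    then show "(\<Sum>t<n. if m mod n = arrow_source \<theta> t then
      ?T m i t else 0) =
      (\<Sum>i'\<in>{1..k}. \<Sum>t<n. mmul (indices H)
      (?S m i)
      (?L i' t))"
      using i by (simp only: sum.delta' finite_atLeastAtMost if_True)
  qed
  also have "\<dots> = mmul (indices H) split_matrix power_matrix"
    by (simp only: split_matrix_def mmul_sum_left)
      (simp only: power_matrix_def bands_matrix_def mmul_sum_right n)
  finally show ?thesis .
qed

end

section \<open>The mapping cone of a single map\<close>

lemma telescoping_sum: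
  "(d0 - fa + bf + f) + (bfa + fa) = d0 + f + bfa + (bf :: 'g::ab_group_add)"
  by (simp add: algebra_simps)

text \<open>
  The letters at the vertices \<open>x\<close> and \<open>y\<close> are already factored: \<open>\<sigma>\<^sub>R = f p\<close>, and \<open>\<tau>\<^sub>R\<close> is the inverse
  of \<open>q f\<close>. The vertices \<open>x'\<close> and \<open>y'\<close> below are the right neighbours of \<open>x\<close> and \<open>y\<close>.
\<close>

locale single_map_cone = gentle_algebra Q I for Q :: "('v, 'a) pre_digraph" and I +
  fixes \<sigma> \<tau> \<alpha> \<beta> \<gamma> \<delta> :: "'a letter list" and \<sigma>L \<tau>L :: "'a letter" and f p q :: "'a list"
    and d\<sigma> d\<tau> :: int and l\<sigma> l\<tau> :: nat and lam mu :: "'k::field"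
  assumes \<sigma>: "cyclic_word \<sigma>" "balance \<sigma> = 0" and \<tau>: "cyclic_word \<tau>" "balance \<tau> = 0"
    and l\<sigma>: "direct_position \<sigma> l\<sigma>" and l\<tau>: "direct_position \<tau> l\<tau>"
    and lam: "lam \<noteq> 0" and mu: "mu \<noteq> 0"
    and \<sigma>_eq: "\<sigma> = \<beta> @ [\<sigma>L, Direct (f @ p)] @ \<alpha>"
    and \<tau>_eq: "\<tau> = \<delta> @ [\<tau>L, Inverse (q @ f)] @ \<gamma>"
    and ne: "f \<noteq> []" "p \<noteq> []" "q \<noteq> []"
    and degrees: "vertex_degree \<sigma> d\<sigma> (Suc (length \<beta>)) = vertex_degree \<tau> d\<tau> (Suc (length \<delta>))"
begin

abbreviation x :: nat where "x \<equiv> Suc (length \<beta>)"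
abbreviation y :: nat where "y \<equiv> Suc (length \<delta>)"
abbreviation x' :: nat where "x' \<equiv> Suc x mod length \<sigma>"
abbreviation y' :: nat where "y' \<equiv> Suc y mod length \<tau>"
definition G :: "'v summands" where "G = cone_summands \<sigma> d\<sigma> \<tau> d\<tau>"

definition s :: 'k where "s = scalar_at l\<sigma> lam x"

definition F :: "('v, 'a, 'k) matrix" where "F = entry (0, x) (1, y) (path_elem 1 f)"
text \<open>
  \<open>A\<close> and \<open>B\<close> are the two base changes: \<open>p\<close> from \<open>y\<close> to \<open>x'\<close>, and \<open>q\<close> from \<open>y'\<close> to \<open>x\<close>. The scalar \<open>s\<close> of
  the letter \<open>f p\<close> is put on \<open>p\<close>; the letter \<open>q f\<close> is inverse and carries the scalar \<open>1\<close>.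
\<close>

definition A :: "('v, 'a, 'k) matrix" where "A = entry (1, y) (0, x') (path_elem s p)"
definition B :: "('v, 'a, 'k) matrix" where "B = entry (1, y') (0, x) (path_elem 1 q)"

text \<open>The letters that are not affected by the base change.\<close>

definition D0 :: "('v, 'a, 'k) matrix" where
  "D0 = (\<Sum>t\<in>{..<length \<sigma>} - {x}. letter_entry 0 \<sigma> (- scalar_at l\<sigma> lam t) t) +
    (\<Sum>t\<in>{..<length \<tau>} - {y}. letter_entry 1 \<tau> (scalar_at l\<tau> mu t) t)"

definition cone_matrix :: "('v, 'a, 'k) matrix" where
  "cone_matrix = (\<Sum>t<length \<sigma>. letter_entry 0 \<sigma> (- scalar_at l\<sigma> lam t) t) +
     (\<Sum>t<length \<tau>. letter_entry 1 \<tau> (scalar_at l\<tau> mu t) t) + entry (0, x) (1, y) (path_elem 1 f)"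

definition word_matrix :: "('v, 'a, 'k) matrix" where
  "word_matrix = D0 + F + entry (1, y') (0, x') (path_elem s (q @ f @ p))"

abbreviation mm :: "('v, 'a, 'k) matrix \<Rightarrow> ('v, 'a, 'k) matrix \<Rightarrow> ('v, 'a, 'k) matrix"
    (infixl "\<star>" 70) where
  "X \<star> Y \<equiv> mmul (indices G) X Y"

lemma lengths: "x < length \<sigma>" "y < length \<tau>" "2 \<le> length \<sigma>" "2 \<le> length \<tau>"
  by (simp_all add: \<sigma>_eq \<tau>_eq)

lemma letters: "\<sigma> ! x = Direct (f @ p)" "\<tau> ! y = Inverse (q @ f)"
  "\<sigma> ! length \<beta> = \<sigma>L" "\<tau> ! length \<delta> = \<tau>L"
  by (simp_all add: \<sigma>_eq \<tau>_eq nth_append)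

lemma next_less: "x' < length \<sigma>" "y' < length \<tau>" and next_ne: "x' \<noteq> x" "y' \<noteq> y"
  using lengths by (auto simp: mod_Suc)

lemma nonzero_paths: "nontrivial_nonzero Q I (f @ p)" "nontrivial_nonzero Q I (q @ f)"
  using \<sigma>(1) \<tau>(1) by (auto simp: cyclic_word_def \<sigma>_eq \<tau>_eq)

lemma nonzero_factors:
  "nontrivial_nonzero Q I f" "nontrivial_nonzero Q I p" "nontrivial_nonzero Q I q"
  "nontrivial_nonzero Q I (q @ f @ p)"
  "path_end Q (arrows_start Q p, p) = arrows_start Q f"
  "path_end Q (arrows_start Q f, f) = arrows_start Q q"
proof -
  have fp: "nz (arrows_start Q p, f @ p)" and qf: "nz (arrows_start Q f, q @ f)"
    using nonzero_paths ne by (simp_all add: nontrivial_nonzero_def arrows_start_def)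
  show 1: "path_end Q (arrows_start Q p, p) = arrows_start Q f"
    and 2: "path_end Q (arrows_start Q f, f) = arrows_start Q q"
    using fp qf nz_start_eq ne unfolding nz_append arrows_start_def by blast+
  show "nontrivial_nonzero Q I f" "nontrivial_nonzero Q I p" "nontrivial_nonzero Q I q"
    using fp qf ne 1 2 unfolding nz_append by (auto simp: nontrivial_nonzero_def)
  have "nz (arrows_start Q p, q @ f @ p)"
    using fp qf ne 1 2 unfolding nz_append path_end_append by auto
  then show "nontrivial_nonzero Q I (q @ f @ p)"
    using ne by (simp add: nontrivial_nonzero_def arrows_start_def)
qed

lemma middle_relations: "(last f, hd p) \<notin> I" "(last q, hd f) \<notin> I"
  using nonzero_paths ne by (auto simp: nontrivial_nonzero_def nz_append)

lemma \<tau>_scalar: "scalar_at l\<tau> mu y = 1"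
  using l\<tau> letters by (auto simp: scalar_at_def direct_position_def)

lemma finG: "finite (indices G)"
  by (simp add: G_def)

lemma shift_degree: "vertex_degree \<sigma> (d\<sigma> - 1) t = vertex_degree \<sigma> d\<sigma> t - 1"
  using vertex_degree_shift[of \<sigma> d\<sigma> "- 1" t] by simp

lemma G_simps [simp]:
  "(0, t) \<in> indices G \<longleftrightarrow> t < length \<sigma>" "(Suc 0, t) \<in> indices G \<longleftrightarrow> t < length \<tau>"
  "vert G (0, t) = band_vertex Q \<sigma> t" "vert G (Suc 0, t) = band_vertex Q \<tau> t"
  "deg G (0, t) = vertex_degree \<sigma> d\<sigma> t - 1" "deg G (Suc 0, t) = vertex_degree \<tau> d\<tau> t"
  by (auto simp: G_def shift_degree)

text \<open>
  The two letters that disappear and the one that replaces them all factor through \<open>f\<close>.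
\<close>

lemma removed_entries:
  "letter_entry 0 \<sigma> (- scalar_at l\<sigma> lam x) x = - (F \<star> A)"
  "letter_entry 1 \<tau> (scalar_at l\<tau> mu y) y = B \<star> F"
  "entry (1, y') (0, x') (path_elem s (q @ f @ p)) = B \<star> (F \<star> A)"
proof -
  have FA: "F \<star> A = entry (0, x) (0, x') (path_elem s (f @ p))"
    using lengths path_elem_mult[OF nonzero_paths(1) ne(1,2), of 1 s]
    by (simp add: F_def A_def mmul_entry[OF finG])
  have "letter_entry 0 \<sigma> (- scalar_at l\<sigma> lam x) x = entry (0, x) (0, x') (- path_elem s (f @ p))"
    by (simp add: letter_entry_def arrow_source_def arrow_target_def letters path_elem_uminus s_def del: mod_less)
  also have "\<dots> = - entry (0, x) (0, x') (path_elem s (f @ p))"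
    by (auto simp: entry_def fun_eq_iff)
  finally show "letter_entry 0 \<sigma> (- scalar_at l\<sigma> lam x) x = - (F \<star> A)"
    by (simp add: FA)
  show "letter_entry 1 \<tau> (scalar_at l\<tau> mu y) y = B \<star> F"
    using lengths path_elem_mult[OF nonzero_paths(2) ne(3,1), of "1 :: 'k" 1] \<tau>_scalar
    by (simp add: F_def B_def mmul_entry[OF finG] letter_entry_def arrow_source_def arrow_target_def letters)
  show "entry (1, y') (0, x') (path_elem s (q @ f @ p)) = B \<star> (F \<star> A)"
    using lengths path_elem_mult[OF nonzero_factors(4) ne(3), of 1 s] ne
    by (simp add: FA B_def mmul_entry[OF finG])
qed

lemma cone_matrix_eq: "cone_matrix = D0 - F \<star> A + B \<star> F + F"
proof -
  have "(\<Sum>t<length \<sigma>. letter_entry 0 \<sigma> (- scalar_at l\<sigma> lam t) t :: ('v, 'a, 'k) matrix) =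
      - (F \<star> A) + (\<Sum>t\<in>{..<length \<sigma>} - {x}. letter_entry 0 \<sigma> (- scalar_at l\<sigma> lam t) t)"
    unfolding removed_entries(1)[symmetric] using lengths by (intro sum.remove) auto
  moreover have "(\<Sum>t<length \<tau>. letter_entry 1 \<tau> (scalar_at l\<tau> mu t) t :: ('v, 'a, 'k) matrix) =
      B \<star> F + (\<Sum>t\<in>{..<length \<tau>} - {y}. letter_entry 1 \<tau> (scalar_at l\<tau> mu t) t)"
    unfolding removed_entries(2)[symmetric] using lengths by (intro sum.remove) auto
  ultimately show ?thesis
    unfolding cone_matrix_def D0_def F_def[symmetric] by (simp only: diff_conv_add_uminus add_ac)
qed

lemma adjacent_\<sigma>: "t < length \<sigma> \<Longrightarrow> adjacent (\<sigma> ! t) (\<sigma> ! (Suc t mod length \<sigma>))"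
  and adjacent_\<tau>: "t < length \<tau> \<Longrightarrow> adjacent (\<tau> ! t) (\<tau> ! (Suc t mod length \<tau>))"
  using \<sigma>(1) \<tau>(1) by (simp_all add: cyclic_word_def)

lemma neighbours:
  "adjacent \<sigma>L (Direct (f @ p))" "adjacent \<tau>L (Inverse (q @ f))"
  "adjacent (Direct (f @ p)) (\<sigma> ! x')" "adjacent (Inverse (q @ f)) (\<tau> ! y')"
  using adjacent_\<sigma>[of "length \<beta>"] adjacent_\<sigma>[of x] adjacent_\<tau>[of "length \<delta>"] adjacent_\<tau>[of y]
    lengths letters by simp_all

lemmas junctions = neighbours[unfolded adjacent_def, THEN conjunct2]

lemma D0_mult_zero_right:
  assumes "\<And>t. t < length \<sigma> \<Longrightarrow> t \<noteq> x \<Longrightarrow> z = (0, arrow_target \<sigma> t) \<Longrightarrow> path_elem (- scalar_at l\<sigma> lam t) (letter_path (\<sigma> ! t)) \<odot> u = 0"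
    and "\<And>t. t < length \<tau> \<Longrightarrow> t \<noteq> y \<Longrightarrow> z = (1, arrow_target \<tau> t) \<Longrightarrow> path_elem (scalar_at l\<tau> mu t) (letter_path (\<tau> ! t)) \<odot> u = 0"
  shows "D0 \<star> entry z z' u = 0"
proof -
  have "letter_entry 0 \<sigma> (- scalar_at l\<sigma> lam t) t \<star> entry z z' u = 0" if "t \<in> {..<length \<sigma>} - {x}" for t
    using assms(1)[of t] that by (auto simp: letter_entry_def mmul_entry[OF finG])
  moreover have "letter_entry 1 \<tau> (scalar_at l\<tau> mu t) t \<star> entry z z' u = 0" if "t \<in> {..<length \<tau>} - {y}" for t
    using assms(2)[of t] that by (auto simp: letter_entry_def mmul_entry[OF finG])
  ultimately show ?thesis
    unfolding D0_def mmul_add_left mmul_sum_left by simp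
qed

lemma D0_mult_zero_left:
  assumes "\<And>t. t < length \<sigma> \<Longrightarrow> t \<noteq> x \<Longrightarrow> z' = (0, arrow_source \<sigma> t) \<Longrightarrow> u \<odot> path_elem (- scalar_at l\<sigma> lam t) (letter_path (\<sigma> ! t)) = 0"
    and "\<And>t. t < length \<tau> \<Longrightarrow> t \<noteq> y \<Longrightarrow> z' = (1, arrow_source \<tau> t) \<Longrightarrow> u \<odot> path_elem (scalar_at l\<tau> mu t) (letter_path (\<tau> ! t)) = 0"
  shows "entry z z' u \<star> D0 = 0"
proof -
  have "entry z z' u \<star> letter_entry 0 \<sigma> (- scalar_at l\<sigma> lam t) t = 0" if "t \<in> {..<length \<sigma>} - {x}" for t
    using assms(1)[of t] that by (auto simp: letter_entry_def mmul_entry[OF finG])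
  moreover have "entry z z' u \<star> letter_entry 1 \<tau> (scalar_at l\<tau> mu t) t = 0" if "t \<in> {..<length \<tau>} - {y}" for t
    using assms(2)[of t] that by (auto simp: letter_entry_def mmul_entry[OF finG])
  ultimately show ?thesis
    unfolding D0_def mmul_add_right mmul_sum_right by simp
qed

lemma Suc_mod_inj: "Suc t mod n = Suc t' mod n \<Longrightarrow> t < n \<Longrightarrow> t' < n \<Longrightarrow> t = t'"
  by (auto simp: mod_Suc split: if_splits)

lemma letter_path_nonempty:
  "t < length \<sigma> \<Longrightarrow> letter_path (\<sigma> ! t) \<noteq> []" "t < length \<tau> \<Longrightarrow> letter_path (\<tau> ! t) \<noteq> []"
  using \<sigma>(1) \<tau>(1) by (auto simp: cyclic_word_def nontrivial_nonzero_def)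

lemma letter_in_arcs:
  assumes "nontrivial_nonzero Q I r"
  shows "last r \<in> arcs Q" "hd r \<in> arcs Q"
proof -
  have "nz (z, r) \<Longrightarrow> set r \<subseteq> arcs Q" for z
    by (induction r) (auto simp: nz_Cons)
  then have "set r \<subseteq> arcs Q" "r \<noteq> []" using assms by (auto simp: nontrivial_nonzero_def)
  then show "last r \<in> arcs Q" "hd r \<in> arcs Q" by auto
qed

text \<open>An arrow has at most one continuation which is not a relation; \<open>relation_before\<close> is the same at its start.\<close>

lemma relation_after:
  assumes "b \<in> arcs Q" "c \<in> arcs Q" "c' \<in> arcs Q" "tail Q c = head Q b" "tail Q c' = head Q b"
    "c \<noteq> c'" "(c, b) \<notin> I"
  shows "(c', b) \<in> I"
proof (rule ccontr)
  assume "(c', b) \<notin> I"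
  then have "{c, c'} \<subseteq> {c \<in> arcs Q. head Q b = tail Q c \<and> (c, b) \<notin> I}" using assms by auto
  then have "card {c, c'} \<le> card {c \<in> arcs Q. head Q b = tail Q c \<and> (c, b) \<notin> I}"
    by (rule card_mono[rotated]) simp
  also have "\<dots> \<le> 1" using assms(1) by (rule after_nonrel)
  finally have "card {c, c'} \<le> 1" .
  then show False using assms(6) by simp
qed

lemma relation_before:
  assumes "b \<in> arcs Q" "c \<in> arcs Q" "c' \<in> arcs Q" "head Q c = tail Q b" "head Q c' = tail Q b"
    "c \<noteq> c'" "(b, c) \<notin> I"
  shows "(b, c') \<in> I"
proof (rule ccontr)
  assume "(b, c') \<notin> I"
  then have "{c, c'} \<subseteq> {c \<in> arcs Q. head Q c = tail Q b \<and> (b, c) \<notin> I}" using assms by auto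
  then have "card {c, c'} \<le> card {c \<in> arcs Q. head Q c = tail Q b \<and> (b, c) \<notin> I}"
    by (rule card_mono[rotated]) simp
  also have "\<dots> \<le> 1" using assms(1) by (rule before_nonrel)
  finally have "card {c, c'} \<le> 1" .
  then show False using assms(6) by simp
qed

text \<open>
  Apart from \<open>\<tau>\<^sub>R\<close>, only \<open>\<tau>\<^sub>L\<close> can end in \<open>y\<close>. If it does, its path \<open>r\<close> and \<open>f\<close> start with different
  arrows, and \<open>f p\<close> being nonzero, gentleness makes \<open>r p\<close> zero.
\<close>

lemma D0_A: "D0 \<star> A = 0"
  unfolding A_def
proof (rule D0_mult_zero_right)
  fix t assume t: "t < length \<tau>" "t \<noteq> y" "(1, y) = (1 :: nat, arrow_target \<tau> t)"
  show "path_elem (scalar_at l\<tau> mu t) (letter_path (\<tau> ! t)) \<odot> path_elem s p = 0"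
  proof (cases "\<tau> ! t")
    case (Inverse r)
    then show ?thesis using t by (simp add: arrow_target_def)
  next
    case (Direct r)
    then have "Suc (length \<delta>) mod length \<tau> = Suc t mod length \<tau>"
      using t lengths by (simp add: arrow_target_def)
    from Suc_mod_inj[OF this] have "length \<delta> = t" using t(1) lengths by simp
    then have \<tau>L: "\<tau>L = Direct r" using Direct letters by simp
    have r: "nontrivial_nonzero Q I r" using \<tau>(1) \<tau>L by (auto simp: cyclic_word_def \<tau>_eq)
    have start: "letter_start Q \<tau>L = letter_end Q (Inverse (q @ f))"
      using neighbours(2) by (simp add: adjacent_def)
    have "last f \<noteq> last r" using junctions(2) ne by (auto simp: \<tau>L)
    moreover have "tail Q (last r) = tail Q (last f)"
      using start ne by (simp add: \<tau>L arrows_start_def)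
    moreover have "head Q (hd p) = tail Q (last f)"
      using nonzero_factors(5) ne by (simp add: path_end_def arrows_start_def)
    ultimately have "(last r, hd p) \<in> I"
      using middle_relations(1) letter_in_arcs[OF r] letter_in_arcs[OF nonzero_factors(1)]
        letter_in_arcs[OF nonzero_factors(2)]
      by (intro relation_after[of "hd p" "last f" "last r"]) auto
    then show ?thesis
      using ne r by (simp add: Direct path_elem_mult_rel nontrivial_nonzero_def)
  qed
qed simp

text \<open>
  Apart from \<open>\<sigma>\<^sub>R\<close>, only \<open>\<sigma>\<^sub>L\<close> can start in \<open>x\<close>. If it does, its path \<open>r\<close> and \<open>f\<close> end with different
  arrows, and \<open>q f\<close> being nonzero, gentleness makes \<open>q r\<close> zero.
\<close>

lemma B_D0: "B \<star> D0 = 0"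
  unfolding B_def
proof (rule D0_mult_zero_left)
  fix t assume t: "t < length \<sigma>" "t \<noteq> x" "(0, x) = (0 :: nat, arrow_source \<sigma> t)"
  show "path_elem 1 q \<odot> path_elem (- scalar_at l\<sigma> lam t) (letter_path (\<sigma> ! t)) = 0"
  proof (cases "\<sigma> ! t")
    case (Direct r)
    then show ?thesis using t by (simp add: arrow_source_def)
  next
    case (Inverse r)
    then have "Suc (length \<beta>) mod length \<sigma> = Suc t mod length \<sigma>"
      using t lengths by (simp add: arrow_source_def)
    from Suc_mod_inj[OF this] have "length \<beta> = t" using t(1) lengths by simp
    then have \<sigma>L: "\<sigma>L = Inverse r" using Inverse letters by simp
    have r: "nontrivial_nonzero Q I r" using \<sigma>(1) \<sigma>L by (auto simp: cyclic_word_def \<sigma>_eq)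
    have start: "letter_start Q \<sigma>L = letter_end Q (Direct (f @ p))"
      using neighbours(1) by (simp add: adjacent_def)
    have "hd f \<noteq> hd r" using junctions(1) ne by (auto simp: \<sigma>L)
    moreover have "head Q (hd r) = head Q (hd f)"
      using start ne by (simp add: \<sigma>L arrows_end_def)
    moreover have "head Q (hd f) = tail Q (last q)"
      using nonzero_factors(6) ne by (simp add: path_end_def arrows_start_def)
    ultimately have "(last q, hd r) \<in> I"
      using middle_relations(2) letter_in_arcs[OF r] letter_in_arcs[OF nonzero_factors(1)]
        letter_in_arcs[OF nonzero_factors(3)]
      by (intro relation_before[of "last q" "hd f" "hd r"]) auto
    then show ?thesis
      using ne r by (simp add: Inverse path_elem_mult_rel nontrivial_nonzero_def)
  qed
qed simp

text \<open>
  A further letter starting in \<open>x'\<close> is the right neighbour of \<open>\<sigma>\<^sub>R\<close> and direct, so the junction is a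
  relation between it and the first arrow of \<open>p\<close>. The lemma \<open>D0_B\<close> is the same at \<open>y'\<close>.
\<close>

lemma A_D0: "A \<star> D0 = 0"
  unfolding A_def
proof (rule D0_mult_zero_left)
  fix t assume t: "t < length \<sigma>" "t \<noteq> x" "(0, x') = (0 :: nat, arrow_source \<sigma> t)"
  show "path_elem s p \<odot> path_elem (- scalar_at l\<sigma> lam t) (letter_path (\<sigma> ! t)) = 0"
  proof (cases "\<sigma> ! t")
    case (Direct r)
    then have "t = x'" using t by (simp add: arrow_source_def)
    then show ?thesis
      using junctions(3) ne letter_path_nonempty(1)[OF t(1)] Direct by (simp add: path_elem_mult_rel)
  next
    case (Inverse r)
    then have "Suc x mod length \<sigma> = Suc t mod length \<sigma>" using t by (simp add: arrow_source_def)
    from Suc_mod_inj[OF this] have "x = t" using t(1) lengths by simp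
    then show ?thesis using t by simp
  qed
qed simp

lemma D0_B: "D0 \<star> B = 0"
  unfolding B_def
proof (rule D0_mult_zero_right)
  fix t assume t: "t < length \<tau>" "t \<noteq> y" "(1, y') = (1 :: nat, arrow_target \<tau> t)"
  show "path_elem (scalar_at l\<tau> mu t) (letter_path (\<tau> ! t)) \<odot> path_elem 1 q = 0"
  proof (cases "\<tau> ! t")
    case (Inverse r)
    then have "t = y'" using t by (simp add: arrow_target_def)
    then show ?thesis
      using junctions(4) ne letter_path_nonempty(2)[OF t(1)] Inverse by (simp add: path_elem_mult_rel)
  next
    case (Direct r)
    then have "Suc y mod length \<tau> = Suc t mod length \<tau>" using t by (simp add: arrow_target_def)
    from Suc_mod_inj[OF this] have "y = t" using t(1) lengths by simp
    then show ?thesis using t by simp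
  qed
qed simp

lemma zero_products:
  "A \<star> A = 0" "A \<star> B = 0" "B \<star> A = 0" "B \<star> B = 0" "A \<star> F = 0" "F \<star> B = 0"
  using next_ne by (auto simp: A_def B_def F_def mmul_entry[OF finG])

definition U :: "('v, 'a, 'k) matrix" where "U = idm G + (A + B)"
definition U' :: "('v, 'a, 'k) matrix" where "U' = idm G - (A + B)"

lemma \<sigma>_next_vertex: "arrows_start Q p = band_vertex Q \<sigma> x'" "vertex_degree \<sigma> d\<sigma> x' = vertex_degree \<sigma> d\<sigma> x + 1"
  using band_vertex_next[OF \<sigma>(1) lengths(1)] vertex_degree_next[OF \<sigma>(2) lengths(1)] letters ne
  by (simp_all add: arrows_start_def)

lemma \<tau>_next_vertex: "arrows_end Q q = band_vertex Q \<tau> y'" "vertex_degree \<tau> d\<tau> y' = vertex_degree \<tau> d\<tau> y - 1"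
  using band_vertex_next[OF \<tau>(1) lengths(2)] vertex_degree_next[OF \<tau>(2) lengths(2)] letters ne
  by (simp_all add: arrows_end_def)

lemma f_vertices: "arrows_end Q f = band_vertex Q \<sigma> x" "arrows_start Q f = band_vertex Q \<tau> y"
  using letters ne by (simp_all add: band_vertex_def arrows_end_def arrows_start_def)

lemma between_A: "between G G 0 A" and between_B: "between G G 0 B"
proof -
  show "between G G 0 A"
    unfolding A_def using lengths next_less nonzero_factors \<sigma>_next_vertex f_vertices degrees shift_degree ne
    by (intro between_path_elem) (simp_all add: nontrivial_path_end)
  show "between G G 0 B"
    unfolding B_def using lengths next_less nonzero_factors \<tau>_next_vertex f_vertices degrees shift_degree ne
    by (intro between_path_elem) (simp_all add: nontrivial_path_end)
qed

lemma between_F: "between G G 1 F"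
  unfolding F_def using lengths nonzero_factors f_vertices degrees by (intro between_path_elem) simp_all

lemma between_D0: "between G G 1 D0"
proof -
  have "between G G 1 (letter_entry 0 \<sigma> (- scalar_at l\<sigma> lam t) t)" if "t < length \<sigma>" for t
    using between_letter_entry[of "\<lambda>a. if a = 0 then \<sigma> else \<tau>" 0 "{0, 1}" t] \<sigma> that
    by (simp add: G_def)
  moreover have "between G G 1 (letter_entry 1 \<tau> (scalar_at l\<tau> mu t) t)" if "t < length \<tau>" for t
    using between_letter_entry[of "\<lambda>a. if a = 0 then \<sigma> else \<tau>" 1 "{0, 1}" t] \<tau> that
    by (simp add: G_def)
  ultimately show ?thesis
    unfolding D0_def by (intro between_add between_sum) auto
qed

lemma word_matrix_eq: "word_matrix = D0 + F + B \<star> (F \<star> A)"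
  by (simp only: word_matrix_def removed_entries)

lemma between_BFA: "between G G 1 (B \<star> (F \<star> A))"
  using between_mmul[OF between_B between_mmul[OF between_F between_A]] by simp

lemma between_cone_matrix: "between G G 1 cone_matrix"
proof -
  have "between G G 1 (F \<star> A)" "between G G 1 (B \<star> F)"
    using between_mmul[OF between_F between_A] between_mmul[OF between_B between_F] by simp_all
  then show ?thesis
    unfolding cone_matrix_eq diff_conv_add_uminus
    by (intro between_add between_uminus between_D0 between_F)
qed

text \<open>
  As \<open>D0\<close> is annihilated by \<open>A\<close> and \<open>B\<close> on both sides, both products are equal to
  \<open>D0 + F + B F + B F A\<close>.
\<close>

lemma cone_chain: "cone_matrix \<star> U = U \<star> word_matrix"
proof -
  note idm = mmul_idm[OF _ finG] idm_mmul[OF _ finG]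
  note distrib = mmul_add_left mmul_add_right mmul_diff_left mmul_assoc
  have "cone_matrix \<star> U = cone_matrix + (cone_matrix \<star> A + cone_matrix \<star> B)"
    unfolding U_def by (simp only: mmul_add_right idm(1)[OF between_cone_matrix])
  also have "cone_matrix \<star> A = B \<star> (F \<star> A) + F \<star> A"
    unfolding cone_matrix_eq
    by (simp only: distrib D0_A zero_products mmul_zero_right add_0_left diff_zero)
  also have "cone_matrix \<star> B = 0"
    unfolding cone_matrix_eq
    by (simp only: distrib D0_B zero_products mmul_zero_right add_0_left diff_zero)
  finally have L: "cone_matrix \<star> U = (D0 - F \<star> A + B \<star> F + F) + (B \<star> (F \<star> A) + F \<star> A)"
    by (simp only: cone_matrix_eq add_0_right)
  have "between G G 1 word_matrix"
    unfolding word_matrix_eq by (intro between_add between_D0 between_F between_BFA)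
  then have "U \<star> word_matrix = word_matrix + (A \<star> word_matrix + B \<star> word_matrix)"
    unfolding U_def by (simp only: mmul_add_left idm(2))
  also have "A \<star> word_matrix = 0"
    unfolding word_matrix_eq
    by (simp only: mmul_add_right A_D0 zero_products add_0_left mmul_zero_left mmul_assoc[of _ _ A B, symmetric])
  also have "B \<star> word_matrix = B \<star> F"
    unfolding word_matrix_eq
    by (simp only: mmul_add_right B_D0 zero_products add_0_left add_0_right mmul_zero_left
        mmul_assoc[of _ _ B B, symmetric])
  finally have "U \<star> word_matrix = D0 + F + B \<star> (F \<star> A) + B \<star> F"
    by (simp only: word_matrix_eq add_0_left)
  then show ?thesis unfolding L telescoping_sum by (rule sym)
qed

lemma between_idm: "between G G 0 (idm G)"
proof (rule betweenI)
  fix s t r assume n0: "idm G s t r \<noteq> 0"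
  then have st: "s = t" "s \<in> indices G" and r: "r = (vert G s, [])"
    by (auto simp: idm_def alg_path_def split: if_splits)
  have "band_vertex Q w i \<in> verts Q" if "cyclic_word w" "i < length w" for w i
  proof -
    have p: "nontrivial_nonzero Q I (letter_path (w ! i))"
      using that by (simp add: cyclic_word_def)
    then have "nz (arrows_start Q (letter_path (w ! i)), letter_path (w ! i))"
      by (simp add: nontrivial_nonzero_def)
    from nz_start[OF this] nz_end[OF this] p show ?thesis
      by (cases "w ! i") (auto simp: band_vertex_def nontrivial_path_end)
  qed
  then have "vert G s \<in> verts Q" using st(2) \<sigma>(1) \<tau>(1) by (auto simp: G_def)
  then show "s \<in> indices G \<and> t \<in> indices G \<and> nz r \<and> path_end Q r = vert G s \<and> fst r = vert G t \<and>
      deg G t = deg G s + 0" using st r by simp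
qed

lemma U_inverse: "U \<star> U' = idm G" "U' \<star> U = idm G"
  and between_U: "between G G 0 U" "between G G 0 U'"
proof -
  define C where "C = A + B"
  have C: "between G G 0 C" unfolding C_def by (intro between_add between_A between_B)
  have sq: "C \<star> C = 0"
    by (simp only: C_def mmul_add_left mmul_add_right zero_products add_0_left)
  note idm = mmul_idm[OF _ finG] idm_mmul[OF _ finG]
  show "U \<star> U' = idm G" "U' \<star> U = idm G"
    unfolding U_def U'_def C_def[symmetric]
    by (simp_all only: mmul_add_left mmul_add_right mmul_diff_left mmul_diff_right sq
        idm(1)[OF C] idm(2)[OF C] idm(1)[OF between_idm] diff_zero diff_0_right add_0_right
        add_diff_cancel diff_add_cancel)
  show "between G G 0 U" unfolding U_def C_def[symmetric] by (intro between_add between_idm C)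
  show "between G G 0 U'"
    unfolding U'_def C_def[symmetric] diff_conv_add_uminus
    by (intro between_add between_uminus between_idm C)
qed

subsection \<open>Reading the cone along the new word\<close>

definition e\<sigma> :: "nat \<Rightarrow> ('a, 'k) edge" where
  "e\<sigma> t = \<lparr>lft = (0, t), rgt = (0, Suc t mod length \<sigma>), lett = \<sigma> ! t, coef = - scalar_at l\<sigma> lam t\<rparr>"

text \<open>The word runs through \<open>\<tau>\<close> backwards, so the letters are inverted and their ends exchanged.\<close>

definition e\<tau> :: "nat \<Rightarrow> ('a, 'k) edge" where
  "e\<tau> t = \<lparr>lft = (1, Suc t mod length \<tau>), rgt = (1, t), lett = letter_inv (\<tau> ! t),
     coef = scalar_at l\<tau> mu t\<rparr>"

definition ef :: "('a, 'k) edge" where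
  "ef = \<lparr>lft = (0, x), rgt = (1, y), lett = Direct f, coef = 1\<rparr>"

definition enew :: "('a, 'k) edge" where
  "enew = \<lparr>lft = (1, y'), rgt = (0, x'), lett = Direct (q @ f @ p), coef = s\<rparr>"

text \<open>
  From \<open>y\<close> leftwards along \<open>\<tau>\<^sub>L\<close> and \<open>\<delta>\<close> to vertex \<open>0\<close>, and then from the right end of \<open>\<gamma>\<close> to \<open>y'\<close>.
\<close>

definition \<tau>_positions :: "nat list" where
  "\<tau>_positions = rev [0..<y] @ rev [Suc y..<length \<tau>]"

definition diagram :: "('a, 'k) edge list" where
  "diagram = map e\<sigma> [0..<x] @ ef # map e\<tau> \<tau>_positions @ enew # map e\<sigma> [Suc x..<length \<sigma>]"

definition W :: "'a letter list" where
  "W = \<beta> @ [\<sigma>L, Direct f] @ [letter_inv \<tau>L] @ word_inv \<delta> @ word_inv \<gamma> @ [Direct (q @ f @ p)] @ \<alpha>"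

lemma map_nth_upt: "j \<le> length w \<Longrightarrow> map ((!) w) [i..<j] = drop i (take j w)"
  by (rule nth_equalityI) auto

lemma map_lett_diagram: "map lett diagram = W"
proof -
  have 1: "map (\<lambda>t. \<sigma> ! t) [0..<x] = \<beta> @ [\<sigma>L]"
    using map_nth_upt[of x \<sigma> 0] lengths by (simp add: \<sigma>_eq)
  have 2: "map (\<lambda>t. \<sigma> ! t) [Suc x..<length \<sigma>] = \<alpha>"
    using map_nth_upt[of "length \<sigma>" \<sigma> "Suc x"] by (simp add: \<sigma>_eq)
  have 3: "map (\<lambda>t. \<tau> ! t) [0..<y] = \<delta> @ [\<tau>L]"
    using map_nth_upt[of y \<tau> 0] lengths by (simp add: \<tau>_eq)
  have 4: "map (\<lambda>t. \<tau> ! t) [Suc y..<length \<tau>] = \<gamma>"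
    using map_nth_upt[of "length \<tau>" \<tau> "Suc y"] by (simp add: \<tau>_eq)
  have "map (\<lambda>t. letter_inv (\<tau> ! t)) (rev [0..<y]) = word_inv (map (\<lambda>t. \<tau> ! t) [0..<y])"
    "map (\<lambda>t. letter_inv (\<tau> ! t)) (rev [Suc y..<length \<tau>]) = word_inv (map (\<lambda>t. \<tau> ! t) [Suc y..<length \<tau>])"
    by (simp_all add: word_inv_def rev_map comp_def)
  then have "map lett diagram = (\<beta> @ [\<sigma>L]) @ Direct f # (word_inv (\<delta> @ [\<tau>L]) @ word_inv \<gamma>) @ Direct (q @ f @ p) # \<alpha>"
    unfolding diagram_def \<tau>_positions_def using 1 2 3 4
    by (simp add: e\<sigma>_def e\<tau>_def ef_def enew_def comp_def del: upt_Suc)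
  then show ?thesis by (simp add: W_def word_inv_def)
qed

lemma edge_matrices:
  "edge_matrix (e\<sigma> t) = letter_entry 0 \<sigma> (- scalar_at l\<sigma> lam t) t"
  "edge_matrix (e\<tau> t) = letter_entry 1 \<tau> (scalar_at l\<tau> mu t) t"
  "edge_matrix ef = F" "edge_matrix enew = entry (1, y') (0, x') (path_elem s (q @ f @ p))"
  by (simp_all add: edge_matrix_def edge_source_def edge_target_def letter_entry_def e\<sigma>_def e\<tau>_def
      ef_def enew_def F_def arrow_source_def arrow_target_def)

lemma distinct_positions: "distinct \<tau>_positions" "set \<tau>_positions = {..<length \<tau>} - {y}"
  "distinct ([0..<x] @ [Suc x..<length \<sigma>])" "set ([0..<x] @ [Suc x..<length \<sigma>]) = {..<length \<sigma>} - {x}"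
  using lengths by (auto simp: \<tau>_positions_def)

lemma sum_diagram:
  fixes g :: "('a, 'k) edge \<Rightarrow> 'b::comm_monoid_add"
  shows "(\<Sum>m<length diagram. g (diagram ! m)) = (\<Sum>t\<in>{..<length \<sigma>} - {x}. g (e\<sigma> t)) +
    (\<Sum>t\<in>{..<length \<tau>} - {y}. g (e\<tau> t)) + g ef + g enew"
proof -
  have "(\<Sum>m<length diagram. g (diagram ! m)) = sum_list (map g diagram)"
    by (simp add: sum_list_sum_nth atLeast0LessThan)
  also have "\<dots> = sum_list (map (\<lambda>t. g (e\<sigma> t)) ([0..<x] @ [Suc x..<length \<sigma>])) +
      sum_list (map (\<lambda>t. g (e\<tau> t)) \<tau>_positions) + g ef + g enew"
    by (simp add: diagram_def comp_def add_ac del: upt_Suc)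
  finally show ?thesis
    unfolding sum.distinct_set_conv_list[OF distinct_positions(1), symmetric]
      sum.distinct_set_conv_list[OF distinct_positions(3), symmetric] distinct_positions(2,4) .
qed

lemma prod_diagram:
  fixes g :: "('a, 'k) edge \<Rightarrow> 'b::comm_monoid_mult"
  shows "(\<Prod>m<length diagram. g (diagram ! m)) = (\<Prod>t\<in>{..<length \<sigma>} - {x}. g (e\<sigma> t)) *
    (\<Prod>t\<in>{..<length \<tau>} - {y}. g (e\<tau> t)) * g ef * g enew"
proof -
  have "(\<Prod>m<length diagram. g (diagram ! m)) = prod_list (map g diagram)"
    by (simp add: prod.list_conv_set_nth atLeast0LessThan)
  also have "\<dots> = prod_list (map (\<lambda>t. g (e\<sigma> t)) ([0..<x] @ [Suc x..<length \<sigma>])) *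
      prod_list (map (\<lambda>t. g (e\<tau> t)) \<tau>_positions) * g ef * g enew"
    by (simp add: diagram_def comp_def mult_ac del: upt_Suc)
  finally show ?thesis
    unfolding prod.distinct_set_conv_list[OF distinct_positions(1), symmetric]
      prod.distinct_set_conv_list[OF distinct_positions(3), symmetric] distinct_positions(2,4) .
qed

lemma sum_edge_matrices: "(\<Sum>m<length diagram. edge_matrix (diagram ! m)) = word_matrix"
  unfolding sum_diagram edge_matrices word_matrix_def D0_def by (simp only: add_ac)

lemma even_length_\<sigma>: "even (length \<sigma>)"
proof -
  have "length (filter is_direct \<sigma>) = length (filter (\<lambda>l. \<not> is_direct l) \<sigma>)"
    using \<sigma>(2) by (simp add: balance_eq)
  then show ?thesis using sum_length_filter_compl[of is_direct \<sigma>] by presburger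
qed

text \<open>
  Each of the evenly many letters of \<open>\<sigma>\<close> contributes a sign, except that the sign at \<open>\<sigma>\<^sub>R\<close> is
  absent from its replacement \<open>q f p\<close>; one sign remains. Along \<open>\<tau>\<close> the scalar \<open>mu\<close> is met on an
  inverted letter.
\<close>

lemma holonomy_diagram: "(\<Prod>m<length diagram. holonomy (diagram ! m)) = - mu * inverse lam"
proof -
  have "(\<Prod>t<length \<sigma>. holonomy (e\<sigma> t)) = (\<Prod>t<length \<sigma>. - 1 * (if t = l\<sigma> then inverse lam else 1))"
    using l\<sigma> by (intro prod.cong) (auto simp: holonomy_def e\<sigma>_def scalar_at_def direct_position_def)
  also have "\<dots> = inverse lam"
    unfolding prod.distrib using l\<sigma> even_length_\<sigma> by (simp add: direct_position_def)
  finally have \<sigma>_prod: "(\<Prod>t<length \<sigma>. holonomy (e\<sigma> t)) = inverse lam" .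
  have "(\<Prod>t<length \<tau>. holonomy (e\<tau> t)) = (\<Prod>t<length \<tau>. if t = l\<tau> then mu else 1)"
  proof (rule prod.cong[OF refl])
    fix t show "holonomy (e\<tau> t) = (if t = l\<tau> then mu else 1)"
      using l\<tau> by (cases "\<tau> ! t") (auto simp: holonomy_def e\<tau>_def scalar_at_def direct_position_def)
  qed
  also have "\<dots> = mu" using l\<tau> by (simp add: direct_position_def)
  finally have \<tau>_prod: "(\<Prod>t<length \<tau>. holonomy (e\<tau> t)) = mu" .
  have "holonomy enew = - holonomy (e\<sigma> x)" "holonomy ef = 1" "holonomy (e\<tau> y) = 1"
    using letters \<tau>_scalar by (simp_all add: holonomy_def enew_def e\<sigma>_def ef_def e\<tau>_def s_def)
  moreover have "(\<Prod>t<length \<sigma>. holonomy (e\<sigma> t)) = holonomy (e\<sigma> x) * (\<Prod>t\<in>{..<length \<sigma>} - {x}. holonomy (e\<sigma> t))"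
    "(\<Prod>t<length \<tau>. holonomy (e\<tau> t)) = holonomy (e\<tau> y) * (\<Prod>t\<in>{..<length \<tau>} - {y}. holonomy (e\<tau> t))"
    using lengths by (auto intro: prod.remove)
  ultimately show ?thesis
    unfolding prod_diagram using \<sigma>_prod \<tau>_prod by (simp add: mult_ac)
qed

text \<open>
  The left ends along \<open>\<tau>\<close> are the positions shifted by one; the missing one, \<open>y'\<close>, is the left end of the
  new letter \<open>q f p\<close>.
\<close>

lemma lefts_diagram: "distinct (map lft diagram)" "set (map lft diagram) = indices G"
proof -
  have inj: "inj_on (\<lambda>t. Suc t mod length \<tau>) {..<length \<tau>}"
    and surj: "(\<lambda>t. Suc t mod length \<tau>) ` {..<length \<tau>} = {..<length \<tau>}"
    using bij_betw_Suc_mod[of "length \<tau>"] by (auto simp: bij_betw_def)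
  have lefts: "map lft diagram = map (Pair 0) [0..<x] @ (0, x) # map (\<lambda>t. (1, Suc t mod length \<tau>)) \<tau>_positions @
      (1, y') # map (Pair 0) [Suc x..<length \<sigma>]"
    by (simp add: diagram_def e\<sigma>_def e\<tau>_def ef_def enew_def comp_def del: upt_Suc)
  have "y' \<notin> (\<lambda>t. Suc t mod length \<tau>) ` set \<tau>_positions"
    using inj lengths unfolding distinct_positions(2) inj_on_def by auto
  moreover have "inj_on (\<lambda>t. (1 :: nat, Suc t mod length \<tau>)) (set \<tau>_positions)"
    using inj unfolding distinct_positions(2) inj_on_def by auto
  ultimately show "distinct (map lft diagram)"
    unfolding lefts using distinct_positions(1) by (auto simp: distinct_map inj_on_def)
  have "{..<length \<tau>} = insert y ({..<length \<tau>} - {y})" using lengths by auto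
  then have \<tau>_all: "{..<length \<tau>} = insert y' ((\<lambda>t. Suc t mod length \<tau>) ` set \<tau>_positions)"
    unfolding distinct_positions(2) by (metis image_insert surj)
  have "set (map lft diagram) = Pair 0 ` {..<length \<sigma>} \<union> Pair 1 ` {..<length \<tau>}"
    unfolding lefts \<tau>_all using lengths by (auto simp: image_iff)
  also have "\<dots> = indices G" by (auto simp: G_def split: if_splits)
  finally show "set (map lft diagram) = indices G" .
qed

end

subsection \<open>Cyclic sequences\<close>

lemma cyclic_chain:
  assumes "xs \<noteq> []"
  shows "successively R (xs @ [hd xs]) \<longleftrightarrow> (\<forall>m<length xs. R (xs ! m) (xs ! (Suc m mod length xs)))"
proof -
  have nth: "(xs @ [hd xs]) ! Suc m = xs ! (Suc m mod length xs)" if "m < length xs" for m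
    using that assms by (cases "Suc m = length xs") (auto simp: nth_append hd_conv_nth)
  have "successively R (xs @ [hd xs]) \<longleftrightarrow>
      (\<forall>m<length xs. R ((xs @ [hd xs]) ! m) ((xs @ [hd xs]) ! Suc m))"
    by (simp add: successively_conv_nth)
  then show ?thesis using nth by (simp add: nth_append)
qed

lemma successively_map_upt:
  assumes "\<And>t. i \<le> t \<Longrightarrow> Suc t < j \<Longrightarrow> P (g t) (g (Suc t))"
  shows "successively P (map g [i..<j])"
  using assms by (auto simp: successively_conv_nth)

lemma successively_map_rev_upt:
  assumes "\<And>t. i \<le> t \<Longrightarrow> Suc t < j \<Longrightarrow> P (g (Suc t)) (g t)"
  shows "successively P (map g (rev [i..<j]))"
  unfolding rev_map[symmetric] successively_rev using assms by (intro successively_map_upt)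

lemma successively_overlap:
  "successively P (xs @ [c]) \<Longrightarrow> successively P (c # ys) \<Longrightarrow> successively P (xs @ c # ys)"
  by (simp add: successively_append_iff)

context gentle_algebra
begin

lemma adjacent_inv: "adjacent l r \<Longrightarrow> adjacent (letter_inv r) (letter_inv l)"
  by (cases l; cases r) (auto simp: adjacent_def)

lemma successively_adjacent_inv: "successively adjacent w \<Longrightarrow> successively adjacent (word_inv w)"
  unfolding word_inv_def successively_rev successively_map
  by (erule successively_mono) (rule adjacent_inv)

lemma cyclic_word_iff:
  "cyclic_word w \<longleftrightarrow> w \<noteq> [] \<and> (\<forall>l\<in>set w. nontrivial_nonzero Q I (letter_path l)) \<and>
     successively adjacent (w @ [hd w])"
  using cyclic_chain[of w adjacent] by (auto simp: cyclic_word_def)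

lemma homotopy_string_double_iff: "homotopy_string Q I (w @ w) \<longleftrightarrow> cyclic_word w"
proof
  assume w: "cyclic_word w"
  then have ne: "w \<noteq> []" and s: "successively adjacent (w @ [hd w])" by (auto simp: cyclic_word_iff)
  then have "successively adjacent (w @ w)"
    by (simp add: successively_append_iff)
  then show "homotopy_string Q I (w @ w)" using w by (auto simp: homotopy_string_iff cyclic_word_iff)
qed (rule cyclic_word_if_double)

end

context single_map_cone
begin

lemma diagram_chain:
  assumes "m < length diagram"
  shows "rgt (diagram ! m) = lft (diagram ! (Suc m mod length diagram))"
proof -
  let ?R = "\<lambda>e e' :: ('a, 'k) edge. rgt e = lft e'"
  \<comment> \<open>reading positions modulo the length makes the step from the last letter to \<open>e\<sigma> 0\<close> an ordinary one\<close>
  let ?e = "\<lambda>t. e\<sigma> (t mod length \<sigma>)"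
  have hd: "hd diagram = e\<sigma> 0" and ne: "diagram \<noteq> []"
    by (simp_all add: diagram_def upt_conv_Cons del: upt_Suc)
  have step: "?R (?e t) (?e (Suc t))" for t
    by (simp add: e\<sigma>_def mod_Suc_eq)
  have right: "successively ?R (map ?e [Suc x..<Suc (length \<sigma>)])"
    by (rule successively_map_upt) (rule step)
  have left: "successively ?R (map ?e [0..<Suc x])"
    by (rule successively_map_upt) (rule step)
  have "map ?e [Suc x..<Suc (length \<sigma>)] = map ?e [Suc x..<length \<sigma>] @ [e\<sigma> 0]"
    using lengths by simp
  also have "map ?e [Suc x..<length \<sigma>] = map e\<sigma> [Suc x..<length \<sigma>]" by (intro map_cong) auto
  finally have tail: "successively ?R (map e\<sigma> [Suc x..<length \<sigma>] @ [e\<sigma> 0])" using right by simp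
  have tail_hd: "lft (hd (map e\<sigma> [Suc x..<length \<sigma>] @ [e\<sigma> 0])) = (0, x')"
    using lengths by (cases "Suc x < length \<sigma>") (auto simp: e\<sigma>_def hd_append hd_map mod_Suc)
  have "map ?e [0..<Suc x] = map e\<sigma> [0..<Suc x]" using lengths by (intro map_cong) auto
  with left have "successively ?R (map e\<sigma> [0..<Suc x])" by (simp only:)
  then have "successively ?R (map e\<sigma> [0..<x] @ [e\<sigma> x])" by simp
  moreover have "lft ef = lft (e\<sigma> x)" by (simp add: e\<sigma>_def ef_def)
  ultimately have head: "successively ?R (map e\<sigma> [0..<x] @ [ef])"
    unfolding successively_append_iff by (simp del: upt_Suc)
  have m1: "successively ?R (map e\<tau> (rev [0..<y]))"
    and m2: "successively ?R (map e\<tau> (rev [Suc y..<length \<tau>]))"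
    using lengths by (auto intro!: successively_map_rev_upt simp: e\<tau>_def simp del: upt_Suc)
  have ends1: "hd (map e\<tau> (rev [0..<y])) = e\<tau> (length \<delta>)" "last (map e\<tau> (rev [0..<y])) = e\<tau> 0"
    by (simp_all add: hd_map last_map hd_rev last_rev)
  have middle: "successively ?R (ef # map e\<tau> \<tau>_positions @ [enew])"
  \<comment> \<open>for \<open>\<gamma> = []\<close> the second half of \<open>\<tau>_positions\<close> is empty and \<open>y' = 0\<close>\<close>
  proof (cases "Suc y < length \<tau>")
    case True
    then have "[Suc y..<length \<tau>] \<noteq> []" by (auto simp del: length_0_conv)
    then have "hd (map e\<tau> (rev [Suc y..<length \<tau>])) = e\<tau> (length \<tau> - 1)"
      "last (map e\<tau> (rev [Suc y..<length \<tau>])) = e\<tau> (Suc y)"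
      using True by (simp_all add: hd_map last_map hd_rev last_rev del: upt_Suc)
    then show ?thesis
      using m1 m2 ends1 True lengths \<tau>(1)
      by (simp add: \<tau>_positions_def successively_append_iff successively_Cons e\<tau>_def ef_def enew_def
          hd_append last_append cyclic_word_def del: upt_Suc)
  next
    case False
    then have "length \<tau> = Suc y" using lengths by simp
    then show ?thesis
      using m1 ends1 lengths
      by (simp add: \<tau>_positions_def successively_append_iff successively_Cons e\<tau>_def ef_def enew_def
          hd_append last_append del: upt_Suc)
  qed
  have "successively ?R ((ef # map e\<tau> \<tau>_positions) @ enew # map e\<sigma> [Suc x..<length \<sigma>] @ [e\<sigma> 0])"
  proof (rule successively_overlap)
    show "successively ?R (enew # map e\<sigma> [Suc x..<length \<sigma>] @ [e\<sigma> 0])"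
      using tail tail_hd by (simp add: successively_Cons enew_def)
  qed (use middle in simp)
  from successively_overlap[OF head, OF this[unfolded append_Cons]]
  have "successively ?R (diagram @ [hd diagram])"
    unfolding hd by (simp add: diagram_def del: upt_Suc)
  then show ?thesis using assms unfolding cyclic_chain[OF ne] by blast
qed

lemma diagram_edges:
  assumes "e \<in> set diagram"
  shows "vert G (lft e) = letter_end Q (lett e)"
    and "deg G (rgt e) = deg G (lft e) + (if is_direct (lett e) then 1 else - 1)"
    and "coef e \<noteq> 0"
proof -
  have "e \<in> e\<sigma> ` {..<length \<sigma>} \<or> e \<in> e\<tau> ` {..<length \<tau>} \<or> e = ef \<or> e = enew"
    using assms lengths by (auto simp: diagram_def \<tau>_positions_def)
  then have "vert G (lft e) = letter_end Q (lett e) \<and>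
    deg G (rgt e) = deg G (lft e) + (if is_direct (lett e) then 1 else - 1) \<and> coef e \<noteq> 0"
  proof (elim disjE imageE)
    fix t assume "e = e\<sigma> t" "t \<in> {..<length \<sigma>}"
    then show ?thesis
      using vertex_degree_next[OF \<sigma>(2), of t d\<sigma>] lam by (simp add: e\<sigma>_def band_vertex_def scalar_at_def)
  next
    fix t assume "e = e\<tau> t" "t \<in> {..<length \<tau>}"
    then show ?thesis
      using vertex_degree_next[OF \<tau>(2), of t d\<tau>] band_vertex_next[OF \<tau>(1), of t] mu
      by (simp add: e\<tau>_def scalar_at_def)
  next
    assume "e = ef"
    then show ?thesis using f_vertices degrees by (simp add: ef_def)
  next
    assume "e = enew"
    then show ?thesis
      using \<tau>_next_vertex \<sigma>_next_vertex degrees ne lam by (simp add: enew_def arrows_end_def s_def scalar_at_def)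
  qed
  then show "vert G (lft e) = letter_end Q (lett e)"
    "deg G (rgt e) = deg G (lft e) + (if is_direct (lett e) then 1 else - 1)" "coef e \<noteq> 0" by auto
qed

lemma length_W: "length W = length diagram"
  unfolding map_lett_diagram[symmetric] by simp

text \<open>
  The junctions of \<open>W\<close> are junctions of \<open>\<sigma>\<close> or of the inverse of \<open>\<tau>\<close>: at the ends of \<open>f\<close> and \<open>q f p\<close> the
  condition only depends on the outermost arrow, which is the one of \<open>f p\<close> or of \<open>q f\<close>.
\<close>

lemma cyclic_word_W: "cyclic_word W"
proof -
  let ?n = "Direct (q @ f @ p)" and ?\<tau>R = "Inverse (q @ f)" and ?\<sigma>R = "Direct (f @ p)"
  let ?M = "letter_inv \<tau>L # word_inv \<delta> @ word_inv \<gamma>"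
  let ?h = "hd (\<beta> @ [\<sigma>L])"
  have \<sigma>s: "successively adjacent (\<sigma> @ [hd \<sigma>])" and \<tau>s: "successively adjacent (\<tau> @ [hd \<tau>])"
    using \<sigma>(1) \<tau>(1) by (auto simp: cyclic_word_iff)
  have "hd \<sigma> = ?h" by (simp add: \<sigma>_eq hd_append)
  define v where "v = \<alpha> @ [?h]"
  have v: "v \<noteq> []" by (simp add: v_def)
  have "successively adjacent ((\<beta> @ [\<sigma>L]) @ ?\<sigma>R # v)"
    using \<sigma>s \<open>hd \<sigma> = ?h\<close> by (simp add: \<sigma>_eq v_def)
  then have left: "successively adjacent (\<beta> @ [\<sigma>L])" and right: "successively adjacent v"
    and \<sigma>R: "adjacent ?\<sigma>R (hd v)" and \<sigma>L: "adjacent \<sigma>L ?\<sigma>R"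
    using v by (auto simp: successively_append_iff successively_Cons)
  \<comment> \<open>rotate \<open>\<tau>\<close> so that it is cut at \<open>\<tau>\<^sub>R\<close> instead of at vertex \<open>0\<close>\<close>
  obtain c u where c: "\<delta> @ [\<tau>L, ?\<tau>R] = c # u" by (cases \<delta>) auto
  then have "hd \<tau> = c" by (cases \<delta>) (auto simp: \<tau>_eq)
  with \<tau>s have \<tau>s': "successively adjacent ((\<delta> @ [\<tau>L, ?\<tau>R]) @ (\<gamma> @ [c]))"
    by (simp add: \<tau>_eq)
  then have "successively adjacent (c # u)"
    unfolding c[symmetric] successively_append_iff[of _ "\<delta> @ [\<tau>L, ?\<tau>R]"] by blast
  moreover have "(\<delta> @ [\<tau>L, ?\<tau>R]) @ (\<gamma> @ [c]) = (\<delta> @ [\<tau>L]) @ (?\<tau>R # \<gamma> @ [c])" by simp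
  with \<tau>s' have "successively adjacent (?\<tau>R # \<gamma> @ [c])"
    by (metis successively_append_iff)
  ultimately have "successively adjacent ((?\<tau>R # \<gamma>) @ c # u)"
    using successively_overlap[of adjacent "?\<tau>R # \<gamma>" c u] by simp
  then have "successively adjacent (?\<tau>R # \<gamma> @ \<delta> @ [\<tau>L, ?\<tau>R])"
    unfolding c by simp
  then have "successively adjacent (word_inv (?\<tau>R # \<gamma> @ \<delta> @ [\<tau>L, ?\<tau>R]))"
    by (rule successively_adjacent_inv)
  then have inv: "successively adjacent (Direct (q @ f) # ?M @ [Direct (q @ f)])"
    by (simp add: word_inv_def)
  then have M: "successively adjacent ?M" and first: "adjacent (Direct (q @ f)) (letter_inv \<tau>L)"
    and last: "adjacent (last ?M) (Direct (q @ f))"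
    unfolding successively_Cons[of _ "Direct (q @ f)"] successively_append_iff by auto
  have "adjacent (Direct f) (letter_inv \<tau>L)"
    using first ne by (cases \<tau>L) (auto simp: adjacent_def arrows_start_def)
  moreover have "adjacent (last ?M) ?n"
    using last ne by (cases "last ?M") (auto simp: adjacent_def arrows_end_def)
  moreover have "adjacent ?n (hd v)"
    using \<sigma>R ne by (cases "hd v") (auto simp: adjacent_def arrows_start_def)
  moreover have "adjacent \<sigma>L (Direct f)"
    using \<sigma>L ne by (cases \<sigma>L) (auto simp: adjacent_def arrows_end_def)
  ultimately have "successively adjacent ((\<beta> @ [\<sigma>L]) @ Direct f # ?M @ ?n # v)"
    using left right M v by (simp only: successively_append_iff successively_Cons) auto
  moreover have "hd W = ?h" by (simp add: W_def hd_append)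
  ultimately have "successively adjacent (W @ [hd W])" by (simp add: W_def v_def)
  moreover have "\<forall>l\<in>set W. nontrivial_nonzero Q I (letter_path l)"
    using \<sigma>(1) \<tau>(1) nonzero_factors by (auto simp: cyclic_word_def W_def \<sigma>_eq \<tau>_eq word_inv_def)
  ultimately show ?thesis by (simp add: cyclic_word_iff W_def)
qed

lemma balance_W: "balance W = 0"
proof -
  have "balance w = (\<Sum>l\<leftarrow>w. if is_direct l then 1 else - 1)" for w :: "'a letter list"
    by (simp add: balance_def sum_list_sum_nth atLeast0LessThan)
  moreover have "(\<Sum>l\<leftarrow>word_inv w. if is_direct l then 1 else - 1 :: int) =
      - (\<Sum>l\<leftarrow>w. if is_direct l then 1 else - 1)" for w :: "'a letter list"
    by (induction w) (auto simp: word_inv_def)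
  ultimately show ?thesis
    using \<sigma>(2) \<tau>(2) by (auto simp: W_def \<sigma>_eq \<tau>_eq)
qed

end

section \<open>Reduced walks and powers of words\<close>

lemma walk_append: "walk (u @ v) = walk u @ walk v"
  by (simp add: walk_def)

lemma walk_Cons: "walk (l # w) = letter_walk l @ walk w"
  by (simp add: walk_def)

abbreviation reduced :: "('a \<times> bool) list \<Rightarrow> bool" where
  "reduced \<equiv> successively (\<lambda>x y. \<not> (fst x = fst y \<and> snd x \<noteq> snd y))"

lemma foldr_cancel_reduced: "reduced (u @ v) \<Longrightarrow> foldr cancel_cons u v = u @ v"
proof (induction u)
  case (Cons a u)
  then show ?case by (cases "u @ v") (auto simp: successively_Cons)
qed simp

lemma foldr_cancel_inverse:
  "foldr cancel_cons (map (\<lambda>a. (a, False)) (rev f)) (map (\<lambda>a. (a, True)) f @ v) = v"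
  by (induction f) auto

text \<open>
  Cancellation inside the walk of a homotopy string could only occur where its direction changes, and
  there the junction condition excludes it.
\<close>

lemma (in gentle_algebra) reduced_walk_of_string:
  assumes "successively adjacent w" "\<forall>l\<in>set w. letter_path l \<noteq> []"
  shows "reduced (walk w)"
  using assms
proof (induction w)
  case Nil
  then show ?case by (simp add: walk_def)
next
  case (Cons l w)
  have letter: "reduced (letter_walk l)" for l :: "'a letter"
    by (cases l) (auto simp: successively_conv_nth)
  show ?case
  proof (cases w)
    case Nil
    then show ?thesis using letter by (simp add: walk_def)
  next
    case (Cons r w')
    have hd: "hd (walk w) = hd (letter_walk r)" and ne: "letter_path r \<noteq> []" "letter_path l \<noteq> []"
      using Cons.prems Cons by (cases r; auto simp: walk_def hd_append)+
    have "adjacent l r" using Cons.prems Cons by simp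
    then have "\<not> (fst (last (letter_walk l)) = fst (hd (letter_walk r)) \<and>
        snd (last (letter_walk l)) \<noteq> snd (hd (letter_walk r)))"
      using ne by (cases l; cases r) (auto simp: adjacent_def last_map hd_map last_rev hd_rev)
    moreover have "reduced (walk w)" using Cons.IH Cons.prems Cons by auto
    ultimately show ?thesis
      unfolding walk_Cons successively_append_iff hd using letter by blast
  qed
qed

text \<open>
  Cancelling proceeds from the right: the walk of \<open>f p\<close> and \<open>\<alpha>\<close> is reduced, the inverse of \<open>f\<close> removes \<open>f\<close>
  from it, and putting \<open>q f\<close> in front gives \<open>W\<close>, which admits no further cancellation.
\<close>

lemma (in single_map_cone) walk_W:
  "reduced_walk (\<beta> @ [\<sigma>L] @ [Direct f] @ word_inv [\<tau>L] @ word_inv \<delta> @ word_inv \<gamma> @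
     word_inv [Inverse (q @ f)] @ [Inverse f] @ [Direct (f @ p)] @ \<alpha>) = walk W"
proof -
  let ?P = "\<beta> @ [\<sigma>L] @ [Direct f] @ word_inv [\<tau>L] @ word_inv \<delta> @ word_inv \<gamma>"
  let ?d = "map (\<lambda>a. (a, True))"
  have W: "walk W = (walk ?P @ ?d (q @ f)) @ ?d p @ walk \<alpha>"
    by (simp add: W_def walk_def word_inv_def)
  have red: "reduced (walk W)"
    using cyclic_word_W by (intro reduced_walk_of_string)
      (auto simp: cyclic_word_iff successively_append_iff nontrivial_nonzero_def)
  have "successively adjacent \<sigma>" "\<forall>l\<in>set \<sigma>. letter_path l \<noteq> []"
    using \<sigma>(1) by (auto simp: cyclic_word_iff successively_append_iff nontrivial_nonzero_def)
  then have "reduced (walk \<sigma>)" by (rule reduced_walk_of_string)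
  moreover have "walk \<sigma> = walk (\<beta> @ [\<sigma>L]) @ (?d f @ ?d p @ walk \<alpha>)"
    by (simp add: walk_def \<sigma>_eq)
  ultimately have "reduced (walk (\<beta> @ [\<sigma>L]) @ (?d f @ ?d p @ walk \<alpha>))" by (simp only:)
  then have "reduced (?d f @ ?d p @ walk \<alpha>)"
    unfolding successively_append_iff[of _ "walk (\<beta> @ [\<sigma>L])"] by blast
  then have "foldr cancel_cons (?d (f @ p) @ walk \<alpha>) [] = ?d f @ ?d p @ walk \<alpha>"
    using foldr_cancel_reduced[of "?d (f @ p) @ walk \<alpha>" "[]"] by simp
  then have "foldr cancel_cons (walk ([Inverse f] @ [Direct (f @ p)] @ \<alpha>)) [] = ?d p @ walk \<alpha>"
    by (simp add: walk_def foldr_cancel_inverse)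
  then have "reduced_walk (?P @ [Direct (q @ f)] @ [Inverse f] @ [Direct (f @ p)] @ \<alpha>) =
      foldr cancel_cons (walk ?P @ ?d (q @ f)) (?d p @ walk \<alpha>)"
    unfolding reduced_walk_def walk_append foldr_append by (simp add: walk_def)
  also have "\<dots> = walk W"
    using red foldr_cancel_reduced unfolding W by blast
  finally show ?thesis by (simp add: word_inv_def)
qed

lemma word_power_0 [simp]: "word_power w 0 = []"
  and word_power_Suc [simp]: "word_power w (Suc k) = w @ word_power w k"
  by (simp_all add: word_power_def)

lemma word_power_add: "word_power w (j + k) = word_power w j @ word_power w k"
  by (induction j) auto

lemma word_power_mult: "word_power (word_power w j) k = word_power w (k * j)"
  by (induction k) (auto simp: word_power_add)

lemma length_word_power [simp]: "length (word_power w k) = k * length w"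
  by (induction k) auto

lemma nth_word_power: "m < k * length w \<Longrightarrow> word_power w k ! m = w ! (m mod length w)"
proof (induction k arbitrary: m)
  case (Suc k)
  show ?case
  proof (cases "m < length w")
    case False
    then have "m - length w < k * length w" using Suc.prems by auto
    then show ?thesis using Suc.IH[of "m - length w"] False by (simp add: nth_append le_mod_geq)
  qed (simp add: nth_append)
qed simp

lemma primitive_word_root:
  assumes "w \<noteq> []"
  shows "\<exists>u k. 1 \<le> k \<and> w = word_power u k \<and> \<not> (\<exists>v m. 2 \<le> m \<and> u = word_power v m)"
  using assms
proof (induction "length w" arbitrary: w rule: less_induct)
  case less
  show ?case
  proof (cases "\<exists>v m. 2 \<le> m \<and> w = word_power v m")
    case False
    then show ?thesis by (intro exI[of _ w] exI[of _ 1]) simp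
  next
    case True
    then obtain v m where v: "2 \<le> m" "w = word_power v m" by blast
    then have "v \<noteq> []" using less.prems by (auto simp: word_power_def)
    moreover from this have "length v < length w" using v by simp
    ultimately obtain u k where u: "1 \<le> k" "v = word_power u k" "\<not> (\<exists>v m. 2 \<le> m \<and> u = word_power v m)"
      using less.hyps by blast
    have "w = word_power u (m * k)" using u(2) v(2) by (simp add: word_power_mult)
    moreover have "1 \<le> m * k" using u(1) v(1) by simp
    ultimately show ?thesis using u(3) by blast
  qed
qed

lemma balance_word_power: "balance (word_power w k) = int k * balance w"
proof -
  have "balance (u @ v) = balance u + balance v" for u v :: "'a letter list"
    by (simp add: balance_eq)
  then show ?thesis by (induction k) (simp_all add: algebra_simps, simp add: balance_def)
qed

lemma (in gentle_algebra) homotopy_band_root: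
  assumes W: "cyclic_word (word_power \<theta> k)" "balance (word_power \<theta> k) = 0" and k: "1 \<le> k"
    and prim: "\<not> (\<exists>v m. 2 \<le> m \<and> \<theta> = word_power v m)"
  shows "homotopy_band Q I \<theta>"
proof -
  obtain j where j: "k = Suc j" using k by (cases k) auto
  have "homotopy_string Q I (word_power \<theta> k @ word_power \<theta> k)"
    using W(1) by (simp add: homotopy_string_double_iff)
  then have "homotopy_string Q I ((\<theta> @ word_power \<theta> j) @ (\<theta> @ word_power \<theta> j))" by (simp add: j)
  moreover have "(\<theta> @ word_power \<theta> j) @ (\<theta> @ word_power \<theta> j) = (\<theta> @ \<theta>) @ word_power \<theta> (j + j)"
  proof -
    have "word_power \<theta> (Suc j) = word_power \<theta> j @ \<theta>"
      using word_power_add[of \<theta> j 1] by simp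
    then have "(\<theta> @ word_power \<theta> j) @ (\<theta> @ word_power \<theta> j) = \<theta> @ word_power \<theta> (Suc j) @ word_power \<theta> j"
      by (simp only: append_assoc)
    then show ?thesis by (simp add: word_power_add)
  qed
  ultimately have "homotopy_string Q I ((\<theta> @ \<theta>) @ word_power \<theta> (j + j))" by simp
  moreover have ne: "\<theta> \<noteq> []" using W(1) by (auto simp: cyclic_word_def word_power_def)
  ultimately have double: "homotopy_string Q I (\<theta> @ \<theta>)"
    unfolding homotopy_string_iff successively_append_iff by auto
  then have "homotopy_string Q I \<theta>"
    using ne unfolding homotopy_string_iff successively_append_iff by auto
  moreover have "letter_start Q (last \<theta>) = letter_end Q (hd \<theta>)"
    using double ne unfolding homotopy_string_iff successively_append_iff by (simp add: adjacent_def)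
  moreover have "balance \<theta> = 0" using W(2) k by (simp add: balance_word_power)
  ultimately show ?thesis
    using double prim by (simp add: homotopy_band_def balance_eq)
qed

section \<open>The decomposition of the mapping cone\<close>

text \<open>
  The change of basis \<open>U\<close> followed by the splitting of \<open>W = \<theta>\<^sup>k\<close> is the isomorphism.
\<close>

lemma (in single_map_cone) cone_decomposition:
  assumes F: "single_map Q I \<sigma> d\<sigma> l\<sigma> lam \<tau> d\<tau> l\<tau> mu x y f F'"
    and W: "W = word_power \<theta> k" and \<theta>: "homotopy_band Q I \<theta>" "direct_position \<theta> l"
    and \<omega>: "primitive_root_of_unity k \<omega>" and \<rho>: "\<rho> ^ k = - lam * inverse mu"
  shows "derived_iso Q I
    (cone (band_complex Q I \<sigma> d\<sigma> l\<sigma> lam) (band_complex Q I \<tau> d\<tau> l\<tau> mu) F')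
    (cpx_dsum {1..k} (\<lambda>i. band_complex Q I \<theta> (d\<sigma> - 1) l (\<omega> ^ i * \<rho>)))"
proof -
  let ?n = "length \<theta>"
  have cyc: "cyclic_word \<theta>" "balance \<theta> = 0" using \<theta>(1) by (rule homotopy_bandD)+
  have n0: "0 < ?n" using cyc(1) by (simp add: cyclic_word_def)
  have len: "length diagram = k * ?n" using length_W by (simp add: W)
  have lett: "lett (diagram ! m) = \<theta> ! (m mod ?n)" if "m < k * ?n" for m
    using that nth_word_power[of m k \<theta>] unfolding W[symmetric] map_lett_diagram[symmetric] by (simp add: len)
  have rgt: "rgt (diagram ! m) = lft (diagram ! (Suc m mod (k * ?n)))" if "m < k * ?n" for m
    using diagram_chain[of m] that by (simp add: len)
  have vert: "vert G (lft (diagram ! m)) = band_vertex Q \<theta> (m mod ?n)" if "m < k * ?n" for m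
    using diagram_edges(1)[OF nth_mem] that lett by (simp add: band_vertex_def len)
  have deg: "deg G (lft (diagram ! m)) = vertex_degree \<theta> (d\<sigma> - 1) (m mod ?n)" if "m < k * ?n" for m
    using that
  proof (induction m)
    case 0
    have "lft (diagram ! 0) = (0, 0)"
      by (simp add: diagram_def e\<sigma>_def upt_conv_Cons del: upt_Suc)
    then show ?case by (simp add: vertex_degree_def)
  next
    case (Suc m)
    then have "deg G (lft (diagram ! Suc m)) = deg G (rgt (diagram ! m))" using rgt[of m] by simp
    also have "\<dots> = vertex_degree \<theta> (d\<sigma> - 1) (m mod ?n) + (if is_direct (\<theta> ! (m mod ?n)) then 1 else - 1)"
      using Suc diagram_edges(2)[OF nth_mem, of m] lett[of m] by (simp add: len)
    also have "\<dots> = vertex_degree \<theta> (d\<sigma> - 1) (Suc (m mod ?n) mod ?n)"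
      using vertex_degree_next[OF cyc(2)] n0 by simp
    finally show ?case by (simp add: mod_Suc_eq)
  qed
  interpret P: cyclic_power Q I diagram G \<theta> "d\<sigma> - 1" k ?n l \<omega> \<rho>
  proof
    show "coef (diagram ! m) \<noteq> 0" if "m < k * ?n" for m
      using diagram_edges(3)[OF nth_mem] that by (simp add: len)
    show "(\<Prod>m<k * ?n. holonomy (diagram ! m)) * \<rho> ^ k = 1"
      using holonomy_diagram lam mu by (simp add: len \<rho> field_simps)
  qed (use len cyc lett rgt lefts_diagram vert deg \<omega> \<theta>(2) in auto)
  have X: "presents (cone (band_complex Q I \<sigma> d\<sigma> l\<sigma> lam) (band_complex Q I \<tau> d\<tau> l\<tau> mu) F') G cone_matrix"
    unfolding G_def cone_matrix_def by (rule presents_cone[OF \<sigma> \<tau> F])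
  have Y: "presents (cpx_dsum {1..k} (\<lambda>i. band_complex Q I \<theta> (d\<sigma> - 1) l (\<omega> ^ i * \<rho>)))
      P.power_summands P.power_matrix"
    unfolding P.power_summands_def P.power_matrix_def
    using presents_band_sum[of "{1..k}" "\<lambda>_. \<theta>"] cyc by simp
  let ?S = P.split_matrix and ?J = P.join_matrix and ?H = "indices P.power_summands"
  have edges: "(\<Sum>m<k * ?n. edge_matrix (diagram ! m)) = word_matrix"
    using sum_edge_matrices by (simp add: len)
  show ?thesis
  proof (rule derived_iso_if_matrix_iso[OF X Y])
    show "between G P.power_summands 0 (U \<star> ?S)"
      using between_mmul[OF between_U(1) P.between_split] by simp
    show "between P.power_summands G 0 (mmul (indices G) ?J U')"
      using between_mmul[OF P.between_join between_U(2)] by simp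
    have "cone_matrix \<star> (U \<star> ?S) = U \<star> (word_matrix \<star> ?S)"
      by (simp only: mmul_assoc[symmetric] cone_chain)
    also have "\<dots> = mmul ?H (U \<star> ?S) P.power_matrix"
      using P.split_chain unfolding edges by (simp only: mmul_assoc)
    finally show "cone_matrix \<star> (U \<star> ?S) = mmul ?H (U \<star> ?S) P.power_matrix" .
    have "mmul ?H (U \<star> ?S) (?J \<star> U') = U \<star> (mmul ?H ?S ?J \<star> U')"
      by (simp only: mmul_assoc)
    also have "\<dots> = idm G"
      by (simp only: P.split_join idm_mmul[OF between_U(2) finG] U_inverse)
    finally show "mmul ?H (U \<star> ?S) (?J \<star> U') = idm G" .
    have "(?J \<star> U') \<star> (U \<star> ?S) = ?J \<star> ((U' \<star> U) \<star> ?S)"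
      by (simp only: mmul_assoc)
    also have "\<dots> = idm P.power_summands"
      by (simp only: P.join_split idm_mmul[OF P.between_split finG] U_inverse)
    finally show "(?J \<star> U') \<star> (U \<star> ?S) = idm P.power_summands" .
    show "mmul ?H P.power_matrix P.power_matrix = 0"
      unfolding P.power_summands_def P.power_matrix_def
      by (rule bands_matrix_square) (simp_all add: cyc)
  qed
qed

theorem proposition4p1:
  fixes Q :: "('v, 'a) pre_digraph"
    and I :: "('a \<times> 'a) set"
    and lam mu :: "'k::alg_closed_field"
    and \<sigma> \<tau> \<alpha> \<beta> \<gamma> \<delta> :: "'a letter list"
    and \<sigma>L \<sigma>R \<tau>L \<tau>R :: "'a letter"
    and f :: "'a list"
    and F :: "('v, 'a, 'k) cmap"
    and d\<sigma> d\<tau> :: int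
    and l\<sigma> l\<tau> :: nat
  assumes gentle: "gentle_algebra Q I"
    and band_\<sigma>: "homotopy_band Q I \<sigma>" "lam \<noteq> 0" "direct_position \<sigma> l\<sigma>"
    and band_\<tau>: "homotopy_band Q I \<tau>" "mu \<noteq> 0" "direct_position \<tau> l\<tau>"
    and \<sigma>_eq: "\<sigma> = \<beta> @ [\<sigma>L, \<sigma>R] @ \<alpha>"
    and \<tau>_eq: "\<tau> = \<delta> @ [\<tau>L, \<tau>R] @ \<gamma>"
    and single: "single_map Q I \<sigma> d\<sigma> l\<sigma> lam \<tau> d\<tau> l\<tau> mu (length \<beta> + 1) (length \<delta> + 1) f F"
    and oriented: "compatibly_oriented f \<sigma>R \<tau>R"
  shows "\<exists>\<theta> k. homotopy_band Q I \<theta> \<and> 1 \<le> k \<and>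
    walk (word_power \<theta> k) =
      reduced_walk (\<beta> @ [\<sigma>L] @ [Direct f] @ word_inv [\<tau>L] @ word_inv \<delta> @ word_inv \<gamma> @
        word_inv [\<tau>R] @ [Inverse f] @ [\<sigma>R] @ \<alpha>) \<and>
    (\<forall>l\<theta> \<omega> \<rho>. direct_position \<theta> l\<theta> \<and> primitive_root_of_unity k \<omega> \<and> \<rho> ^ k = - lam * inverse mu \<longrightarrow>
      derived_iso Q I
        (cone (band_complex Q I \<sigma> d\<sigma> l\<sigma> lam) (band_complex Q I \<tau> d\<tau> l\<tau> mu) F)
        (cpx_dsum {1..k} (\<lambda>i. band_complex Q I \<theta> (d\<sigma> - 1) l\<theta> (\<omega> ^ i * \<rho>))))"
proof -
  interpret gentle_algebra Q I by (rule gentle)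
  obtain p q where p: "p \<noteq> []" "\<sigma>R = Direct (f @ p)" and q: "q \<noteq> []" "\<tau>R = Inverse (q @ f)"
    using oriented by (auto simp: compatibly_oriented_def)
  have f: "f \<noteq> []" and degrees: "vertex_degree \<sigma> d\<sigma> (length \<beta> + 1) = vertex_degree \<tau> d\<tau> (length \<delta> + 1)"
    using single by (auto simp: single_map_def nontrivial_nonzero_def)
  interpret C: single_map_cone Q I \<sigma> \<tau> \<alpha> \<beta> \<gamma> \<delta> \<sigma>L \<tau>L f p q d\<sigma> d\<tau> l\<sigma> l\<tau> lam mu
    using homotopy_bandD[OF band_\<sigma>(1)] homotopy_bandD[OF band_\<tau>(1)] band_\<sigma> band_\<tau> \<sigma>_eq \<tau>_eq p q f degrees
    by unfold_locales simp_all
  have "C.W \<noteq> []" using C.cyclic_word_W by (simp add: cyclic_word_def)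
  then obtain \<theta> k where k: "1 \<le> k" and W: "C.W = word_power \<theta> k"
    and primitive: "\<not> (\<exists>v m. 2 \<le> m \<and> \<theta> = word_power v m)"
    using primitive_word_root by blast
  have \<theta>: "homotopy_band Q I \<theta>"
    using C.cyclic_word_W C.balance_W k primitive unfolding W by (rule homotopy_band_root)
  have "walk (word_power \<theta> k) = reduced_walk (\<beta> @ [\<sigma>L] @ [Direct f] @ word_inv [\<tau>L] @ word_inv \<delta> @
      word_inv \<gamma> @ word_inv [\<tau>R] @ [Inverse f] @ [\<sigma>R] @ \<alpha>)"
    unfolding p q W[symmetric] by (rule C.walk_W[symmetric])
  moreover have "single_map Q I \<sigma> d\<sigma> l\<sigma> lam \<tau> d\<tau> l\<tau> mu (Suc (length \<beta>)) (Suc (length \<delta>)) f F"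
    using single by simp
  note C.cone_decomposition[OF this W \<theta>]
  ultimately show ?thesis using \<theta> k by blast
qed

end
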